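(* Let $f\in\widehat{\mathcal{B}}$ and suppose that its post-singular set $\mathcal{P}=\overline{\bigcup_{n\ge 0} f^n(\mathcal{S}(f))}$ is bounded. Then every periodic dynamic ray of $f$ lands, i.e. for every periodic dynamic ray $g:(0,\infty)\to\mathbb{C}$ of $f$ the limit $\lim_{t\to 0} g(t)$ exists in $\mathbb{C}$; moreover the landing point $\lim_{t\to0}g(t)$ is a periodic point of $f$ which is either repelling or parabolic.
   Context: For an entire map $f:\mathbb{C}\to\mathbb{C}$, $f^n$ denotes the $n$-th iterate. The set of singular values $\mathcal{S}(f)\subset\mathbb{C}$ is the union of the critical values of $f$ (values $f(c)$ with $f'(c)=0$), the (finite) asymptotic values of $f$ (values $a\in\mathbb{C}$ for which there is a curve tending to $\infty$ whose image under $f$ lands at $a$), and the accumulation points of these. The closure in the definition of $\mathcal{P}$ is taken in $\mathbb{C}$. $\widehat{\mathcal{B}}$ is the class of all finite compositions $f_1\circ\cdots\circ f_m$ ($m\ge1$) of transcendental entire maps $f_j$ each of finite order (i.e. $\log\log|f_j(z)|=O(\log|z|)$ as $|f_j(z)|\to\infty$) and each having bounded set $\mathcal{S}(f_j)$ of singular values. Dynamic rays: a ray model dynamics is a continuous, unbounded, strictly increasing function $F:[0,\infty)\to[0,\infty)$, with $F(0)=0$ and $F^n(t)\to\infty$ as $n\to\infty$ for each $t>0$. A dynamic ray of $f$ is a continuous unbounded curve $g:(0,\infty)\to\mathbb{C}$ with $g(t)\to\infty$ as $t\to\infty$, consisting of escaping points ($f^n(g(t))\to\infty$ as $n\to\infty$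 for every $t>0$), which respects a ray model dynamics $F$, i.e. $f(g(t))=\tilde g(F(t))$ for all $t>0$ for some dynamic ray $\tilde g$. The ray $g$ is $k$-periodic ($k\ge1$ minimal) if $f^k(g)\subset g$; in that case $f^k(g(t))=g(F^k(t))$ for all $t>0$. A ray is periodic if it is $k$-periodic for some $k\ge 1$. The parameter $t$ is called the potential. A periodic point $p$ of period $q$ (so $f^q(p)=p$) is repelling if $|(f^q)'(p)|>1$, and parabolic if $(f^q)'(p)$ is a root of unity. *)

theory Defs
  imports "HOL-Complex_Analysis.Complex_Analysis" "HOL-Library.Landau_Symbols"
begin

definition entire :: "(complex \<Rightarrow> complex) \<Rightarrow> bool" where
  "entire f \<longleftrightarrow> f holomorphic_on UNIV"

definition transcendental_entire :: "(complex \<Rightarrow> complex) \<Rightarrow> bool" where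
  "transcendental_entire f \<longleftrightarrow> entire f \<and> \<not> (\<exists>p :: complex poly. \<forall>z. f z = poly p z)"

(* The filter "filtercomap f at_infinity" on the z-plane expresses "as |f z| tends to infinity". *)
definition finite_order :: "(complex \<Rightarrow> complex) \<Rightarrow> bool" where
  "finite_order f \<longleftrightarrow>
     (\<lambda>z. ln (ln (norm (f z)))) \<in> O[filtercomap f at_infinity](\<lambda>z. ln (norm z))"

definition critical_values :: "(complex \<Rightarrow> complex) \<Rightarrow> complex set" where
  "critical_values f = {f c | c. deriv f c = 0}"

definition asymptotic_values :: "(complex \<Rightarrow> complex) \<Rightarrow> complex set" where
  "asymptotic_values f =
     {a. \<exists>\<gamma> :: real \<Rightarrow> complex. continuous_on {0..} \<gamma> \<and> filterlim \<gamma> at_infinity at_top \<and>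
           ((\<lambda>t. f (\<gamma> t)) \<longlongrightarrow> a) at_top}"

definition singular_values :: "(complex \<Rightarrow> complex) \<Rightarrow> complex set" where
  "singular_values f =
     critical_values f \<union> asymptotic_values f \<union>
     {a. a islimpt (critical_values f \<union> asymptotic_values f)}"

definition postsingular_set :: "(complex \<Rightarrow> complex) \<Rightarrow> complex set" where
  "postsingular_set f = closure (\<Union>n. (f ^^ n) ` singular_values f)"

definition class_B_hat :: "(complex \<Rightarrow> complex) set" where
  "class_B_hat =
     {foldr (\<circ>) fs id | fs. fs \<noteq> [] \<and>
        (\<forall>h \<in> set fs. transcendental_entire h \<and> finite_order h \<and> bounded (singular_values h))}"

definition escaping :: "(complex \<Rightarrow> complex) \<Rightarrow> complex \<Rightarrow> bool" where
  "escaping f z \<longleftrightarrow> filterlim (\<lambda>n. (f ^^ n) z) at_infinity sequentially"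

(* Ray models and rays are total functions on the reals; only their values on [0,\<infinity>)
   and (0,\<infinity>), respectively, matter. *)
definition ray_model :: "(real \<Rightarrow> real) \<Rightarrow> bool" where
  "ray_model F \<longleftrightarrow>
     F ` {0..} \<subseteq> {0..} \<and> continuous_on {0..} F \<and> \<not> bounded (F ` {0..}) \<and>
     strict_mono_on {0..} F \<and> F 0 = 0 \<and>
     (\<forall>t>0. filterlim (\<lambda>n. (F ^^ n) t) at_top sequentially)"

(* "dynamic_ray f F g": g is a dynamic ray of f respecting the ray model F. The defining
   condition refers to another dynamic ray (the image ray, respecting the same model),
   so the notion is the greatest one satisfying it; an inductive reading would be empty. *)
coinductive dynamic_ray ::
    "(complex \<Rightarrow> complex) \<Rightarrow> (real \<Rightarrow> real) \<Rightarrow> (real \<Rightarrow> complex) \<Rightarrow> bool"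
  for f :: "complex \<Rightarrow> complex" and F :: "real \<Rightarrow> real" where
  "\<lbrakk>ray_model F;
    continuous_on {0<..} g; \<not> bounded (g ` {0<..}); filterlim g at_infinity at_top;
    \<forall>t>0. escaping f (g t);
    dynamic_ray f F g'; \<forall>t>0. f (g t) = g' (F t)\<rbrakk>
   \<Longrightarrow> dynamic_ray f F g"

(* The inclusion of f^k(g) in g is an inclusion of parametrised rays: potentials are
   transported by the model, f^k(g(t)) = g(F^k(t)). The bare inclusion of the traces does
   not imply this identity, since g may run back and forth along its trace. *)
definition ray_returns ::
    "(complex \<Rightarrow> complex) \<Rightarrow> (real \<Rightarrow> real) \<Rightarrow> (real \<Rightarrow> complex) \<Rightarrow> nat \<Rightarrow> bool" where
  "ray_returns f F g k \<longleftrightarrow>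
     (f ^^ k) ` g ` {0<..} \<subseteq> g ` {0<..} \<and> (\<forall>t>0. (f ^^ k) (g t) = g ((F ^^ k) t))"

definition k_periodic_ray :: "(complex \<Rightarrow> complex) \<Rightarrow> nat \<Rightarrow> (real \<Rightarrow> complex) \<Rightarrow> bool" where
  "k_periodic_ray f k g \<longleftrightarrow>
     (\<exists>F. dynamic_ray f F g \<and> k \<ge> 1 \<and> ray_returns f F g k \<and>
          (\<forall>j. 1 \<le> j \<and> j < k \<longrightarrow> \<not> ray_returns f F g j))"

definition periodic_ray :: "(complex \<Rightarrow> complex) \<Rightarrow> (real \<Rightarrow> complex) \<Rightarrow> bool" where
  "periodic_ray f g \<longleftrightarrow> (\<exists>k\<ge>1. k_periodic_ray f k g)"

definition has_period :: "(complex \<Rightarrow> complex) \<Rightarrow> nat \<Rightarrow> complex \<Rightarrow> bool" where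
  "has_period f q p \<longleftrightarrow>
     q \<ge> 1 \<and> (f ^^ q) p = p \<and> (\<forall>j. 1 \<le> j \<and> j < q \<longrightarrow> (f ^^ j) p \<noteq> p)"

definition repelling_point :: "(complex \<Rightarrow> complex) \<Rightarrow> complex \<Rightarrow> bool" where
  "repelling_point f p \<longleftrightarrow> (\<exists>q. has_period f q p \<and> norm (deriv (f ^^ q) p) > 1)"

definition parabolic_point :: "(complex \<Rightarrow> complex) \<Rightarrow> complex \<Rightarrow> bool" where
  "parabolic_point f p \<longleftrightarrow>
     (\<exists>q. has_period f q p \<and> (\<exists>n\<ge>1. deriv (f ^^ q) p ^ n = 1))"

end

theory Submission
  imports Defs "HOL-Real_Asymp.Real_Asymp"
begin

text \<open>
  Let \<open>P\<close> be the post-singular set and \<open>H = f^k\<close>, where \<open>k\<close> is the period of the ray \<open>g\<close>. Holomorphic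
  maps from discs into the complement of \<open>P\<close> lift through all iterates of \<open>H\<close>. The inverse
  branches of the iterates along \<open>g\<close> omit \<open>P\<close>, which has at least two points, so by the theorems
  of Schottky and Montel they form a normal family as soon as they are bounded at one point; as
  points of \<open>g\<close> escape, their limits are constant. Therefore every finite accumulation point
  of \<open>g(t)\<close> as \<open>t\<close> tends to 0 is fixed by \<open>H\<close>, and since fixed points are isolated, \<open>g\<close> lands at a fixed
  point or tends to infinity. The latter is impossible because, by Bloch's theorem, \<open>H\<close> is strongly
  expanding near infinity in logarithmic coordinates.

  The landing point is not attracting as points of \<open>g\<close> escape. If its multiplier has modulus 1
  but is not 1, then in a logarithmic coordinate at the landing point \<open>g\<close> becomes a curve
  whose imaginary part is unbounded. The local inverse of \<open>H\<close> maps this curve into itself,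
  so orbits to the left of the curve cannot cross it. Hence the iterates of the local inverse are
  bounded near the landing point, and they converge to it along \<open>g\<close>. So they converge to it locally
  uniformly, contradicting that their derivatives there have modulus 1.
\<close>

section \<open>Lifting through entire maps\<close>

text \<open>Covering theory is replaced by the property \<open>lifts_off\<close>: it passes to
  iterates because \<open>P\<close> is forward invariant, so the singular values of
  \<open>f^k\<close> never have to be determined. Schottky's and Bloch's theorems stand in for
  contraction of the hyperbolic metric.

  Transcendence enters in the form that \<open>H\<close> does not tend to infinity at infinity. A
  lift of \<open>exp\<close> with an imaginary period would make infinity a pole of
  \<open>H\<close>; hence such lifts are injective, and Bloch's theorem turns injectivity into
  expansion. The same estimate shows that \<open>P\<close> has two points.

  A ray may cross itself, so near an indifferent landing point it need not bound a domain; the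
  argument there uses that paths joining opposite sides of a box meet. As the ray is invariant under
  \<open>H\<close>, a logarithm along it determines a real rotation angle, not merely its class
  modulo 2 pi. Every non-zero angle is excluded, the rational ones included, so the multiplier for
  \<open>H\<close> is exactly 1. Other roots of unity appear when \<open>k\<close> is a proper
  multiple of the period of the landing point.\<close>

text \<open>The domain is a general metric space because the lemma compares holomorphic lifts on
  discs and half-planes as well as curves parametrised by potentials.\<close>

lemma lift_unique:
  fixes H :: "complex \<Rightarrow> complex" and p q :: "'a::metric_space \<Rightarrow> complex"
  assumes H: "H holomorphic_on UNIV" and U: "connected U"
    and p: "continuous_on U p" and q: "continuous_on U q"
    and eq: "\<And>x. x \<in> U \<Longrightarrow> H (p x) = H (q x)"
    and nz: "\<And>x. x \<in> U \<Longrightarrow> deriv H (p x) \<noteq> 0"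
    and a: "a \<in> U" "p a = q a" and b: "b \<in> U"
  shows "p b = q b"
proof (rule connected_induction_simple [OF U a(1) b, where P = "\<lambda>x. p x = q x", OF a(2)])
  fix c assume c: "c \<in> U"
  show "\<exists>T. openin (top_of_set U) T \<and> c \<in> T \<and> (\<forall>x\<in>T. \<forall>y\<in>T. p x = q x \<longrightarrow> p y = q y)"
  \<comment> \<open>Agreement persists nearby because \<open>H\<close> is injective near the common
    value, disagreement by continuity.\<close>
  proof (cases "p c = q c")
    case True
    obtain r where r: "r > 0" "inj_on H (ball (p c) r)"
      using has_complex_derivative_locally_injective [OF H _ open_UNIV nz [OF c]] by blast
    define T where "T = (U \<inter> p -` ball (p c) r) \<inter> (U \<inter> q -` ball (p c) r)"
    have "openin (top_of_set U) T"
      unfolding T_def using p q by (intro openin_Int continuous_openin_preimage_gen) auto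
    moreover have "c \<in> T" using c True r by (auto simp: T_def)
    moreover have "p y = q y" if "y \<in> T" for y
      using that eq [of y] r(2) by (auto simp: T_def inj_on_def)
    ultimately show ?thesis by blast
  next
    case False
    define T where "T = U \<inter> (\<lambda>x. p x - q x) -` (-{0})"
    have "openin (top_of_set U) T"
      unfolding T_def using p q by (intro continuous_openin_preimage_gen continuous_intros) auto
    moreover have "c \<in> T" using c False by (auto simp: T_def)
    moreover have "p y \<noteq> q y" if "y \<in> T" for y
      using that by (auto simp: T_def)
    ultimately show ?thesis by blast
  qed
qed

text \<open>The last clause makes \<open>\<xi>\<close> more than a right inverse: it recovers every
  point near \<open>z\<close> from its image. This identifies the branch with a lift or a ray known
  to pass close to \<open>z\<close>.\<close>

lemma local_inverse:
  fixes f :: "complex \<Rightarrow> complex"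
  assumes f: "f holomorphic_on UNIV" and nz: "deriv f z \<noteq> 0"
  obtains \<delta> \<epsilon> \<xi> where "\<delta> > 0" "\<epsilon> > 0" "\<xi> holomorphic_on ball (f z) \<delta>"
    "\<And>w. w \<in> ball (f z) \<delta> \<Longrightarrow> f (\<xi> w) = w"
    "\<And>x. dist x z < \<epsilon> \<Longrightarrow> f x \<in> ball (f z) \<delta> \<and> \<xi> (f x) = x"
proof -
  obtain r where r: "r > 0" "ball z r \<subseteq> UNIV" "open (f ` ball z r)" "inj_on f (ball z r)"
    by (rule has_complex_derivative_locally_invertible [OF f UNIV_I open_UNIV nz])
  have fh: "f holomorphic_on ball z r" using f holomorphic_on_subset by blast
  obtain g where g: "g holomorphic_on (f ` ball z r)" "\<And>x. x \<in> ball z r \<Longrightarrow> g (f x) = x"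
    using holomorphic_has_inverse [OF fh open_ball r(4)] by metis
  obtain \<delta> where \<delta>: "\<delta> > 0" "ball (f z) \<delta> \<subseteq> f ` ball z r"
    using r(1,3) by (meson centre_in_ball imageI openE)
  have "isCont f z"
    using f holomorphic_on_imp_continuous_on continuous_on_eq_continuous_at by blast
  then obtain \<epsilon>0 where e0: "\<epsilon>0 > 0" "\<And>x. dist x z < \<epsilon>0 \<Longrightarrow> dist (f x) (f z) < \<delta>"
    using \<delta>(1) unfolding continuous_at_eps_delta by blast
  show thesis
  proof (rule that [of \<delta> "min \<epsilon>0 r" g])
    show "g holomorphic_on ball (f z) \<delta>" using g(1) \<delta>(2) holomorphic_on_subset by blast
    show "f (g w) = w" if "w \<in> ball (f z) \<delta>" for w
      using that \<delta>(2) g(2) by force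
    show "f x \<in> ball (f z) \<delta> \<and> g (f x) = x" if "dist x z < min \<epsilon>0 r" for x
      using that e0(2)[of x] g(2)[of x] by (auto simp: dist_commute)
  qed (use \<delta> e0 r in auto)
qed

section \<open>The disc lifting property\<close>

text \<open>A substitute for \<open>H\<close> being a covering over the complement of
  \<open>P\<close>. Taking an arbitrary map \<open>e\<close> instead of the inclusion of a disc
  allows \<open>exp\<close> to be lifted and lets a lift serve as the next \<open>e\<close> when
  maps are composed.\<close>

definition lifts_off :: "(complex \<Rightarrow> complex) \<Rightarrow> complex set \<Rightarrow> bool" where
  "lifts_off H P \<longleftrightarrow> (\<forall>e u0 R z0. e holomorphic_on ball u0 R \<longrightarrow> e ` ball u0 R \<subseteq> -P \<longrightarrow>
     H z0 = e u0 \<longrightarrow> R > 0 \<longrightarrow>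
     (\<exists>\<Phi>. \<Phi> holomorphic_on ball u0 R \<and> \<Phi> u0 = z0 \<and> (\<forall>u\<in>ball u0 R. H (\<Phi> u) = e u)))"

text \<open>Along the radius ending at \<open>us\<close> the lift accumulates at a finite point
  \<open>zs\<close> with \<open>f zs = e us\<close>. As \<open>e us\<close> is outside
  \<open>P\<close>, \<open>zs\<close> is not critical, and the local inverse of \<open>f\<close>
  there, composed with \<open>e\<close>, continues the lift across \<open>us\<close>.\<close>

lemma lift_extends_locally:
  fixes f :: "complex \<Rightarrow> complex"
  assumes f: "f holomorphic_on UNIV"
    and crit: "\<And>z. f z \<notin> P \<Longrightarrow> deriv f z \<noteq> 0"
    and asym: "asymptotic_values f \<subseteq> P"
    and e: "e holomorphic_on ball u0 R" "e ` ball u0 R \<subseteq> -P"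
    and r: "0 < r" "r < R"
    and \<phi>: "\<phi> holomorphic_on ball u0 r" "\<And>u. u \<in> ball u0 r \<Longrightarrow> f (\<phi> u) = e u"
    and us: "us \<in> sphere u0 r"
  shows "\<exists>\<delta> \<xi>. \<delta> > 0 \<and> ball us \<delta> \<subseteq> ball u0 R \<and> \<xi> holomorphic_on ball us \<delta> \<and>
    (\<forall>u\<in>ball us \<delta>. f (\<xi> u) = e u) \<and> (\<forall>u\<in>ball us \<delta> \<inter> ball u0 r. \<xi> u = \<phi> u)"
proof -
  \<comment> \<open>\<open>\<phi>\<close> along the radius ending at \<open>us\<close> does not tend to infinity, as \<open>e us\<close> is not an asymptotic value.\<close>
  define v where "v s = u0 + of_real (s / (1 + s)) * (us - u0)" for s :: real
  have frac: "0 \<le> s / (1+s)" "s / (1+s) < 1" if "s \<ge> 0" for s :: real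
    using that by (auto simp: field_simps)
  have vin: "v s \<in> ball u0 r" if "s \<ge> 0" for s
  proof -
    have "dist u0 (v s) = s / (1+s) * r"
      using us that by (simp add: v_def dist_norm norm_mult norm_minus_commute norm_divide del: of_real_divide)
    also have "\<dots> < 1 * r" using frac[OF that] r by (intro mult_strict_right_mono) auto
    finally show ?thesis by simp
  qed
  have usR: "us \<in> ball u0 R" using us r by auto
  have vlim: "(v \<longlongrightarrow> us) at_top"
  proof -
    have "((\<lambda>s::real. s / (1 + s)) \<longlongrightarrow> 1) at_top" by real_asymp
    then have "((\<lambda>s. u0 + of_real (s / (1 + s)) * (us - u0)) \<longlongrightarrow> u0 + of_real 1 * (us - u0)) at_top"
      by (intro tendsto_intros)
    then show ?thesis by (simp add: v_def[abs_def])
  qed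
  have econt: "isCont e us"
    using e(1) usR by (metis continuous_on_eq_continuous_at holomorphic_on_imp_continuous_on open_ball)
  define \<gamma> where "\<gamma> s = \<phi> (v s)" for s
  have vcont: "continuous_on {0..} v"
    unfolding v_def by (intro continuous_intros) auto
  have \<gamma>cont: "continuous_on {0..} \<gamma>"
    unfolding \<gamma>_def using vcont vin
    by (intro continuous_on_compose2 [OF holomorphic_on_imp_continuous_on [OF \<phi>(1)]]) auto
  have elim: "((\<lambda>s. e (v s)) \<longlongrightarrow> e us) at_top"
    using isCont_tendsto_compose [OF econt vlim] .
  have f\<gamma>: "f (\<gamma> s) = e (v s)" if "s \<ge> 0" for s
    unfolding \<gamma>_def using \<phi>(2) vin that by blast
  have flim: "((\<lambda>s. f (\<gamma> s)) \<longlongrightarrow> e us) at_top"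
    by (rule Lim_transform_eventually [OF elim]) (auto intro!: eventually_at_top_linorderI [of 0] simp: f\<gamma>)
  have "e us \<notin> P" using e(2) usR by blast
  then have "\<not> filterlim \<gamma> at_infinity at_top"
    using asym \<gamma>cont flim unfolding asymptotic_values_def by blast
  then obtain B where "\<not> eventually (\<lambda>s. B \<le> norm (\<gamma> s)) at_top"
    by (auto simp: filterlim_at_infinity [of 0])
  then have "\<forall>n::nat. \<exists>s\<ge>real n. norm (\<gamma> s) < B"
    by (auto simp: eventually_at_top_linorder not_le)
  then obtain s where s: "\<And>n. s n \<ge> real n" "\<And>n. norm (\<gamma> (s n)) < B" by metis
  have "\<forall>n. \<gamma> (s n) \<in> cball 0 B" using s(2) by (auto simp: less_imp_le)
  moreover have "seq_compact (cball (0::complex) B)"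
    using compact_cball by (simp add: seq_compact_eq_compact)
  ultimately obtain zs \<sigma> where zs': "strict_mono \<sigma>" "((\<lambda>n. \<gamma> (s n)) \<circ> \<sigma>) \<longlonglongrightarrow> zs"
    by (metis seq_compactE)
  then have zs: "strict_mono \<sigma>" "(\<lambda>n. \<gamma> (s (\<sigma> n))) \<longlonglongrightarrow> zs" by (auto simp: comp_def)
  have slim: "filterlim (\<lambda>n. s (\<sigma> n)) at_top sequentially"
  proof (rule filterlim_at_top_mono)
    show "filterlim (\<lambda>n. real (\<sigma> n)) at_top sequentially"
      using filterlim_compose [OF filterlim_real_sequentially filterlim_subseq [OF zs(1)]] .
  qed (auto simp: s)
  have fcont: "isCont f x" for x
    using f holomorphic_on_imp_continuous_on continuous_on_eq_continuous_at by blast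
  have "(\<lambda>n. f (\<gamma> (s (\<sigma> n)))) \<longlonglongrightarrow> f zs" using isCont_tendsto_compose [OF fcont zs(2)] .
  moreover have "(\<lambda>n. f (\<gamma> (s (\<sigma> n)))) \<longlonglongrightarrow> e us" using filterlim_compose [OF flim slim] .
  ultimately have fzs: "f zs = e us" using LIMSEQ_unique by blast
  obtain \<delta>0 \<epsilon> \<xi>0 where L: "\<delta>0 > 0" "\<epsilon> > 0" "\<xi>0 holomorphic_on ball (f zs) \<delta>0"
    "\<And>w. w \<in> ball (f zs) \<delta>0 \<Longrightarrow> f (\<xi>0 w) = w"
    "\<And>x. dist x zs < \<epsilon> \<Longrightarrow> f x \<in> ball (f zs) \<delta>0 \<and> \<xi>0 (f x) = x"
    using local_inverse [OF f crit [of zs]] \<open>e us \<notin> P\<close> fzs by metis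
  obtain \<delta>1 where d1: "\<delta>1 > 0" "\<And>x. dist x us < \<delta>1 \<Longrightarrow> dist (e x) (e us) < \<delta>0"
    using econt L(1) unfolding continuous_at_eps_delta by blast
  define \<delta> where "\<delta> = min \<delta>1 (R - r)"
  have \<delta>: "\<delta> > 0" using d1 r by (simp add: \<delta>_def)
  have sub: "ball us \<delta> \<subseteq> ball u0 R"
  proof
    fix x assume "x \<in> ball us \<delta>"
    then have "dist us x < R - r" by (simp add: \<delta>_def)
    moreover have "dist u0 us = r" using us by simp
    ultimately show "x \<in> ball u0 R" using dist_triangle [of u0 x us] by simp
  qed
  have eball: "e x \<in> ball (f zs) \<delta>0" if "x \<in> ball us \<delta>" for x
    using that d1(2)[of x] by (simp add: fzs \<delta>_def dist_commute)
  have hol: "(\<lambda>x. \<xi>0 (e x)) holomorphic_on ball us \<delta>"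
    using holomorphic_on_compose_gen [OF holomorphic_on_subset [OF e(1) sub] L(3) image_subsetI [OF eball]]
    by (simp add: comp_def)
  have lift: "f (\<xi>0 (e x)) = e x" if "x \<in> ball us \<delta>" for x
    using L(4) eball that by blast
  \<comment> \<open>One point of the radius that is close to \<open>us\<close> and whose lift is
    close to \<open>zs\<close> is enough: there both branches agree, and \<open>lift_unique\<close>
    spreads this over the convex intersection.\<close>
  have "eventually (\<lambda>n. dist (\<gamma> (s (\<sigma> n))) zs < \<epsilon>) sequentially"
    using zs(2) L(2) by (simp add: tendstoD)
  moreover have "eventually (\<lambda>n. dist (v (s (\<sigma> n))) us < \<delta>) sequentially"
    using filterlim_compose [OF vlim slim] \<delta> by (simp add: tendstoD)
  ultimately have "eventually (\<lambda>n. dist (\<gamma> (s (\<sigma> n))) zs < \<epsilon> \<and> dist (v (s (\<sigma> n))) us < \<delta>) sequentially"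
    by (rule eventually_conj)
  then obtain n where n: "dist (\<gamma> (s (\<sigma> n))) zs < \<epsilon>" "dist (v (s (\<sigma> n))) us < \<delta>"
    using eventually_happens' sequentially_bot by blast
  define w where "w = v (s (\<sigma> n))"
  have s0: "s (\<sigma> n) \<ge> 0" using s(1)[of "\<sigma> n"] by linarith
  have w: "w \<in> ball us \<delta> \<inter> ball u0 r" using n(2) vin[OF s0] by (auto simp: w_def dist_commute)
  have "\<xi>0 (f (\<phi> w)) = \<phi> w" using L(5) n(1) by (simp add: w_def \<gamma>_def)
  then have agree: "\<xi>0 (e w) = \<phi> w" using \<phi>(2) w by auto
  have "\<xi>0 (e u) = \<phi> u" if u: "u \<in> ball us \<delta> \<inter> ball u0 r" for u
  proof (rule lift_unique [OF f _ _ _ _ _ w _ u, where p = "\<lambda>x. \<xi>0 (e x)" and q = \<phi>])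
    show "connected (ball us \<delta> \<inter> ball u0 r)"
      by (intro convex_connected convex_Int convex_ball)
    show "continuous_on (ball us \<delta> \<inter> ball u0 r) (\<lambda>x. \<xi>0 (e x))"
      using hol by (meson holomorphic_on_imp_continuous_on holomorphic_on_subset inf_le1)
    show "continuous_on (ball us \<delta> \<inter> ball u0 r) \<phi>"
      using \<phi>(1) by (meson holomorphic_on_imp_continuous_on holomorphic_on_subset inf_le2)
    show "f (\<xi>0 (e x)) = f (\<phi> x)" if "x \<in> ball us \<delta> \<inter> ball u0 r" for x
      using that lift \<phi>(2) by auto
    show "deriv f (\<xi>0 (e x)) \<noteq> 0" if "x \<in> ball us \<delta> \<inter> ball u0 r" for x
    proof (rule crit)
      have "e x \<notin> P" using that sub e(2) by blast
      then show "f (\<xi>0 (e x)) \<notin> P" using that lift[of x] by simp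
    qed
    show "\<xi>0 (e w) = \<phi> w" by (rule agree)
  qed
  then show ?thesis using \<delta> sub hol lift by blast
qed

text \<open>The supremum of the radii that admit a lift is \<open>R\<close>: at a smaller supremum,
  the local continuations through the points of the bounding circle are mutually consistent and, by
  compactness, cover a larger disc.\<close>

lemma lifts_offI:
  fixes f :: "complex \<Rightarrow> complex"
  assumes f: "f holomorphic_on UNIV"
    and crit: "\<And>z. f z \<notin> P \<Longrightarrow> deriv f z \<noteq> 0"
    and asym: "asymptotic_values f \<subseteq> P"
  shows "lifts_off f P"
  unfolding lifts_off_def
proof (intro allI impI)
  fix e u0 R z0
  assume e: "e holomorphic_on ball u0 R" "e ` ball u0 R \<subseteq> -P" and z0: "f z0 = e u0" and R: "(R::real) > 0"
  have eP: "e x \<notin> P" if "x \<in> ball u0 R" for x using e(2) that by blast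
  define good where "good r \<phi> \<longleftrightarrow> \<phi> holomorphic_on ball u0 r \<and> \<phi> u0 = z0 \<and> (\<forall>u\<in>ball u0 r. f (\<phi> u) = e u)" for r \<phi>
  have unq: "\<phi> u = \<phi>' u" if g: "good r \<phi>" "good r' \<phi>'" and r: "r \<le> R" "u \<in> ball u0 r" "u \<in> ball u0 r'" for r r' \<phi> \<phi>' u
  proof (rule lift_unique [OF f, where U="ball u0 r \<inter> ball u0 r'" and a=u0 and b=u and p=\<phi> and q="\<phi>'"])
    show "connected (ball u0 r \<inter> ball u0 r')"
      by (intro convex_connected convex_Int convex_ball)
    show "continuous_on (ball u0 r \<inter> ball u0 r') \<phi>"
      using g(1) unfolding good_def by (meson holomorphic_on_imp_continuous_on holomorphic_on_subset inf_le1)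
    show "continuous_on (ball u0 r \<inter> ball u0 r') \<phi>'"
      using g(2) unfolding good_def by (meson holomorphic_on_imp_continuous_on holomorphic_on_subset inf_le2)
    show "f (\<phi> x) = f (\<phi>' x)" if "x \<in> ball u0 r \<inter> ball u0 r'" for x
      using that g by (auto simp: good_def)
    show "deriv f (\<phi> x) \<noteq> 0" if "x \<in> ball u0 r \<inter> ball u0 r'" for x
    proof (rule crit)
      have "x \<in> ball u0 R" using that r by auto
      then have "e x \<notin> P" by (rule eP)
      then show "f (\<phi> x) \<notin> P" using that g(1) by (auto simp: good_def)
    qed
    have "dist u0 u < r" "dist u0 u < r'" using r by auto
    then have "0 < r" "0 < r'" using zero_le_dist[of u0 u] by linarith+
    then show "u0 \<in> ball u0 r \<inter> ball u0 r'" by auto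
    show "\<phi> u0 = \<phi>' u0" using g by (auto simp: good_def)
  qed (use r in auto)
  define M where "M = {r. 0 < r \<and> r \<le> R \<and> (\<exists>\<phi>. good r \<phi>)}"
  have "\<exists>r. r \<in> M"
  proof -
    have econt: "isCont e u0"
      using e(1) R by (metis centre_in_ball continuous_on_eq_continuous_at holomorphic_on_imp_continuous_on open_ball)
    have "f z0 \<notin> P" using z0 eP[of u0] R by simp
    then obtain \<delta>0 \<epsilon> \<xi>0 where L: "\<delta>0 > 0" "\<epsilon> > 0" "\<xi>0 holomorphic_on ball (f z0) \<delta>0"
      "\<And>w. w \<in> ball (f z0) \<delta>0 \<Longrightarrow> f (\<xi>0 w) = w"
      "\<And>x. dist x z0 < \<epsilon> \<Longrightarrow> f x \<in> ball (f z0) \<delta>0 \<and> \<xi>0 (f x) = x"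
      using local_inverse [OF f crit [of z0]] by metis
    obtain \<delta>1 where d1: "\<delta>1 > 0" "\<And>x. dist x u0 < \<delta>1 \<Longrightarrow> dist (e x) (e u0) < \<delta>0"
      using econt L(1) unfolding continuous_at_eps_delta by blast
    define r where "r = min \<delta>1 R"
    have eball: "e x \<in> ball (f z0) \<delta>0" if "x \<in> ball u0 r" for x
      using that d1(2)[of x] by (simp add: z0 r_def dist_commute)
    have sub: "ball u0 r \<subseteq> ball u0 R" by (auto simp: r_def)
    have "(\<lambda>x. \<xi>0 (e x)) holomorphic_on ball u0 r"
      using holomorphic_on_compose_gen [OF holomorphic_on_subset [OF e(1) sub] L(3) image_subsetI [OF eball]]
      by (simp add: comp_def)
    then have "good r (\<lambda>x. \<xi>0 (e x))"
      unfolding good_def using L(2,4) eball L(5)[of z0] z0 by auto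
    moreover have "0 < r" "r \<le> R" using d1 R by (auto simp: r_def)
    ultimately show ?thesis unfolding M_def by blast
  qed
  then have Mne: "M \<noteq> {}" by blast
  have Mbdd: "bdd_above M" unfolding M_def by (intro bdd_aboveI[of _ R]) auto
  define rs where "rs = Sup M"
  have rs: "0 < rs" "rs \<le> R"
    using Mne Mbdd unfolding rs_def
    by (auto simp: less_cSup_iff M_def intro!: cSup_least)
  have "\<forall>r\<in>M. \<exists>\<phi>. good r \<phi>" unfolding M_def by blast
  then obtain \<Psi> where \<Psi>: "\<And>r. r \<in> M \<Longrightarrow> good r (\<Psi> r)" by metis
  \<comment> \<open>The arbitrary choice of a radius is harmless: by \<open>unq\<close>, lifts on
    two discs agree where both are defined.\<close>
  define \<phi> where "\<phi> u = \<Psi> (SOME r. r \<in> M \<and> u \<in> ball u0 r) u" for u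
  have \<phi>eq: "\<phi> u = \<Psi> r u" if "r \<in> M" "u \<in> ball u0 r" for r u
  proof -
    define s where "s = (SOME r. r \<in> M \<and> u \<in> ball u0 r)"
    have s: "s \<in> M \<and> u \<in> ball u0 s"
      unfolding s_def using that by (intro someI[where P="\<lambda>r. r \<in> M \<and> u \<in> ball u0 r"]) blast
    then have "s \<le> R" by (simp add: M_def)
    then have "\<Psi> s u = \<Psi> r u"
      using unq[OF \<Psi> \<Psi>] s that by blast
    then show ?thesis by (simp add: \<phi>_def s_def)
  qed
  have ex: "\<exists>r\<in>M. u \<in> ball u0 r" if "u \<in> ball u0 rs" for u
    using that Mne Mbdd by (auto simp: rs_def less_cSup_iff)
  have goodrs: "good rs \<phi>"
    unfolding good_def
  proof (intro conjI ballI)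
    show "\<phi> u0 = z0"
      using ex[of u0] rs \<phi>eq \<Psi> unfolding good_def by (metis centre_in_ball)
    show "f (\<phi> u) = e u" if "u \<in> ball u0 rs" for u
      using ex[OF that] \<phi>eq \<Psi> unfolding good_def by metis
    have "\<phi> field_differentiable at u" if u: "u \<in> ball u0 rs" for u
    proof -
      obtain r where r: "r \<in> M" "u \<in> ball u0 r" using ex[OF u] by blast
      have "\<Psi> r holomorphic_on ball u0 r" using \<Psi>[OF r(1)] by (simp add: good_def)
      then have "\<phi> holomorphic_on ball u0 r"
        by (rule holomorphic_transform) (rule \<phi>eq[OF r(1), symmetric])
      then show ?thesis using r(2) by (rule holomorphic_on_imp_differentiable_at[OF _ open_ball])
    qed
    then show "\<phi> holomorphic_on ball u0 rs"
      by (simp add: holomorphic_on_def field_differentiable_at_within)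
  qed
  have "rs = R"
  proof (rule ccontr)
    assume "rs \<noteq> R"
    with rs have rsR: "rs < R" by simp
    have \<phi>h: "\<phi> holomorphic_on ball u0 rs" "\<And>u. u \<in> ball u0 rs \<Longrightarrow> f (\<phi> u) = e u"
      using goodrs by (auto simp: good_def)
    have "\<forall>us\<in>sphere u0 rs. \<exists>\<delta> \<xi>. \<delta> > 0 \<and> ball us \<delta> \<subseteq> ball u0 R \<and> \<xi> holomorphic_on ball us \<delta> \<and>
       (\<forall>u\<in>ball us \<delta>. f (\<xi> u) = e u) \<and> (\<forall>u\<in>ball us \<delta> \<inter> ball u0 rs. \<xi> u = \<phi> u)"
      using lift_extends_locally [OF f crit asym e rs(1) rsR \<phi>h] by blast
    then obtain \<delta> \<xi> where D: "\<And>us. us \<in> sphere u0 rs \<Longrightarrow> \<delta> us > 0 \<and> ball us (\<delta> us) \<subseteq> ball u0 R \<and> \<xi> us holomorphic_on ball us (\<delta> us) \<and>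
       (\<forall>u\<in>ball us (\<delta> us). f (\<xi> us u) = e u) \<and> (\<forall>u\<in>ball us (\<delta> us) \<inter> ball u0 rs. \<xi> us u = \<phi> u)"
      by metis
    have cons: "\<xi> u1 u = \<xi> u2 u" if u12: "u1 \<in> sphere u0 rs" "u2 \<in> sphere u0 rs" and u: "u \<in> ball u1 (\<delta> u1)" "u \<in> ball u2 (\<delta> u2)" for u1 u2 u
    proof (cases "u1 = u2")
      case False
      \<comment> \<open>Both discs contain a point of the segment joining their centres, which lies in \<open>ball u0 rs\<close>.\<close>
      let ?U = "ball u1 (\<delta> u1) \<inter> ball u2 (\<delta> u2)"
      note d1 = D[OF u12(1)] and d2 = D[OF u12(2)]
      \<comment> \<open>Dividing the segment in the ratio of the radii puts \<open>q\<close> into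
        both discs, because the distance of the centres is less than the sum of the radii.\<close>
      define \<tau> where "\<tau> = \<delta> u1 / (\<delta> u1 + \<delta> u2)"
      have \<tau>: "0 < \<tau>" "\<tau> < 1" using d1 d2 by (auto simp: \<tau>_def field_simps)
      define q where "q = (1 - \<tau>) *\<^sub>R u1 + \<tau> *\<^sub>R u2"
      have qseg: "q \<in> open_segment u1 u2"
        using False \<tau> by (auto simp: in_segment q_def)
      have ds: "dist u1 u2 < \<delta> u1 + \<delta> u2"
        using u dist_triangle[of u1 u2 u] by (simp add: dist_commute)
      have "dist q u0 < dist u1 u0 \<or> dist q u0 < dist u2 u0"
        using dist_decreases_open_segment[OF qseg, of u0] by (simp add: dist_commute)
      then have q0: "q \<in> ball u0 rs" using u12 by (auto simp: dist_commute)
      have "dist u1 q = \<tau> * dist u1 u2"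
      proof -
        have "u1 - q = \<tau> *\<^sub>R (u1 - u2)" by (simp add: q_def algebra_simps)
        then show ?thesis using \<tau> by (simp add: dist_norm)
      qed
      also have "\<dots> < \<tau> * (\<delta> u1 + \<delta> u2)" using ds \<tau> by simp
      also have "\<dots> = \<delta> u1" using d1 d2 by (simp add: \<tau>_def)
      finally have q1: "q \<in> ball u1 (\<delta> u1)" by simp
      have "dist u2 q = (1 - \<tau>) * dist u1 u2"
      proof -
        have "u2 - q = (1 - \<tau>) *\<^sub>R (u2 - u1)" by (simp add: q_def algebra_simps)
        then show ?thesis using \<tau> by (simp add: dist_norm norm_minus_commute)
      qed
      also have "\<dots> < (1 - \<tau>) * (\<delta> u1 + \<delta> u2)" using ds \<tau> by simp
      also have "\<dots> = \<delta> u2" using d1 d2 by (simp add: \<tau>_def field_simps)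
      finally have q2: "q \<in> ball u2 (\<delta> u2)" by simp
      show ?thesis
      proof (rule lift_unique [OF f, where U = ?U and a = q and b = u and p = "\<xi> u1" and q = "\<xi> u2"])
        show "connected ?U" by (intro convex_connected convex_Int convex_ball)
        show "continuous_on ?U (\<xi> u1)"
          using d1 by (meson holomorphic_on_imp_continuous_on holomorphic_on_subset inf_le1)
        show "continuous_on ?U (\<xi> u2)"
          using d2 by (meson holomorphic_on_imp_continuous_on holomorphic_on_subset inf_le2)
        show "f (\<xi> u1 x) = f (\<xi> u2 x)" if "x \<in> ?U" for x using that d1 d2 by auto
        show "deriv f (\<xi> u1 x) \<noteq> 0" if "x \<in> ?U" for x
        proof (rule crit)
          have "x \<in> ball u0 R" using that d1 by auto
          then show "f (\<xi> u1 x) \<notin> P" using that d1 eP[of x] by auto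
        qed
        show "\<xi> u1 q = \<xi> u2 q" using d1 d2 q0 q1 q2 by auto
      qed (use u q1 q2 in auto)
    qed auto
    define N where "N = ball u0 rs \<union> (\<Union>us\<in>sphere u0 rs. ball us (\<delta> us))"
    have "open N" unfolding N_def by auto
    moreover have "cball u0 rs \<subseteq> N"
    proof
      fix x assume "x \<in> cball u0 rs"
      then consider "x \<in> ball u0 rs" | "x \<in> sphere u0 rs" by force
      then show "x \<in> N"
      proof cases
        case 2 then show ?thesis using D[OF 2] unfolding N_def by (meson UN_I UnI2 centre_in_ball)
      qed (auto simp: N_def)
    qed
    ultimately obtain \<epsilon> where \<epsilon>: "\<epsilon> > 0" "(\<Union>x\<in>cball u0 rs. ball x \<epsilon>) \<subseteq> N"
      using compact_subset_open_imp_ball_epsilon_subset [of "cball u0 rs" N] by auto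
    define r' where "r' = min (rs + \<epsilon> / 2) R"
    have r': "rs < r'" "r' \<le> R" "r' < rs + \<epsilon>" using \<epsilon> rsR by (auto simp: r'_def)
    have sub: "ball u0 r' \<subseteq> N"
    proof
      fix x assume x: "x \<in> ball u0 r'"
      show "x \<in> N"
      proof (cases "x \<in> ball u0 rs")
        case False
        define y where "y = u0 + of_real (rs / dist u0 x) * (x - u0)"
        have dx: "dist u0 x \<ge> rs" "dist u0 x > 0" using False rs(1) by auto
        have "dist u0 y = rs"
          using dx rs by (simp add: y_def dist_norm norm_mult norm_divide norm_minus_commute)
        moreover have "dist y x = dist u0 x - rs"
        proof -
          have "x - y = of_real (1 - rs / dist u0 x) * (x - u0)" by (simp add: y_def algebra_simps)
          then have "dist y x = \<bar>1 - rs / dist u0 x\<bar> * dist u0 x"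
            by (metis dist_commute dist_norm norm_mult norm_of_real real_norm_def)
          also have "\<dots> = dist u0 x - rs" using dx by (simp add: field_simps)
          finally show ?thesis .
        qed
        ultimately have "y \<in> cball u0 rs" "x \<in> ball y \<epsilon>" using x r' by auto
        then show ?thesis using \<epsilon>(2) by blast
      qed (auto simp: N_def)
    qed
    define \<phi>' where "\<phi>' u = (if u \<in> ball u0 rs then \<phi> u else \<xi> (SOME us. us \<in> sphere u0 rs \<and> u \<in> ball us (\<delta> us)) u)" for u
    have eq1: "\<phi>' u = \<phi> u" if "u \<in> ball u0 rs" for u using that by (simp add: \<phi>'_def)
    have eq2: "\<phi>' u = \<xi> us u" if "us \<in> sphere u0 rs" "u \<in> ball us (\<delta> us)" for u us
    proof (cases "u \<in> ball u0 rs")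
      case True then show ?thesis using that D[OF that(1)] eq1 by auto
    next
      case False
      define s where "s = (SOME us. us \<in> sphere u0 rs \<and> u \<in> ball us (\<delta> us))"
      have s: "s \<in> sphere u0 rs \<and> u \<in> ball s (\<delta> s)"
        unfolding s_def using that by (intro someI[where P="\<lambda>us. us \<in> sphere u0 rs \<and> u \<in> ball us (\<delta> us)"]) blast
      then have "\<xi> s u = \<xi> us u" using that cons by blast
      then show ?thesis using False by (simp add: \<phi>'_def s_def)
    qed
    have loc: "\<phi>' field_differentiable at u \<and> f (\<phi>' u) = e u" if u: "u \<in> ball u0 r'" for u
    proof -
      consider "u \<in> ball u0 rs" | us where "us \<in> sphere u0 rs" "u \<in> ball us (\<delta> us)"
        using sub u by (auto simp: N_def)
      then show ?thesis
      proof cases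
        case 1
        have "\<phi>' holomorphic_on ball u0 rs"
          by (rule holomorphic_transform[OF \<phi>h(1)]) (simp add: eq1)
        then have "\<phi>' field_differentiable at u"
          using 1 by (rule holomorphic_on_imp_differentiable_at[OF _ open_ball])
        then show ?thesis using 1 \<phi>h(2) eq1 by auto
      next
        case 2
        have "\<phi>' holomorphic_on ball us (\<delta> us)"
          by (rule holomorphic_transform[of "\<xi> us"]) (use D[OF 2(1)] eq2[OF 2(1)] in auto)
        then have "\<phi>' field_differentiable at u"
          using 2(2) by (rule holomorphic_on_imp_differentiable_at[OF _ open_ball])
        then show ?thesis using 2 D[OF 2(1)] eq2 by auto
      qed
    qed
    have "good r' \<phi>'"
      unfolding good_def
    proof (intro conjI)
      show "\<phi>' holomorphic_on ball u0 r'"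
        using loc by (simp add: holomorphic_on_def field_differentiable_at_within)
      show "\<phi>' u0 = z0" using eq1[of u0] rs(1) goodrs by (auto simp: good_def)
      show "\<forall>u\<in>ball u0 r'. f (\<phi>' u) = e u" using loc by blast
    qed
    then have "r' \<in> M" using r' rs by (auto simp: M_def)
    then have "r' \<le> rs" unfolding rs_def using Mbdd by (rule cSup_upper)
    with r' show False by simp
  qed
  then show "\<exists>\<Phi>. \<Phi> holomorphic_on ball u0 R \<and> \<Phi> u0 = z0 \<and> (\<forall>u\<in>ball u0 R. f (\<Phi> u) = e u)"
    using goodrs unfolding good_def by blast
qed

lemma lifts_offD:
  assumes "lifts_off H P" "e holomorphic_on ball u0 R" "\<And>u. u \<in> ball u0 R \<Longrightarrow> e u \<notin> P" "H z0 = e u0" "R > 0"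
  obtains \<Phi> where "\<Phi> holomorphic_on ball u0 R" "\<Phi> u0 = z0" "\<And>u. u \<in> ball u0 R \<Longrightarrow> H (\<Phi> u) = e u"
proof -
  have "e ` ball u0 R \<subseteq> -P" using assms(3) by blast
  then show thesis using assms(1,2,4,5) that unfolding lifts_off_def by metis
qed

text \<open>The lift through \<open>H\<close> omits \<open>P\<close>, since \<open>H\<close> would
  map a value in \<open>P\<close> into \<open>P\<close>, which \<open>e\<close> avoids. So it can in
  turn be lifted through \<open>K\<close>.\<close>

lemma lifts_off_comp:
  assumes H: "lifts_off H P" "H ` P \<subseteq> P" and K: "lifts_off K P"
  shows "lifts_off (\<lambda>z. H (K z)) P"
  unfolding lifts_off_def
proof (intro allI impI)
  fix e u0 R z0
  assume e: "e holomorphic_on ball u0 R" "e ` ball u0 R \<subseteq> -P" and z0: "H (K z0) = e u0" and R: "(R::real) > 0"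
  have eP: "e u \<notin> P" if "u \<in> ball u0 R" for u using e(2) that by blast
  obtain \<Phi> where \<Phi>: "\<Phi> holomorphic_on ball u0 R" "\<Phi> u0 = K z0" "\<And>u. u \<in> ball u0 R \<Longrightarrow> H (\<Phi> u) = e u"
    using lifts_offD [OF H(1) e(1) eP z0 R] by metis
  have "\<Phi> u \<notin> P" if "u \<in> ball u0 R" for u
    using \<Phi>(3)[OF that] eP[OF that] H(2) by auto
  then obtain \<Psi> where \<Psi>: "\<Psi> holomorphic_on ball u0 R" "\<Psi> u0 = z0" "\<And>u. u \<in> ball u0 R \<Longrightarrow> K (\<Psi> u) = \<Phi> u"
    using lifts_offD [OF K \<Phi>(1) _ \<Phi>(2)[symmetric] R] by metis
  show "\<exists>\<Phi>. \<Phi> holomorphic_on ball u0 R \<and> \<Phi> u0 = z0 \<and> (\<forall>u\<in>ball u0 R. H (K (\<Phi> u)) = e u)"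
    using \<Psi> \<Phi>(3) by (intro exI[of _ \<Psi>]) simp
qed

lemma lifts_off_funpow:
  assumes "lifts_off f P" "f ` P \<subseteq> P"
  shows "lifts_off (f ^^ n) P"
proof (induction n)
  case 0
  show ?case unfolding lifts_off_def by auto
next
  case (Suc n)
  show ?case using lifts_off_comp [OF assms Suc] by (simp add: comp_def)
qed

text \<open>A lift of the identity is a holomorphic right inverse near \<open>H z\<close>, and the
  chain rule applies. In this way iterates have no critical points over the complement of
  \<open>P\<close>, without reference to their critical values.\<close>

lemma lifts_off_deriv:
  assumes H: "lifts_off H P" "H holomorphic_on UNIV" and P: "closed P" "H z \<notin> P"
  shows "deriv H z \<noteq> 0"
proof -
  obtain R where R: "R > 0" "ball (H z) R \<subseteq> -P"
    using P by (meson ComplI open_Compl openE)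
  obtain \<Phi> where \<Phi>: "\<Phi> holomorphic_on ball (H z) R" "\<Phi> (H z) = z" "\<And>u. u \<in> ball (H z) R \<Longrightarrow> H (\<Phi> u) = u"
    by (rule lifts_offD [OF H(1), where e = "\<lambda>x. x" and ?u0.0 = "H z" and R = R and ?z0.0 = z]) (use R in auto)
  have d1: "(\<Phi> has_field_derivative deriv \<Phi> (H z)) (at (H z))"
    using holomorphic_derivI [OF \<Phi>(1) open_ball] R(1) by simp
  have d2: "(H has_field_derivative deriv H z) (at (\<Phi> (H z)))"
    using holomorphic_derivI [OF H(2) open_UNIV] \<Phi>(2) by simp
  have d3: "((\<lambda>u. H (\<Phi> u)) has_field_derivative deriv H z * deriv \<Phi> (H z)) (at (H z))"
    using DERIV_chain2 [OF d2 d1] .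
  have "((\<lambda>u. u) has_field_derivative deriv H z * deriv \<Phi> (H z)) (at (H z))"
    by (rule has_field_derivative_transform_within_open [OF d3 open_ball, of "H z" R]) (use R \<Phi>(3) in auto)
  then have "deriv H z * deriv \<Phi> (H z) = 1"
    using DERIV_unique DERIV_ident by blast
  then show ?thesis by auto
qed

section \<open>Lifts on half-planes\<close>

text \<open>Half-planes are needed because \<open>c + exp u\<close> maps them onto the outside of a
  disc that contains \<open>P\<close>; this is where the logarithmic coordinate lives.\<close>

lemma lift_half_plane:
  assumes H: "lifts_off H P" and e: "e holomorphic_on {u. L < Re u}" "\<And>u. L < Re u \<Longrightarrow> e u \<notin> P"
    and u0: "L < Re u0" "H z0 = e u0"
  obtains \<Phi> where "\<Phi> holomorphic_on {u. L < Re u}" "\<Phi> u0 = z0" "\<And>u. L < Re u \<Longrightarrow> H (\<Phi> u) = e u"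
proof -
  define d where "d = Re u0 - L"
  have d: "d > 0" using u0 by (simp add: d_def)
  \<comment> \<open>the Cayley transform of the unit disc onto the half-plane sending \<open>0\<close> to \<open>u0\<close>, with inverse \<open>k\<close>\<close>
  define m where "m \<zeta> = u0 - of_real d + of_real d * ((1 + \<zeta>) / (1 - \<zeta>))" for \<zeta>
  define k where "k u = ((u - u0 + of_real d) / of_real d - 1) / ((u - u0 + of_real d) / of_real d + 1)" for u
  have mL: "L < Re (m \<zeta>)" if "\<zeta> \<in> ball 0 1" for \<zeta>
  proof -
    have z: "(Re \<zeta>)\<^sup>2 + (Im \<zeta>)\<^sup>2 < 1" using that
      by (simp add: cmod_def)
    have "\<zeta> \<noteq> 1" using that by auto
    then have "(1 - Re \<zeta>)\<^sup>2 + (Im \<zeta>)\<^sup>2 > 0"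
      by (metis add.inverse_inverse complex_eq_iff diff_eq_diff_eq diff_self one_complex.simps sum_power2_gt_zero_iff right_minus_eq)
    then have "Re ((1 + \<zeta>) / (1 - \<zeta>)) > 0"
      using z by (simp add: Re_divide power2_eq_square algebra_simps)
    then have "0 < d * Re ((1 + \<zeta>) / (1 - \<zeta>))" using d by simp
    moreover define w where "w = (1 + \<zeta>) / (1 - \<zeta>)"
    ultimately have "0 < d * Re w" by simp
    moreover have "m \<zeta> = u0 - of_real d + of_real d * w" by (simp add: m_def w_def)
    ultimately show ?thesis by (simp add: d_def)
  qed
  have mh: "m holomorphic_on ball 0 1" unfolding m_def
    by (intro holomorphic_intros) auto
  have v: "Re ((u - u0 + of_real d) / of_real d) > 0" if "L < Re u" for u
    using that d by (simp add: d_def)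
  have vn: "(u - u0 + of_real d) / of_real d + 1 \<noteq> 0" if "L < Re u" for u
  proof
    assume "(u - u0 + of_real d) / of_real d + 1 = 0"
    then have "Re ((u - u0 + of_real d) / of_real d + 1) = 0" by simp
    then show False using v[OF that] unfolding plus_complex.sel one_complex.sel by linarith
  qed
  have kin: "k u \<in> ball 0 1" if "L < Re u" for u
  proof -
    define w where "w = (u - u0 + of_real d) / of_real d"
    have "Re w > 0" using v[OF that] by (simp add: w_def)
    then have "(Re w - 1)\<^sup>2 + (Im w)\<^sup>2 < (Re w + 1)\<^sup>2 + (Im w)\<^sup>2" by (simp add: power2_eq_square algebra_simps)
    then have "norm (w - 1) < norm (w + 1)" by (simp add: cmod_def)
    then have "norm ((w - 1) / (w + 1)) < 1" by (simp add: norm_divide divide_simps)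
    then show ?thesis by (simp add: k_def w_def)
  qed
  have kh: "k holomorphic_on {u. L < Re u}"
    unfolding k_def using vn d by (intro holomorphic_intros) auto
  have mk: "m (k u) = u" if "L < Re u" for u
  proof -
    define w where "w = (u - u0 + of_real d) / of_real d"
    have "w + 1 \<noteq> 0" using vn[OF that] by (simp add: w_def)
    then have "1 + (w - 1) / (w + 1) = w * (2 / (w + 1))" "1 - (w - 1) / (w + 1) = 2 / (w + 1)"
      by (auto simp: divide_simps)
    then have "(1 + (w - 1) / (w + 1)) / (1 - (w - 1) / (w + 1)) = w"
      using \<open>w + 1 \<noteq> 0\<close> by simp
    then have "m (k u) = u0 - of_real d + of_real d * w" by (simp add: m_def k_def w_def)
    also have "\<dots> = u" using d by (simp add: w_def)
    finally show ?thesis .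
  qed
  have mk0: "m 0 = u0" "k u0 = 0" using d by (auto simp: m_def k_def)
  have "(\<lambda>\<zeta>. e (m \<zeta>)) holomorphic_on ball 0 1"
    using holomorphic_on_compose_gen [OF mh e(1) image_subsetI] mL by (simp add: comp_def)
  then obtain \<Phi> where \<Phi>: "\<Phi> holomorphic_on ball 0 1" "\<Phi> 0 = z0" "\<And>u. u \<in> ball 0 1 \<Longrightarrow> H (\<Phi> u) = e (m u)"
    by (rule lifts_offD [OF H]) (use mL e(2) mk0 u0 in auto)
  show thesis
  proof (rule that [of "\<lambda>u. \<Phi> (k u)"])
    show "(\<lambda>u. \<Phi> (k u)) holomorphic_on {u. L < Re u}"
      using holomorphic_on_compose_gen [OF kh \<Phi>(1) image_subsetI] kin by (simp add: comp_def)
    show "\<Phi> (k u0) = z0" by (simp add: mk0 \<Phi>)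
    show "H (\<Phi> (k u)) = e u" if "L < Re u" for u
      using \<Phi>(3)[OF kin[OF that]] mk[OF that] by simp
  qed
qed

text \<open>A periodic lift takes all its values on one strip of finite height, so it wraps the
  half-plane around infinity finitely often. Used in contrapositive form: for transcendental maps
  the lifts of \<open>c + exp\<close> are injective.\<close>

lemma periodic_lift_pole:
  assumes H: "H holomorphic_on UNIV" and \<Phi>: "\<Phi> holomorphic_on {u. L < Re u}"
    and lift: "\<And>u. L < Re u \<Longrightarrow> H (\<Phi> u) = c + exp u"
    and T: "T > 0" "\<And>u. L < Re u \<Longrightarrow> \<Phi> (u + \<i> * of_real T) = \<Phi> u"
  shows "filterlim H at_infinity at_infinity"
proof -
  have Tz: "\<Phi> (u + \<i> * of_real (of_int k * T)) = \<Phi> u" if "L < Re u" for u and k :: int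
  proof -
    have nat: "\<Phi> (u + \<i> * of_real (of_nat n * T)) = \<Phi> u" if "L < Re u" for u n
    proof (induction n)
      case (Suc n)
      have "u + \<i> * of_real (of_nat (Suc n) * T) = (u + \<i> * of_real (of_nat n * T)) + \<i> * of_real T"
        by (simp add: algebra_simps)
      then show ?case using T(2)[of "u + \<i> * of_real (of_nat n * T)"] that Suc by (simp only:) simp
    qed simp
    show ?thesis
    proof (cases "k \<ge> 0")
      case True then show ?thesis using nat[OF that, of "nat k"] by simp
    next
      case False
      then show ?thesis using nat[of "u + \<i> * of_real (of_int k * T)" "nat (-k)"] that by (simp add: algebra_simps)
    qed
  qed
  have red: "\<exists>v. Re v = Re u \<and> Im v \<in> {0..T} \<and> \<Phi> v = \<Phi> u" if "L < Re u" for u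
  proof -
    define k where "k = - \<lfloor>Im u / T\<rfloor>"
    have "of_int \<lfloor>Im u / T\<rfloor> * T \<le> Im u" "Im u < of_int \<lfloor>Im u / T\<rfloor> * T + T"
      using floor_divide_lower [OF T(1), of "Im u"] floor_divide_upper [OF T(1), of "Im u"]
      by (auto simp: algebra_simps)
    then show ?thesis using Tz[OF that, of k] that
      by (intro exI[of _ "u + \<i> * of_real (of_int k * T)"]) (auto simp: k_def)
  qed
  have opH: "open {u. a < Re u}" "connected {u. a < Re u}" for a
    by (auto simp: open_halfspace_Re_gt convex_connected convex_halfspace_Re_gt)
  have big: "\<exists>N. \<forall>z. norm z > N \<longrightarrow> norm (H z - c) > exp a" if a: "a > L" for a
  proof -
    \<comment> \<open>The boundary of \<open>W\<close> lies in the compact curve \<open>\<Gamma>\<close>, so the unbounded set \<open>W\<close> contains a neighbourhood of infinity.\<close>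
    define W where "W = \<Phi> ` {u. a < Re u}"
    define \<Gamma> where "\<Gamma> = \<Phi> ` ((\<lambda>t. Complex a t) ` {0..T})"
    have \<Phi>c: "continuous_on {u. L < Re u} \<Phi>" using \<Phi> holomorphic_on_imp_continuous_on by blast
    have "compact ((\<lambda>t. Complex a t) ` {0..T})"
      by (intro compact_continuous_image continuous_intros) auto
    moreover have "continuous_on ((\<lambda>t. Complex a t) ` {0..T}) \<Phi>"
      by (rule continuous_on_subset [OF \<Phi>c]) (use a in auto)
    ultimately have "compact \<Gamma>" unfolding \<Gamma>_def by (metis compact_continuous_image)
    then have "bounded \<Gamma>" by (rule compact_imp_bounded)
    then obtain N where "\<forall>x\<in>\<Gamma>. norm x \<le> N" unfolding bounded_iff by blast
    then have N: "\<Gamma> \<subseteq> cball 0 N" by auto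
    have opW: "open W" unfolding W_def
    proof (rule open_mapping_thm [of \<Phi> "{u. L < Re u}"])
      show "\<not> \<Phi> constant_on {u. L < Re u}"
      proof
        assume "\<Phi> constant_on {u. L < Re u}"
        then obtain y where y: "\<And>u. L < Re u \<Longrightarrow> \<Phi> u = y" unfolding constant_on_def by auto
        have "exp (of_real a) = exp (of_real (a + 1) :: complex)"
          using lift[of "of_real a"] lift[of "of_real (a+1)"] y[of "of_real a"] y[of "of_real (a+1)"] a by simp
        then have "exp a = exp (a + 1)" by (metis exp_of_real of_real_eq_iff)
        then show False by simp
      qed
    qed (use \<Phi> opH a in auto)
    \<comment> \<open>If points of \<open>W\<close> converge, their \<open>H\<close>-values are
      bounded, which bounds the real parts of their preimages under \<open>\<Phi>\<close>;
      periodicity bounds the imaginary parts. So the preimages accumulate, either inside the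
      half-plane or on its edge, which \<open>\<Phi>\<close> maps into
      \<open>\<Gamma>\<close>.\<close>
    have clE: "closure W \<subseteq> W \<union> \<Gamma>"
    proof
      fix z assume "z \<in> closure W"
      then obtain x where x: "\<And>n. x n \<in> W" "x \<longlonglongrightarrow> z" unfolding closure_sequential by blast
      have "\<exists>v. a < Re v \<and> Im v \<in> {0..T} \<and> \<Phi> v = x n" for n
      proof -
        obtain u where u: "a < Re u" "x n = \<Phi> u" using x(1)[of n] unfolding W_def by blast
        then obtain w where "Re w = Re u" "Im w \<in> {0..T}" "\<Phi> w = \<Phi> u" using red[of u] a by fastforce
        then show ?thesis using u by (intro exI[of _ w]) simp
      qed
      then obtain v where v: "\<And>n. a < Re (v n)" "\<And>n. Im (v n) \<in> {0..T}" "\<And>n. \<Phi> (v n) = x n" by metis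
      have "isCont H z" using H holomorphic_on_imp_continuous_on continuous_on_eq_continuous_at by blast
      then have "(\<lambda>n. H (x n)) \<longlonglongrightarrow> H z" using x(2) isCont_tendsto_compose by blast
      then have "bounded (range (\<lambda>n. H (x n)))" by (rule convergent_imp_bounded)
      then obtain B where B: "\<And>n. norm (H (x n)) \<le> B" unfolding bounded_iff by auto
      define B1 where "B1 = B + norm c"
      have B1: "exp (Re (v n)) \<le> B1" for n
      proof -
        have "H (x n) = c + exp (v n)" using lift[of "v n"] v(1)[of n] v(3)[of n] a by simp
        then have "exp (v n) = H (x n) - c" by simp
        then have "exp (Re (v n)) \<le> norm (H (x n)) + norm c" by (metis norm_exp_eq_Re norm_triangle_ineq4)
        then show ?thesis using B[of n] by (simp add: B1_def)
      qed
      have B1p: "B1 > 0" using B1[of 0] exp_gt_zero less_le_trans by blast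
      have Reb: "Re (v n) \<le> ln B1" for n
        using B1[of n] B1p by (metis exp_gt_zero ln_exp ln_le_cancel_iff)
      have vb: "v n \<in> cbox (Complex a 0) (Complex (ln B1) T)" for n
        using v(1)[of n] v(2)[of n] Reb[of n] by (auto simp: in_cbox_complex_iff)
      moreover have "seq_compact (cbox (Complex a 0) (Complex (ln B1) T))"
        by (simp add: seq_compact_eq_compact)
      ultimately obtain l r where l: "l \<in> cbox (Complex a 0) (Complex (ln B1) T)" "strict_mono r" "(v \<circ> r) \<longlonglongrightarrow> l"
        by (metis seq_compactE)
      have lL: "a \<le> Re l" "Im l \<in> {0..T}" using l(1) by (auto simp: in_cbox_complex_iff)
      have "isCont \<Phi> l" using \<Phi>c opH(1)[of L] lL a by (simp add: continuous_on_eq_continuous_at)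
      then have "(\<lambda>n. \<Phi> (v (r n))) \<longlonglongrightarrow> \<Phi> l"
        using l(3) isCont_tendsto_compose by (fastforce simp: comp_def)
      moreover have "(\<lambda>n. \<Phi> (v (r n))) \<longlonglongrightarrow> z"
        using LIMSEQ_subseq_LIMSEQ [OF x(2) l(2)] v(3) by (simp add: comp_def)
      ultimately have zl: "z = \<Phi> l" using LIMSEQ_unique by blast
      show "z \<in> W \<union> \<Gamma>"
      proof (cases "Re l = a")
        case True
        then have "l = Complex a (Im l)" by (simp add: complex_eq_iff)
        then show ?thesis using lL zl unfolding \<Gamma>_def by blast
      next
        case False then show ?thesis using lL zl unfolding W_def by auto
      qed
    qed
    define X where "X = - cball (0::complex) N"
    have "connected X" unfolding X_def
      by (intro connected_complement_bounded_convex) auto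
    have disj: "W \<inter> X = closure W \<inter> X" using clE N closure_subset by (auto simp: X_def)
    have "W \<inter> X = {} \<or> W \<inter> X = X"
    proof -
      have "openin (top_of_set X) (X \<inter> W)" using opW by (simp add: openin_open_Int)
      moreover have "closedin (top_of_set X) (X \<inter> W)"
        using disj by (metis closed_closure closedin_closed_Int inf_commute)
      ultimately show ?thesis using \<open>connected X\<close> unfolding connected_clopen by (metis inf_commute)
    qed
    moreover have "W \<inter> X \<noteq> {}"
    proof
      assume "W \<inter> X = {}"
      then have "W \<subseteq> cball 0 N" by (auto simp: X_def)
      then have WH: "H ` W \<subseteq> H ` cball 0 N" by blast
      have "compact (H ` cball 0 N)"
        using H by (intro compact_continuous_image) (auto intro: holomorphic_on_imp_continuous_on holomorphic_on_subset)
      then have "bounded (H ` W)" using WH compact_imp_bounded bounded_subset by blast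
      then obtain B where B: "\<And>z. z \<in> W \<Longrightarrow> norm (H z) \<le> B" unfolding bounded_iff by auto
      define s where "s = max (a + 1) (ln (\<bar>B\<bar> + norm c + 1))"
      have "exp s \<ge> \<bar>B\<bar> + norm c + 1"
        unfolding s_def by (metis abs_ge_zero add_nonneg_pos add_nonneg_nonneg exp_le_cancel_iff exp_ln max.cobounded2 norm_ge_zero zero_less_one)
      moreover have sa: "s > a" unfolding s_def by linarith
      ultimately have "norm (exp (of_real s :: complex)) \<ge> \<bar>B\<bar> + norm c + 1" by simp
      moreover have "\<Phi> (of_real s) \<in> W" using sa by (auto simp: W_def)
      then have "norm (c + exp (of_real s)) \<le> B" using B lift[of "of_real s"] sa a by force
      ultimately show False
        using norm_triangle_ineq2 [of "exp (of_real s :: complex)" "- c"] by (simp add: add.commute)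
    qed
    ultimately have XW: "X \<subseteq> W" by blast
    have "norm (H z - c) > exp a" if "norm z > N" for z
    proof -
      have "z \<in> W" using that XW by (auto simp: X_def)
      then obtain u where u: "a < Re u" "z = \<Phi> u" unfolding W_def by blast
      then have "H z - c = exp u" using lift a by simp
      then show ?thesis using u by simp
    qed
    then show ?thesis by blast
  qed
  show ?thesis
  proof (subst filterlim_at_infinity [of 0])
    show "\<forall>r>0. \<forall>\<^sub>F x in at_infinity. r \<le> norm (H x)"
    proof (intro allI impI)
      fix r :: real assume r: "r > 0"
      define a where "a = max (L + 1) (ln (r + norm c))"
      have ea: "exp a \<ge> r + norm c" unfolding a_def
        by (metis add_pos_nonneg exp_le_cancel_iff exp_ln max.cobounded2 norm_ge_zero r)
      have aL: "a > L" unfolding a_def by linarith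
      obtain N where N: "\<And>z. norm z > N \<Longrightarrow> norm (H z - c) > exp a"
        using big[of a] aL by blast
      have "r \<le> norm (H z)" if "norm z \<ge> N + 1" for z
        using N[of z] that ea norm_triangle_ineq4[of "H z" c] by linarith
      then show "\<forall>\<^sub>F x in at_infinity. r \<le> norm (H x)"
        unfolding eventually_at_infinity by blast
    qed
  qed simp
qed

section \<open>Expansion in logarithmic coordinates\<close>

text \<open>\<open>exp\<close> of \<open>\<psi>\<close> is injective, so the image of
  \<open>\<psi>\<close> contains no disc of radius greater than \<open>pi\<close>, half the period
  of \<open>exp\<close>. Bloch's theorem with the constant 1/12, on the largest disc about
  \<open>u\<close> in the half-plane, gives the bound on the derivative. The logarithm is based at
  \<open>b\<close>, which the lift omits because \<open>H b\<close> lies in the excluded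
  disc.\<close>

lemma log_branch:
  assumes H: "H holomorphic_on UNIV" "\<not> filterlim H at_infinity at_infinity" "lifts_off H P"
    and P: "closed P" "P \<subseteq> cball c r" "r > 0" and b: "dist c (H b) \<le> r"
    and u0: "Re u0 > ln r" "H z0 = c + exp u0"
  obtains \<psi> where "\<psi> holomorphic_on {u. ln r < Re u}" "b + exp (\<psi> u0) = z0"
    "\<And>u. ln r < Re u \<Longrightarrow> H (b + exp (\<psi> u)) = c + exp u"
    "\<And>u. ln r < Re u \<Longrightarrow> norm (deriv \<psi> u) \<le> 12 * pi / (Re u - ln r)"
proof -
  let ?D = "{u. ln r < Re u}"
  have D: "open ?D" "convex ?D"
    by (auto simp: open_halfspace_Re_gt convex_halfspace_Re_gt)
  have nin: "c + exp u \<notin> cball c r" if "ln r < Re u" for u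
  proof -
    have "r < exp (Re u)" using that P(3) by (metis exp_less_cancel_iff exp_ln)
    then show ?thesis by (simp add: dist_norm)
  qed
  have eP: "c + exp u \<notin> P" if "ln r < Re u" for u using nin[OF that] P(2) by blast
  have "(\<lambda>u. c + exp u) holomorphic_on ?D" by (intro holomorphic_intros)
  then obtain \<Phi> where \<Phi>: "\<Phi> holomorphic_on ?D" "\<Phi> u0 = z0" "\<And>u. ln r < Re u \<Longrightarrow> H (\<Phi> u) = c + exp u"
    using lift_half_plane [where L = "ln r" and e = "\<lambda>u. c + exp u", OF H(3) _ _ u0] eP by metis
  have \<Phi>b: "\<Phi> u \<noteq> b" if "ln r < Re u" for u
    using nin[OF that] \<Phi>(3)[OF that] b by auto
  have "(\<lambda>u. \<Phi> u - b) holomorphic_on ?D" by (intro holomorphic_intros \<Phi>)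
  then obtain \<psi> where \<psi>: "\<psi> holomorphic_on ?D" "\<And>u. u \<in> ?D \<Longrightarrow> \<Phi> u - b = exp (\<psi> u)"
    using contractible_imp_holomorphic_log [of "\<lambda>u. \<Phi> u - b" ?D] D(2) \<Phi>b convex_imp_contractible
    by (metis (no_types, lifting) mem_Collect_eq right_minus_eq)
  have \<Phi>\<psi>: "\<Phi> u = b + exp (\<psi> u)" if "ln r < Re u" for u using \<psi>(2)[of u] that by (simp add: algebra_simps)
  have inj: "u1 = u2" if u: "ln r < Re u1" "ln r < Re u2" "\<Phi> u1 = \<Phi> u2" for u1 u2
  proof (rule ccontr)
    assume ne: "u1 \<noteq> u2"
    have "exp u1 = exp u2" using \<Phi>(3)[OF u(1)] \<Phi>(3)[OF u(2)] u(3) by simp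
    then obtain k :: int where k: "u1 = u2 + of_real (2 * of_int k * pi) * \<i>" using exp_eq by auto
    \<comment> \<open>Of the two points \<open>v\<close> is the lower one, so that the period
      \<open>T\<close> is positive.\<close>
    define v where "v = (if k > 0 then u2 else u1)"
    define T where "T = 2 * pi * \<bar>of_int k\<bar>"
    have k0: "k \<noteq> 0" using ne k by auto
    have vT: "v + \<i> * of_real T = (if k > 0 then u1 else u2)"
      using k by (auto simp: v_def T_def complex_eq_iff abs_if)
    have vL: "ln r < Re v" using u by (simp add: v_def)
    have eqv: "\<Phi> (v + \<i> * of_real T) = \<Phi> v" using u(3) unfolding vT by (simp add: v_def)
    have eT: "exp (w + \<i> * of_real T) = exp w" for w
      unfolding exp_eq by (intro exI[of _ "\<bar>k\<bar>"]) (simp add: T_def)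
    have sh: "ln r < Re w \<Longrightarrow> ln r < Re (w + \<i> * of_real T)" for w by simp
    have "(\<lambda>u. \<Phi> (u + \<i> * of_real T)) holomorphic_on ?D"
      using holomorphic_on_compose_gen [of "\<lambda>u. u + \<i> * of_real T" ?D \<Phi> ?D, OF _ \<Phi>(1), unfolded comp_def]
      by (rule) (auto intro!: holomorphic_intros)
    then have c1: "continuous_on ?D (\<lambda>u. \<Phi> (u + \<i> * of_real T))" by (rule holomorphic_on_imp_continuous_on)
    have per: "\<Phi> (w + \<i> * of_real T) = \<Phi> w" if "ln r < Re w" for w
    proof (rule lift_unique [OF H(1), where U = ?D and a = v and b = w and p = "\<lambda>u. \<Phi> (u + \<i> * of_real T)" and q = \<Phi>])
      show "continuous_on ?D \<Phi>" using \<Phi>(1) by (rule holomorphic_on_imp_continuous_on)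
      show "connected ?D" using D(2) by (rule convex_connected)
      show "H (\<Phi> (x + \<i> * of_real T)) = H (\<Phi> x)" if "x \<in> ?D" for x
        using that \<Phi>(3)[OF sh, of x] \<Phi>(3)[of x] eT[of x] by simp
      show "deriv H (\<Phi> (x + \<i> * of_real T)) \<noteq> 0" if "x \<in> ?D" for x
        using that \<Phi>(3)[OF sh, of x] eP[OF sh, of x] by (intro lifts_off_deriv [OF H(3,1) P(1)]) simp
    qed (use c1 eqv vL that in auto)
    have "filterlim H at_infinity at_infinity"
      by (rule periodic_lift_pole [OF H(1) \<Phi>(1) \<Phi>(3) _ per]) (use k0 in \<open>auto simp: T_def\<close>)
    then show False using H(2) by simp
  qed
  have bd: "norm (deriv \<psi> u) \<le> 12 * pi / (Re u - ln r)" if u: "ln r < Re u" for u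
  proof (rule ccontr)
    define \<rho> where "\<rho> = Re u - ln r"
    have \<rho>: "\<rho> > 0" using u by (simp add: \<rho>_def)
    assume "\<not> norm (deriv \<psi> u) \<le> 12 * pi / (Re u - ln r)"
    then have gt: "\<rho> * norm (deriv \<psi> u) / 12 > pi" using \<rho> by (simp add: \<rho>_def field_simps)
    have sub: "ball u \<rho> \<subseteq> ?D"
    proof
      fix x assume "x \<in> ball u \<rho>"
      then have "norm (u - x) < \<rho>" by (simp add: dist_norm)
      then have "\<bar>Re u - Re x\<bar> < \<rho>" using abs_Re_le_cmod[of "u - x"] by simp
      then show "x \<in> ?D" by (simp add: \<rho>_def)
    qed
    \<comment> \<open>A disc of radius greater than \<open>pi\<close> in the image of \<open>\<psi>\<close> has two points with the same exponential.\<close>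
    obtain y where y: "ball y (\<rho> * norm (deriv \<psi> u) / 12) \<subseteq> \<psi> ` ball u \<rho>"
      using Bloch [OF holomorphic_on_subset [OF \<psi>(1) sub] \<rho> order_refl] by blast
    have "y + \<i> * of_real pi \<in> \<psi> ` ball u \<rho>" "y - \<i> * of_real pi \<in> \<psi> ` ball u \<rho>"
      using gt by (auto intro!: subsetD[OF y] simp: dist_norm norm_mult)
    then obtain x1 x2 where x: "x1 \<in> ball u \<rho>" "\<psi> x1 = y + \<i> * of_real pi" "x2 \<in> ball u \<rho>" "\<psi> x2 = y - \<i> * of_real pi"
      by (metis imageE)
    have "exp (\<psi> x1) = exp (\<psi> x2)" unfolding x exp_eq by (intro exI[of _ 1]) (simp add: algebra_simps)
    moreover have "ln r < Re x1" "ln r < Re x2" using x sub by auto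
    ultimately have "x1 = x2" using \<Phi>\<psi> inj by metis
    then have "\<i> * of_real pi = (0::complex)" using x by (simp add: algebra_simps)
    then show False by simp
  qed
  show thesis
    by (rule that [OF \<psi>(1)]) (use \<Phi> \<Phi>\<psi> u0 bd in auto)
qed

text \<open>Otherwise the half-plane in \<open>log_branch\<close> can be extended arbitrarily far to
  the left. The derivative of the logarithmic lift at \<open>u0\<close> would then be arbitrarily
  small, but by the chain rule its modulus times the fixed number \<open>K\<close> is
  \<open>norm (exp u0)\<close>.\<close>

lemma card_ge_2_of_lifts_off:
  assumes H: "H holomorphic_on UNIV" "\<not> filterlim H at_infinity at_infinity" "lifts_off H P" "H ` P \<subseteq> P"
    and nc: "\<not> H constant_on UNIV"
    and P: "closed P"
  obtains p q where "p \<in> P" "q \<in> P" "p \<noteq> q"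
proof (rule ccontr)
  assume "\<not> thesis"
  then have one: "\<And>p q. p \<in> P \<Longrightarrow> q \<in> P \<Longrightarrow> p = q" using that by blast
  \<comment> \<open>If \<open>P = {p}\<close>, then invariance gives \<open>H p = p\<close>, so
    \<open>b = p\<close> works.\<close>
  obtain b where b: "P \<subseteq> {H b}"
  proof (cases "P = {}")
    case False
    then obtain p where "p \<in> P" by blast
    then show ?thesis using one H(4) by (intro that[of p]) blast
  qed (use that in auto)
  define c where "c = H b"
  obtain z0 where z0: "H z0 \<noteq> c" using nc unfolding constant_on_def by blast
  define u0 where "u0 = Ln (H z0 - c)"
  have u0: "H z0 = c + exp u0" using z0 by (simp add: u0_def)
  have dz: "deriv H z0 \<noteq> 0"
    using lifts_off_deriv [OF H(3,1) P, of z0] z0 b by (auto simp: c_def)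
  define K where "K = norm (deriv H z0 * (z0 - b))"
  \<comment> \<open>If \<open>P\<close> lies in \<open>{c}\<close>, then \<open>log_branch\<close> holds with arbitrarily small \<open>r = exp s\<close>.\<close>
  have est: "norm (exp u0) * (Re u0 - s) \<le> K * (12 * pi)" if s: "s < Re u0" for s
  proof -
    have Pc: "P \<subseteq> cball c (exp s)" using b by (auto simp: c_def)
    obtain \<psi> where \<psi>: "\<psi> holomorphic_on {u. s < Re u}" "b + exp (\<psi> u0) = z0"
      "\<And>u. s < Re u \<Longrightarrow> H (b + exp (\<psi> u)) = c + exp u"
      "\<And>u. s < Re u \<Longrightarrow> norm (deriv \<psi> u) \<le> 12 * pi / (Re u - s)"
      using log_branch [OF H(1-3) P Pc, of b u0 z0] s u0 by (auto simp: c_def)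
    have d1: "(\<psi> has_field_derivative deriv \<psi> u0) (at u0)"
      using holomorphic_derivI [OF \<psi>(1) open_halfspace_Re_gt] s by simp
    have d2: "((\<lambda>u. b + exp (\<psi> u)) has_field_derivative exp (\<psi> u0) * deriv \<psi> u0) (at u0)"
      by (auto intro!: derivative_eq_intros d1)
    have d3: "(H has_field_derivative deriv H z0) (at (b + exp (\<psi> u0)))"
      using holomorphic_derivI [OF H(1) open_UNIV] \<psi>(2) by simp
    have d4: "((\<lambda>u. H (b + exp (\<psi> u))) has_field_derivative deriv H z0 * (exp (\<psi> u0) * deriv \<psi> u0)) (at u0)"
      by (rule DERIV_chain2 [OF d3 d2])
    have "((\<lambda>u. c + exp u) has_field_derivative deriv H z0 * (exp (\<psi> u0) * deriv \<psi> u0)) (at u0)"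
      by (rule has_field_derivative_transform_within_open [OF d4 open_halfspace_Re_gt[of s]]) (use \<psi>(3) s in auto)
    moreover have "((\<lambda>u. c + exp u) has_field_derivative exp u0) (at u0)"
      by (auto intro!: derivative_eq_intros)
    ultimately have "exp u0 = deriv H z0 * (exp (\<psi> u0) * deriv \<psi> u0)" using DERIV_unique by blast
    also have "exp (\<psi> u0) = z0 - b" using \<psi>(2) by (simp add: algebra_simps)
    finally have "norm (exp u0) = K * norm (deriv \<psi> u0)" by (simp add: K_def norm_mult)
    also have "\<dots> \<le> K * (12 * pi / (Re u0 - s))" using \<psi>(4)[OF s] by (intro mult_left_mono) (auto simp: K_def)
    finally show ?thesis using s by (simp add: field_simps)
  qed
  \<comment> \<open>With this \<open>s\<close> the left side of \<open>est\<close> equals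
    \<open>K * (12 * pi) + 1\<close>.\<close>
  define s where "s = Re u0 - (K * (12 * pi) + 1) / norm (exp u0)"
  have K0: "K \<ge> 0" by (simp add: K_def)
  have "s < Re u0" unfolding s_def using K0 by (simp add: divide_pos_pos add_nonneg_pos)
  from est[OF this] show False by (simp add: s_def)
qed

section \<open>Accumulation of rays at small potentials\<close>

lemma tendsto_subseq_criterion:
  fixes X :: "nat \<Rightarrow> 'a::metric_space"
  assumes "\<And>r. strict_mono r \<Longrightarrow> \<exists>r'. strict_mono (r' :: nat \<Rightarrow> nat) \<and> (\<lambda>n. X (r (r' n))) \<longlonglongrightarrow> l"
  shows "X \<longlonglongrightarrow> l"
proof (rule ccontr)
  assume "\<not> X \<longlonglongrightarrow> l"
  then obtain e where e: "e > 0" "\<And>n0. \<exists>n\<ge>n0. dist (X n) l \<ge> e"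
    unfolding lim_sequentially by (meson not_le_imp_less)
  then have "infinite {n. dist (X n) l \<ge> e}"
    unfolding infinite_nat_iff_unbounded_le by blast
  then obtain r where r: "strict_mono r" "\<And>n::nat. dist (X (r n)) l \<ge> e"
    using infinite_enumerate by blast
  then obtain r' where "(\<lambda>n. X (r (r' n))) \<longlonglongrightarrow> l" using assms by blast
  then have "eventually (\<lambda>n. dist (X (r (r' n))) l < e) sequentially" using e(1) by (simp add: tendstoD)
  then show False using r(2) by (auto simp: eventually_sequentially not_less[symmetric])
qed

section \<open>Dynamics of potentials\<close>

text \<open>\<open>G\<close> is the action of \<open>H\<close> on potentials and \<open>Gi\<close>
  its inverse. They are kept apart from rays and maps because the analysis at indifferent points
  applies them to curves in other coordinates.\<close>

locale ray_shift =
  fixes G Gi :: "real \<Rightarrow> real"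
  assumes G_pos: "t > 0 \<Longrightarrow> G t > 0" and Gi_pos: "t > 0 \<Longrightarrow> Gi t > 0"
    and G_Gi: "t > 0 \<Longrightarrow> G (Gi t) = t" and Gi_G: "t > 0 \<Longrightarrow> Gi (G t) = t"
    and Gi_mono: "0 < s \<Longrightarrow> s < t \<Longrightarrow> Gi s < Gi t"
    and Gi_cont: "continuous_on {0<..} Gi"
    and G_lim: "t > 0 \<Longrightarrow> filterlim (\<lambda>n. (G ^^ n) t) at_top sequentially"
begin

lemma Gi_mono_le: "0 < s \<Longrightarrow> s \<le> t \<Longrightarrow> Gi s \<le> Gi t"
  using Gi_mono by (cases "s = t") (auto simp: less_imp_le)

lemma Gin_pos: "t > 0 \<Longrightarrow> (Gi ^^ n) t > 0"
  by (induction n) (auto intro: Gi_pos)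

lemma Gn_pos: "t > 0 \<Longrightarrow> (G ^^ n) t > 0"
  by (induction n) (auto intro: G_pos)

lemma Gin_mono_le: "0 < s \<Longrightarrow> s \<le> t \<Longrightarrow> (Gi ^^ n) s \<le> (Gi ^^ n) t"
  by (induction n) (auto intro: Gi_mono_le Gin_pos)

lemma Gin_mono: "0 < s \<Longrightarrow> s < t \<Longrightarrow> (Gi ^^ n) s < (Gi ^^ n) t"
  by (induction n) (auto intro: Gi_mono Gin_pos)

lemma Gn_Gin: "t > 0 \<Longrightarrow> (G ^^ n) ((Gi ^^ n) t) = t"
  by (induction n arbitrary: t) (simp_all add: funpow_swap1 G_Gi Gin_pos Gi_pos)

lemma Gin_Gn: "t > 0 \<Longrightarrow> (Gi ^^ n) ((G ^^ n) t) = t"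
  by (induction n arbitrary: t) (simp_all add: funpow_swap1 Gi_G Gn_pos G_pos)

lemma Gin_G: "t > 0 \<Longrightarrow> (Gi ^^ n) (G t) = G ((Gi ^^ n) t)"
  by (induction n) (simp_all add: Gi_G G_Gi Gin_pos)

lemma Gin_cont: "continuous_on {0<..} (Gi ^^ n)"
proof (induction n)
  case (Suc n)
  have "continuous_on {0<..} (Gi \<circ> (Gi ^^ n))"
    using Suc by (rule continuous_on_compose) (auto intro: continuous_on_subset [OF Gi_cont] Gin_pos)
  then show ?case by simp
qed (simp add: continuous_on_id)

text \<open>If \<open>t <= Gi t\<close>, then by monotonicity all backward iterates of
  \<open>t\<close> stay above \<open>t\<close>, hence all forward iterates stay below it, contrary
  to \<open>G_lim\<close>.\<close>

lemma Gi_less: assumes "t > 0" shows "Gi t < t"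
proof (rule ccontr)
  assume "\<not> Gi t < t"
  then have le: "t \<le> Gi t" by simp
  have "t \<le> (Gi ^^ n) t" for n
  proof (induction n)
    case (Suc n)
    then have "Gi t \<le> Gi ((Gi ^^ n) t)" using Gi_mono_le assms by blast
    then show ?case using le by simp
  qed simp
  note low = this
  have up: "(G ^^ n) t \<le> t" for n
  proof (rule ccontr)
    assume "\<not> (G ^^ n) t \<le> t"
    then have "(Gi ^^ n) t < (Gi ^^ n) ((G ^^ n) t)" using assms by (intro Gin_mono) auto
    then show False using Gin_Gn[OF assms, of n] low[of n] by simp
  qed
  obtain n where "t + 1 \<le> (G ^^ n) t"
    using G_lim[OF assms] unfolding filterlim_at_top eventually_sequentially by blast
  then show False using up[of n] by simp
qed

lemma Gin_antimono: assumes "t > 0" "m \<le> n" shows "(Gi ^^ n) t \<le> (Gi ^^ m) t"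
  using assms(2)
proof (induction rule: dec_induct)
  case (step n)
  then show ?case using Gi_less[OF Gin_pos[OF assms(1), of n]] by simp
qed simp

lemma Gin_lim: assumes "t > 0" shows "(\<lambda>n. (Gi ^^ n) t) \<longlonglongrightarrow> 0"
proof (rule LIMSEQ_I)
  fix e :: real assume e: "e > 0"
  obtain N where N: "\<And>n. n \<ge> N \<Longrightarrow> t + 1 \<le> (G ^^ n) e"
    using G_lim[OF e] unfolding filterlim_at_top eventually_sequentially by blast
  have "(Gi ^^ n) t < e" if "n \<ge> N" for n
  proof -
    have "(Gi ^^ n) t < (Gi ^^ n) ((G ^^ n) e)" using N[OF that] assms by (intro Gin_mono) auto
    then show ?thesis using Gin_Gn[OF e] by simp
  qed
  then show "\<exists>no. \<forall>n\<ge>no. norm ((Gi ^^ n) t - 0) < e"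
    using Gin_pos[OF assms] by (intro exI[of _ N]) (simp add: abs_of_pos)
qed

text \<open>Turns the behaviour of the ray as the potential tends to 0 into the behaviour of the
  iterates of \<open>Gi\<close> on the compact interval from \<open>Gi t1\<close> to
  \<open>t1\<close>.\<close>

lemma fundamental_domain:
  assumes "0 < t" "t \<le> t1"
  obtains n s where "Gi t1 < s" "s \<le> t1" "t = (Gi ^^ n) s"
proof -
  have t1: "t1 > 0" using assms by simp
  have ex: "\<exists>n. t > (Gi ^^ n) t1"
    using Gin_lim[OF t1] assms(1) unfolding lim_sequentially
    by (metis abs_of_pos dist_0_norm dist_commute Gin_pos order_refl real_norm_def t1)
  define m where "m = (LEAST n. t > (Gi ^^ n) t1)"
  have m: "t > (Gi ^^ m) t1" unfolding m_def using ex by (rule LeastI_ex)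
  \<comment> \<open>\<open>m\<close> is the first index with iterate strictly below
    \<open>t\<close>; the required \<open>n\<close> is its predecessor, which exists because
    \<open>t <= t1\<close>.\<close>
  have "m \<noteq> 0" using m assms(2) by (cases m) auto
  then obtain n where n: "m = Suc n" by (cases m) auto
  have "\<not> t > (Gi ^^ n) t1" using not_less_Least[of n "\<lambda>n. t > (Gi ^^ n) t1"] n m_def by simp
  then have tn: "t \<le> (Gi ^^ n) t1" by simp
  have e: "t = (Gi ^^ n) ((G ^^ n) t)" using Gin_Gn[OF assms(1)] by simp
  show thesis
  proof (rule that [OF _ _ e])
    show "(G ^^ n) t \<le> t1"
      using e tn Gin_mono[OF t1, of "(G ^^ n) t" n] by (metis leD not_le_imp_less)
    have "(Gi ^^ n) (Gi t1) < t" using m n by (simp add: funpow_swap1)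
    then show "Gi t1 < (G ^^ n) t"
      using e Gin_mono_le[OF Gn_pos[OF assms(1)], of n "Gi t1" n] by (metis leD not_le_imp_less)
  qed
qed

end

section \<open>Inverse branches along an escaping ray\<close>

locale escaping_ray = ray_shift +
  fixes H :: "complex \<Rightarrow> complex" and P :: "complex set" and g :: "real \<Rightarrow> complex"
  assumes H: "H holomorphic_on UNIV" and lift: "lifts_off H P"
    and P: "closed P" "bounded P" "H ` P \<subseteq> P"
    and g_cont: "continuous_on {0<..} g"
    and Hg: "t > 0 \<Longrightarrow> H (g t) = g (G t)"
    and esc: "t > 0 \<Longrightarrow> filterlim (\<lambda>n. (H ^^ n) (g t)) at_infinity sequentially"
begin

lemma Hn_g: "t > 0 \<Longrightarrow> (H ^^ n) (g t) = g ((G ^^ n) t)"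
  by (induction n) (auto simp: Hg Gn_pos)

lemma Hn_P: "z \<in> P \<Longrightarrow> (H ^^ n) z \<in> P"
  using P(3) by (induction n) auto

lemma Hn_hol: "(H ^^ n) holomorphic_on UNIV"
proof (induction n)
  case (Suc n)
  have "(H \<circ> (H ^^ n)) holomorphic_on UNIV"
    using Suc H by (rule holomorphic_on_compose_gen) auto
  then show ?case by (metis funpow.simps(2))
qed (simp add: id_def)

lemma g_not_P: assumes "t > 0" shows "g t \<notin> P"
proof
  assume "g t \<in> P"
  then have "(H ^^ n) (g t) \<in> P" for n by (rule Hn_P)
  moreover obtain B where B: "\<And>x. x \<in> P \<Longrightarrow> norm x \<le> B" using P(2) unfolding bounded_iff by blast
  moreover have "eventually (\<lambda>n. norm ((H ^^ n) (g t)) \<ge> \<bar>B\<bar> + 1) sequentially"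
    using esc[OF assms] by (subst (asm) filterlim_at_infinity [of 0]) auto
  then obtain n where "norm ((H ^^ n) (g t)) \<ge> \<bar>B\<bar> + 1" unfolding eventually_sequentially by blast
  ultimately show False by (smt (verit))
qed

lemma deriv_Hn: "(H ^^ n) z \<notin> P \<Longrightarrow> deriv (H ^^ n) z \<noteq> 0"
  using lifts_off_deriv [OF lifts_off_funpow [OF lift P(3)] Hn_hol P(1)] .

text \<open>The last clause is limited to parameter intervals around \<open>s\<close> on which
  \<open>g\<close> stays in the disc: when the ray returns to the disc at other potentials, its
  backward orbit may follow a different inverse branch.\<close>

lemma pullback:
  assumes s: "s > 0" and R: "R > 0" "ball (g s) R \<inter> P = {}"
  obtains \<phi> where "\<And>n. \<phi> n holomorphic_on ball (g s) R"
    "\<And>n w. w \<in> ball (g s) R \<Longrightarrow> (H ^^ n) (\<phi> n w) = w"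
    "\<And>n w. w \<in> ball (g s) R \<Longrightarrow> \<phi> n w \<notin> P"
    "\<And>n a b s'. 0 < a \<Longrightarrow> a < s \<Longrightarrow> s < b \<Longrightarrow> g ` {a<..<b} \<subseteq> ball (g s) R \<Longrightarrow> s' \<in> {a<..<b} \<Longrightarrow> \<phi> n (g s') = g ((Gi ^^ n) s')"
proof -
  have "\<exists>\<Phi>. \<Phi> holomorphic_on ball (g s) R \<and> \<Phi> (g s) = g ((Gi ^^ n) s) \<and> (\<forall>u\<in>ball (g s) R. (H ^^ n) (\<Phi> u) = u)" for n
  proof -
    have e: "(H ^^ n) (g ((Gi ^^ n) s)) = (\<lambda>u. u) (g s)" using Hn_g Gin_pos Gn_Gin s by simp
    have nP: "\<And>u. u \<in> ball (g s) R \<Longrightarrow> (\<lambda>u. u) u \<notin> P" using R by blast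
    show ?thesis
      using lifts_offD [OF lifts_off_funpow [OF lift P(3)] holomorphic_on_ident nP e R(1)] by metis
  qed
  then obtain \<phi> where \<phi>: "\<And>n. \<phi> n holomorphic_on ball (g s) R" "\<And>n. \<phi> n (g s) = g ((Gi ^^ n) s)"
    "\<And>n w. w \<in> ball (g s) R \<Longrightarrow> (H ^^ n) (\<phi> n w) = w" by metis
  show thesis
  proof (rule that [OF \<phi>(1) \<phi>(3)])
    show "\<phi> n w \<notin> P" if "w \<in> ball (g s) R" for n w
      using \<phi>(3)[OF that, of n] Hn_P[of "\<phi> n w" n] R(2) that by auto
    show "\<phi> n (g s') = g ((Gi ^^ n) s')"
      if ab: "0 < a" "a < s" "s < b" "g ` {a<..<b} \<subseteq> ball (g s) R" "s' \<in> {a<..<b}" for n a b s'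
    proof (rule lift_unique [OF Hn_hol[of n], where U = "{a<..<b}" and a = s and b = s' and p = "\<lambda>x. \<phi> n (g x)" and q = "\<lambda>x. g ((Gi ^^ n) x)"])
      show "continuous_on {a<..<b} (\<lambda>x. \<phi> n (g x))"
        by (rule continuous_on_compose2 [OF holomorphic_on_imp_continuous_on [OF \<phi>(1)] _ ab(4)])
           (rule continuous_on_subset [OF g_cont], use ab in auto)
      show "continuous_on {a<..<b} (\<lambda>x. g ((Gi ^^ n) x))"
        by (rule continuous_on_compose2 [OF g_cont continuous_on_subset [OF Gin_cont]]) (use ab Gin_pos in auto)
      show "(H ^^ n) (\<phi> n (g x)) = (H ^^ n) (g ((Gi ^^ n) x))" if "x \<in> {a<..<b}" for x
      proof -
        have "g x \<in> ball (g s) R" using that ab(4) by blast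
        moreover have "x > 0" using that ab by simp
        ultimately show ?thesis using \<phi>(3) Hn_g Gin_pos Gn_Gin by simp
      qed
      show "deriv (H ^^ n) (\<phi> n (g x)) \<noteq> 0" if "x \<in> {a<..<b}" for x
      proof -
        have "g x \<in> ball (g s) R" using that ab(4) by blast
        then have "(H ^^ n) (\<phi> n (g x)) \<notin> P" using \<phi>(3)[of "g x" n] R(2) by auto
        then show ?thesis by (rule deriv_Hn)
      qed
    qed (use ab \<phi>(2) in auto)
  qed
qed

text \<open>A non-constant limit of pullbacks would be hit by the ray at an escaping point \<open>y\<close> which is
  a value of almost all pullbacks, so that infinitely many iterates of \<open>y\<close> stay bounded.\<close>

lemma pullback_limit_constant:
  assumes s: "s > 0" and R: "R > 0"
    and \<psi>: "\<And>j::nat. \<psi> j holomorphic_on ball (g s) R"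
    and inv: "\<And>j w. w \<in> ball (g s) R \<Longrightarrow> (H ^^ (N j)) (\<psi> j w) = w"
    and ray: "\<And>j. \<psi> j (g s) = g ((Gi ^^ (N j)) s)"
    and N: "filterlim N at_top sequentially"
    and h: "h holomorphic_on ball (g s) R"
    and lim: "\<And>K. compact K \<Longrightarrow> K \<subseteq> ball (g s) R \<Longrightarrow> uniform_limit K \<psi> h sequentially"
  shows "h constant_on ball (g s) R"
proof (rule ccontr)
  assume nc: "\<not> h constant_on ball (g s) R"
  define x0 where "x0 = g s"
  obtain \<beta> where \<beta>: "\<beta> \<in> ball x0 R" "h \<beta> \<noteq> h x0" using nc unfolding constant_on_def x0_def by blast
  have hh: "(\<lambda>z. h z - h x0) holomorphic_on ball x0 R" using h unfolding x0_def by (intro holomorphic_intros)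
  obtain \<rho> where \<rho>: "\<rho> > 0" "ball x0 \<rho> \<subseteq> ball x0 R" "\<And>z. z \<in> ball x0 \<rho> - {x0} \<Longrightarrow> h z - h x0 \<noteq> 0"
    by (rule isolated_zeros [OF hh, of x0 \<beta>]) (use \<beta> R in auto)
  define r where "r = \<rho> / 2"
  have r: "r > 0" "cball x0 r \<subseteq> ball x0 \<rho>" using \<rho>(1) by (auto simp: r_def)
  have rR: "cball x0 r \<subseteq> ball x0 R" using r \<rho> by blast
  have hc: "continuous_on (cball x0 r) h"
    using h rR unfolding x0_def by (meson holomorphic_on_imp_continuous_on holomorphic_on_subset)
  have "continuous_on (sphere x0 r) (\<lambda>z. norm (h z - h x0))"
    by (intro continuous_intros continuous_on_subset [OF hc]) auto
  moreover have "sphere x0 r \<noteq> {}" using r by simp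
  ultimately obtain zm where zm: "zm \<in> sphere x0 r" "\<And>z. z \<in> sphere x0 r \<Longrightarrow> norm (h zm - h x0) \<le> norm (h z - h x0)"
    using continuous_attains_inf [OF compact_sphere] by metis
  define m where "m = norm (h zm - h x0)"
  have "zm \<in> ball x0 \<rho> - {x0}" using zm(1) r by auto
  then have m: "m > 0" using \<rho>(3) by (simp add: m_def)
  have "uniform_limit (cball x0 r) \<psi> h sequentially"
    by (rule lim) (use rR in \<open>simp_all add: x0_def\<close>)
  then have "\<forall>\<^sub>F j in sequentially. \<forall>z\<in>cball x0 r. dist (\<psi> j z) (h z) < m / 8"
    by (rule uniform_limitD) (use m in simp)
  then obtain J where J: "\<And>j z. j \<ge> J \<Longrightarrow> z \<in> cball x0 r \<Longrightarrow> norm (\<psi> j z - h z) < m / 8"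
    unfolding eventually_sequentially dist_norm by blast
  define y where "y = \<psi> J x0"
  have y: "norm (y - h x0) < m / 8" using J[of J x0] r by (simp add: y_def)
  \<comment> \<open>On the circle \<open>\<psi> j z\<close> is at distance greater than
    \<open>3 * m / 4\<close> from \<open>y\<close>, at the centre at distance less than
    \<open>m / 4\<close>. By the minimum modulus principle the value \<open>y\<close> is taken
    inside, and \<open>H ^^ N j\<close> sends \<open>y\<close> back into the disc.\<close>
  have hit: "\<exists>z\<in>ball x0 r. (H ^^ (N j)) y = z" if j: "j \<ge> J" for j
  proof -
    have \<psi>h: "\<psi> j holomorphic_on ball x0 R" using \<psi> unfolding x0_def .
    obtain z where z: "z \<in> ball x0 r" "\<psi> j z - y = 0"
    proof (rule holomorphic_contract_to_zero [of x0 r "\<lambda>z. \<psi> j z - y"])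
      show "continuous_on (cball x0 r) (\<lambda>z. \<psi> j z - y)"
        by (intro continuous_intros holomorphic_on_imp_continuous_on holomorphic_on_subset [OF \<psi>h] rR)
      show "(\<lambda>z. \<psi> j z - y) holomorphic_on ball x0 r"
        by (intro holomorphic_intros holomorphic_on_subset [OF \<psi>h]) (use rR ball_subset_cball in blast)
      show "norm (\<psi> j x0 - y) < norm (\<psi> j z - y)" if "norm (x0 - z) = r" for z
      proof -
        have zs: "z \<in> sphere x0 r" using that by (simp add: dist_norm)
        have "norm (\<psi> j z - h z) < m / 8" "norm (\<psi> j x0 - h x0) < m / 8" using J[OF j] zs r by auto
        moreover have "norm (h z - h x0) \<ge> m" using zm(2)[OF zs] by (simp add: m_def)
        moreover have "norm (\<psi> j x0 - y) \<le> norm (\<psi> j x0 - h x0) + norm (y - h x0)"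
          using norm_triangle_ineq4[of "\<psi> j x0 - h x0" "y - h x0"] by simp
        moreover have "norm (h z - h x0) \<le> norm (\<psi> j z - y) + norm (\<psi> j z - h z) + norm (y - h x0)"
        proof -
          have "h z - h x0 = (\<psi> j z - y) - (\<psi> j z - h z) + (y - h x0)" by simp
          then have "norm (h z - h x0) \<le> norm ((\<psi> j z - y) - (\<psi> j z - h z)) + norm (y - h x0)"
            using norm_triangle_ineq[of "(\<psi> j z - y) - (\<psi> j z - h z)" "y - h x0"] by (simp only:)
          then show ?thesis using norm_triangle_ineq4[of "\<psi> j z - y" "\<psi> j z - h z"] by linarith
        qed
        ultimately show ?thesis using y m by linarith
      qed
    qed (use r in auto)
    then have "\<psi> j z = y" by simp
    moreover have "(H ^^ (N j)) (\<psi> j z) = z" using inv z(1) rR unfolding x0_def by (metis ball_subset_cball subsetD)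
    ultimately show ?thesis using z(1) by metis
  qed
  have yg: "y = g ((Gi ^^ (N J)) s)" unfolding y_def x0_def by (rule ray)
  have "filterlim (\<lambda>n. (H ^^ n) y) at_infinity sequentially"
    unfolding yg by (rule esc) (use Gin_pos s in auto)
  then have "filterlim (\<lambda>j. (H ^^ (N j)) y) at_infinity sequentially"
    using N by (rule filterlim_compose)
  then have "eventually (\<lambda>j. norm x0 + r \<le> norm ((H ^^ (N j)) y)) sequentially"
    by (subst (asm) filterlim_at_infinity [of 0]) (use r in \<open>auto simp: add_nonneg_pos\<close>)
  then obtain J' where J': "\<And>j. j \<ge> J' \<Longrightarrow> norm x0 + r \<le> norm ((H ^^ (N j)) y)" unfolding eventually_sequentially by blast
  obtain z where z: "z \<in> ball x0 r" "(H ^^ (N (max J J'))) y = z" using hit[of "max J J'"] by auto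
  have "norm z < norm x0 + r" using z(1) norm_triangle_sub[of z x0] by (simp add: dist_norm norm_minus_commute)
  then show False using J'[of "max J J'"] z(2) by simp
qed

text \<open>Local constancy of limits of pullbacks, stated for all sequences at once so that
  \<open>\<delta>\<close> depends on \<open>s\<close> alone. The potentials
  \<open>\<sigma> j\<close> may move with \<open>j\<close>, since they arise from representatives in
  a fundamental domain.\<close>

definition limits_spread :: "real \<Rightarrow> real \<Rightarrow> bool" where
  "limits_spread s \<delta> \<longleftrightarrow> (\<forall>(N :: nat \<Rightarrow> nat) \<sigma> \<zeta> s'. filterlim N at_top sequentially \<longrightarrow>
     (\<forall>j. \<sigma> j > 0 \<and> \<bar>\<sigma> j - s\<bar> < \<delta>) \<longrightarrow> (\<lambda>j. g ((Gi ^^ (N j)) (\<sigma> j))) \<longlonglongrightarrow> \<zeta> \<longrightarrow>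
     s' > 0 \<longrightarrow> \<bar>s' - s\<bar> < \<delta> \<longrightarrow> (\<lambda>j. g ((Gi ^^ (N j)) s')) \<longlonglongrightarrow> \<zeta>)"

lemma limits_spreadD:
  assumes "limits_spread s \<delta>" "filterlim N at_top sequentially" "\<And>j. \<sigma> j > 0 \<and> \<bar>\<sigma> j - s\<bar> < \<delta>"
    "(\<lambda>j. g ((Gi ^^ (N j)) (\<sigma> j))) \<longlonglongrightarrow> \<zeta>" "s' > 0" "\<bar>s' - s\<bar> < \<delta>"
  shows "(\<lambda>j. g ((Gi ^^ (N j)) s')) \<longlonglongrightarrow> \<zeta>"
  using assms unfolding limits_spread_def by meson

text \<open>Boundedness is known at the moving points \<open>g (\<sigma> j)\<close>, so Schottky's
  theorem is applied on discs centred there. Every subsequence then has a locally uniform limit,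
  which is constant, and its value is read off along the moving points.\<close>

lemma pullback_spread:
  assumes pq: "p \<in> P" "q \<in> P" "p \<noteq> q" and s: "s > 0"
  obtains \<delta> where "\<delta> > 0" "limits_spread s \<delta>"
proof -
  have "open (- P)" "g s \<in> - P" using g_not_P s P by auto
  then obtain R where R: "R > 0" "ball (g s) R \<subseteq> - P" by (rule openE[of "-P" "g s"])
  then have R': "ball (g s) R \<inter> P = {}" by blast
  have "isCont g s" using g_cont s by (simp add: continuous_on_eq_continuous_at)
  then obtain \<delta>0 where \<delta>0: "\<delta>0 > 0" "\<And>x. dist x s < \<delta>0 \<Longrightarrow> dist (g x) (g s) < R / 16"
    unfolding continuous_at_eps_delta using R(1) by (metis divide_pos_pos zero_less_numeral)
  define \<delta> where "\<delta> = min \<delta>0 (s / 2)"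
  have \<delta>: "\<delta> > 0" using \<delta>0 s by (simp add: \<delta>_def)
  have near: "g x \<in> ball (g s) (R / 16)" if "\<bar>x - s\<bar> < \<delta>" for x
    using \<delta>0(2)[of x] that by (simp add: \<delta>_def dist_real_def dist_commute)
  obtain \<phi> where \<phi>: "\<And>n. \<phi> n holomorphic_on ball (g s) R"
    "\<And>n w. w \<in> ball (g s) R \<Longrightarrow> (H ^^ n) (\<phi> n w) = w"
    "\<And>n w. w \<in> ball (g s) R \<Longrightarrow> \<phi> n w \<notin> P"
    "\<And>n a b s'. 0 < a \<Longrightarrow> a < s \<Longrightarrow> s < b \<Longrightarrow> g ` {a<..<b} \<subseteq> ball (g s) R \<Longrightarrow> s' \<in> {a<..<b} \<Longrightarrow> \<phi> n (g s') = g ((Gi ^^ n) s')"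
    using pullback [OF s R(1) R'] by metis
  have ray: "\<phi> n (g x) = g ((Gi ^^ n) x)" if "\<bar>x - s\<bar> < \<delta>" for n x
  proof (rule \<phi>(4) [of "s - \<delta>" "s + \<delta>"])
    show "g ` {s - \<delta><..<s + \<delta>} \<subseteq> ball (g s) R"
    proof
      fix y assume "y \<in> g ` {s - \<delta><..<s + \<delta>}"
      then obtain x where x: "y = g x" "\<bar>x - s\<bar> < \<delta>" by (auto simp: abs_less_iff)
      then show "y \<in> ball (g s) R" using near[of x] R(1) by auto
    qed
    show "0 < s - \<delta>" using s by (simp add: \<delta>_def min_def)
    show "x \<in> {s - \<delta><..<s + \<delta>}" using that by (auto simp: abs_less_iff)
  qed (use \<delta> in auto)
  have "limits_spread s \<delta>"
    unfolding limits_spread_def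
  proof (intro allI impI)
    fix N :: "nat \<Rightarrow> nat" and \<sigma> \<zeta> s'
    assume N: "filterlim N at_top sequentially" and \<sigma>: "\<forall>j. \<sigma> j > 0 \<and> \<bar>\<sigma> j - s\<bar> < \<delta>"
      and lim: "(\<lambda>j. g ((Gi ^^ (N j)) (\<sigma> j))) \<longlonglongrightarrow> \<zeta>" and s': "s' > 0" "\<bar>s' - s\<bar> < \<delta>"
    have lim': "(\<lambda>j. \<phi> (N j) (g (\<sigma> j))) \<longlonglongrightarrow> \<zeta>" using lim ray \<sigma> by simp
    then have "bounded (range (\<lambda>j. \<phi> (N j) (g (\<sigma> j))))" by (rule convergent_imp_bounded)
    then obtain B where B: "\<And>j. norm (\<phi> (N j) (g (\<sigma> j))) \<le> B"
      unfolding bounded_iff by auto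
    \<comment> \<open>The centre \<open>w\<close> of the Schottky disc is within
      \<open>R / 16\<close> of \<open>g s\<close>. The disc of radius \<open>R / 2\<close> about
      \<open>w\<close> stays in the domain of the branches, and \<open>S\<close> lies within
      \<open>R / 4\<close> of \<open>w\<close>, i.e. in the concentric disc of half the
      size.\<close>
    define S where "S = ball (g s) (R / 8)"
    have SR: "S \<subseteq> ball (g s) R" using R(1) by (auto simp: S_def)
    \<comment> \<open>Schottky's bound at radius 1/2 for a function that omits 0 and 1 and whose
      value at 0 is at most \<open>(B + norm p) / norm (q - p)\<close> in modulus.\<close>
    define C where "C = exp (pi * exp (pi * (2 + 2 * ((B + norm p) / norm (q - p)) + 12 * (1/2) / (1 - 1/2))))"
    have bnd: "norm (\<phi> (N j) x) \<le> norm p + norm (q - p) * C" if x: "x \<in> S" for j x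
    proof -
      define w where "w = g (\<sigma> j)"
      have w: "dist (g s) w < R / 16" using near \<sigma> unfolding w_def by auto
      \<comment> \<open>The affine normalisation moves the omitted values \<open>p\<close> and
        \<open>q\<close> to 0 and 1.\<close>
      define F where "F z = (\<phi> (N j) (w + of_real (R/2) * z) - p) / (q - p)" for z
      have inR: "w + of_real (R/2) * z \<in> ball (g s) R" if "norm z \<le> 1" for z
      proof -
        have "dist w (w + of_real (R/2) * z) = R / 2 * norm z" using R(1) by (simp add: dist_norm norm_mult)
        also have "\<dots> \<le> R / 2 * 1" using that R(1) by (intro mult_left_mono) auto
        finally have "dist (g s) (w + of_real (R/2) * z) \<le> dist (g s) w + R / 2"
          using dist_triangle[of "g s" "w + of_real (R/2) * z" w] by simp
        then show ?thesis using w R(1) by simp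
      qed
      have Fh: "F holomorphic_on cball 0 1"
      proof -
        have "(\<lambda>z. w + of_real (R/2) * z) ` cball 0 1 \<subseteq> ball (g s) R" using inR by auto
        moreover have "(\<lambda>z. w + of_real (R/2) * z) holomorphic_on cball 0 1" by (intro holomorphic_intros)
        ultimately have "(\<lambda>z. \<phi> (N j) (w + of_real (R/2) * z)) holomorphic_on cball 0 1"
          by (rule holomorphic_on_compose_gen [of "\<lambda>z. w + of_real (R/2) * z" "cball 0 1" "\<phi> (N j)", OF _ \<phi>(1), unfolded comp_def, rotated])
        then show ?thesis unfolding F_def using pq by (intro holomorphic_intros) auto
      qed
      have F0: "norm (F 0) \<le> (B + norm p) / norm (q - p)"
      proof -
        have "norm (\<phi> (N j) w - p) \<le> B + norm p"
          using B[of j] norm_triangle_ineq4[of "\<phi> (N j) w" p] by (simp add: w_def)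
        then show ?thesis by (simp add: F_def norm_divide divide_right_mono)
      qed
      have F01: "\<not> (F z = 0 \<or> F z = 1)" if "z \<in> cball 0 1" for z
      proof -
        have "\<phi> (N j) (w + of_real (R/2) * z) \<notin> P" using \<phi>(3) inR that by simp
        then show ?thesis using pq by (auto simp: F_def)
      qed
      define z where "z = (x - w) / of_real (R/2)"
      have "of_real (R/2) \<noteq> (0::complex)" using R(1) by simp
      then have xz: "x = w + of_real (R/2) * z" by (simp add: z_def del: of_real_divide)
      have "dist w x < R / 4"
        using x w dist_triangle[of w x "g s"] R(1) by (simp add: S_def dist_commute)
      moreover have "norm z = dist w x / (R/2)"
        using R(1) by (simp add: z_def norm_divide dist_norm norm_minus_commute del: of_real_divide)
      ultimately have z: "norm z \<le> 1/2" using R(1) by (simp add: divide_le_eq)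
      have "norm (F z) \<le> C"
        unfolding C_def by (rule Schottky [OF Fh F0 F01 _ _ z]) auto
      moreover have "norm (\<phi> (N j) x - p) = norm (q - p) * norm (F z)"
        using pq by (simp only: F_def xz[symmetric]) (simp add: norm_divide)
      ultimately have "norm (\<phi> (N j) x - p) \<le> norm (q - p) * C" by (simp add: mult_left_mono)
      then show ?thesis using norm_triangle_sub[of "\<phi> (N j) x" p] by simp
    qed
    have "(\<lambda>j. \<phi> (N j) (g s')) \<longlonglongrightarrow> \<zeta>"
    proof (rule tendsto_subseq_criterion)
      fix r :: "nat \<Rightarrow> nat" assume r: "strict_mono r"
      obtain h r' where h: "h holomorphic_on S" "strict_mono (r' :: nat \<Rightarrow> nat)"
          "\<And>K. compact K \<Longrightarrow> K \<subseteq> S \<Longrightarrow> uniform_limit K ((\<lambda>n. \<phi> (N (r n))) \<circ> r') h sequentially"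
      proof (rule Montel [of S "range (\<lambda>n. \<phi> (N (r n)))" "\<lambda>n. \<phi> (N (r n))"])
        show "open S" by (simp add: S_def)
        show "k holomorphic_on S" if "k \<in> range (\<lambda>n. \<phi> (N (r n)))" for k
          using that \<phi>(1) holomorphic_on_subset SR by blast
        show "\<exists>B. \<forall>h\<in>range (\<lambda>n. \<phi> (N (r n))). \<forall>z\<in>K. norm (h z) \<le> B" if "compact K" "K \<subseteq> S" for K
          using bnd that by (intro exI[of _ "norm p + norm (q - p) * C"]) blast
      qed auto
      define \<psi> where "\<psi> j = \<phi> (N (r (r' j)))" for j
      have ul: "uniform_limit K \<psi> h sequentially" if "compact K" "K \<subseteq> S" for K
        using h(3)[OF that] by (simp add: comp_def \<psi>_def[abs_def])
      have rr: "strict_mono (\<lambda>j. r (r' j))" using strict_mono_compose[OF r h(2)] by (simp add: comp_def)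
      have Nr: "filterlim (\<lambda>j. N (r (r' j))) at_top sequentially"
        using filterlim_compose [OF N filterlim_subseq [OF rr]] .
      have "h constant_on S"
        unfolding S_def
      proof (rule pullback_limit_constant [OF s _ _ _ _ Nr])
        show "\<psi> j holomorphic_on ball (g s) (R / 8)" for j
          unfolding \<psi>_def by (rule holomorphic_on_subset [OF \<phi>(1)]) (use SR S_def in auto)
        show "(H ^^ N (r (r' j))) (\<psi> j w) = w" if "w \<in> ball (g s) (R / 8)" for j w
          unfolding \<psi>_def using \<phi>(2) that SR S_def by blast
        show "\<psi> j (g s) = g ((Gi ^^ N (r (r' j))) s)" for j
          unfolding \<psi>_def by (rule ray) (use \<delta> in simp)
      qed (use R h(1) ul in \<open>auto simp: S_def\<close>)
      then obtain \<kappa> where \<kappa>: "\<And>x. x \<in> S \<Longrightarrow> h x = \<kappa>" unfolding constant_on_def by blast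
      define K where "K = cball (g s) (R / 16)"
      have K: "compact K" "K \<subseteq> S" using R(1) by (auto simp: K_def S_def)
      have \<sigma>K: "g (\<sigma> (r (r' j))) \<in> K" for j using near \<sigma> unfolding K_def by (meson ball_subset_cball subsetD)
      have sK: "g s' \<in> K" using near s' unfolding K_def by (meson ball_subset_cball subsetD)
      have "(\<lambda>j. \<psi> j (g (\<sigma> (r (r' j))))) \<longlonglongrightarrow> \<kappa>"
      proof (rule LIMSEQ_I)
        fix e :: real assume "e > 0"
        then have "\<forall>\<^sub>F j in sequentially. \<forall>x\<in>K. dist (\<psi> j x) (h x) < e"
          by (rule uniform_limitD[OF ul[OF K]])
        then obtain J where J: "\<And>j x. j \<ge> J \<Longrightarrow> x \<in> K \<Longrightarrow> dist (\<psi> j x) (h x) < e"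
          unfolding eventually_sequentially by blast
        show "\<exists>no. \<forall>n\<ge>no. norm (\<psi> n (g (\<sigma> (r (r' n)))) - \<kappa>) < e"
          using J[OF _ \<sigma>K] \<kappa>[OF subsetD[OF K(2) \<sigma>K]] by (intro exI[of _ J]) (simp add: dist_norm)
      qed
      moreover have "(\<lambda>j. \<psi> j (g (\<sigma> (r (r' j))))) \<longlonglongrightarrow> \<zeta>"
        using LIMSEQ_subseq_LIMSEQ [OF lim' rr] by (simp add: comp_def \<psi>_def)
      ultimately have "\<kappa> = \<zeta>" using LIMSEQ_unique by blast
      moreover have "(\<lambda>j. \<psi> j (g s')) \<longlonglongrightarrow> h (g s')"
        using tendsto_uniform_limitI [OF ul[OF K] sK] .
      ultimately have "(\<lambda>j. \<phi> (N (r (r' j))) (g s')) \<longlonglongrightarrow> \<zeta>"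
        using \<kappa>[OF subsetD[OF K(2) sK]] by (simp add: \<psi>_def)
      then show "\<exists>r'. strict_mono r' \<and> (\<lambda>n. \<phi> (N (r (r' n))) (g s')) \<longlonglongrightarrow> \<zeta>" using h(2) by blast
    qed
    then show "(\<lambda>j. g ((Gi ^^ (N j)) s')) \<longlonglongrightarrow> \<zeta>" using ray s'(2) by simp
  qed
  then show thesis using that \<delta> by blast
qed

text \<open>By connectedness of the set of potentials the limit \<open>\<zeta>\<close> spreads from
  \<open>s\<close> to every potential, in particular to \<open>G s\<close>. But the pullbacks at
  \<open>G s\<close> are the \<open>H\<close>-images of those at \<open>s\<close>, so they also tend
  to \<open>H \<zeta>\<close>.\<close>

lemma pullback_limit_fixed:
  assumes pq: "p \<in> P" "q \<in> P" "p \<noteq> q" and a: "a > 0"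
    and N: "filterlim N at_top sequentially" and \<sigma>: "\<And>j::nat. a \<le> \<sigma> j \<and> \<sigma> j \<le> b"
    and lim: "(\<lambda>j. g ((Gi ^^ (N j)) (\<sigma> j))) \<longlonglongrightarrow> \<zeta>"
  shows "H \<zeta> = \<zeta>"
proof -
  have "seq_compact {a..b}" by (simp add: seq_compact_eq_compact)
  then obtain s r where s: "s \<in> {a..b}" "strict_mono r" "(\<sigma> \<circ> r) \<longlonglongrightarrow> s"
    using \<sigma> by (metis seq_compactE atLeastAtMost_iff)
  have s0: "s > 0" using s(1) a by simp
  obtain \<delta> where \<delta>: "\<delta> > 0" "limits_spread s \<delta>"
    by (rule pullback_spread [OF pq s0])
  obtain J where J: "\<And>j. j \<ge> J \<Longrightarrow> \<bar>\<sigma> (r j) - s\<bar> < \<delta>"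
    using s(3) \<delta>(1) unfolding lim_sequentially comp_def dist_real_def by blast
  \<comment> \<open>The shift by \<open>J\<close> makes all potentials, not just almost all, lie
    within \<open>\<delta>\<close> of \<open>s\<close>, as \<open>limits_spread\<close>
    demands.\<close>
  define k where "k j = r (j + J)" for j
  have k: "strict_mono k" using s(2) unfolding k_def strict_mono_def by simp
  have Nk: "filterlim (\<lambda>j. N (k j)) at_top sequentially"
    using filterlim_compose [OF N filterlim_subseq [OF k]] .
  have limk: "(\<lambda>j. g ((Gi ^^ (N (k j))) (\<sigma> (k j)))) \<longlonglongrightarrow> \<zeta>"
    using LIMSEQ_subseq_LIMSEQ [OF lim k] by (simp add: comp_def)
  have at_s: "(\<lambda>j. g ((Gi ^^ (N (k j))) s)) \<longlonglongrightarrow> \<zeta>"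
  proof (rule limits_spreadD [OF \<delta>(2) Nk _ limk s0])
    show "\<sigma> (k j) > 0 \<and> \<bar>\<sigma> (k j) - s\<bar> < \<delta>" for j
      using J[of "j + J"] \<sigma>[of "k j"] a by (simp add: k_def)
  qed (use \<delta> in simp)
  have all: "(\<lambda>j. g ((Gi ^^ (N (k j))) x)) \<longlonglongrightarrow> \<zeta>" if x: "x > 0" for x
  proof (rule connected_induction_simple [of "{0<..}" s x "\<lambda>x. (\<lambda>j. g ((Gi ^^ (N (k j))) x)) \<longlonglongrightarrow> \<zeta>"])
    fix y :: real assume "y \<in> {0<..}"
    then have y: "y > 0" by simp
    obtain \<delta> where \<delta>: "\<delta> > 0" "limits_spread y \<delta>"
    by (rule pullback_spread [OF pq y])
    show "\<exists>T. openin (top_of_set {0<..}) T \<and> y \<in> T \<and> (\<forall>x\<in>T. \<forall>z\<in>T.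
        (\<lambda>j. g ((Gi ^^ (N (k j))) x)) \<longlonglongrightarrow> \<zeta> \<longrightarrow> (\<lambda>j. g ((Gi ^^ (N (k j))) z)) \<longlonglongrightarrow> \<zeta>)"
    proof (intro exI[of _ "{0<..} \<inter> ball y \<delta>"] conjI ballI impI)
      fix x z assume xz: "x \<in> {0<..} \<inter> ball y \<delta>" "z \<in> {0<..} \<inter> ball y \<delta>" and xl: "(\<lambda>j. g ((Gi ^^ (N (k j))) x)) \<longlonglongrightarrow> \<zeta>"
      show "(\<lambda>j. g ((Gi ^^ (N (k j))) z)) \<longlonglongrightarrow> \<zeta>"
        by (rule limits_spreadD [OF \<delta>(2) Nk _ xl]) (use xz in \<open>auto simp: dist_real_def abs_minus_commute\<close>)
    qed (use \<delta>(1) y in auto)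
  qed (use s0 x at_s in auto)
  have eq: "g ((Gi ^^ (N (k j))) (G s)) = H (g ((Gi ^^ (N (k j))) s))" for j
    using Hg Gin_G Gin_pos s0 by simp
  have "(\<lambda>j. H (g ((Gi ^^ (N (k j))) s))) \<longlonglongrightarrow> \<zeta>"
    using all[OF G_pos[OF s0]] by (simp only: eq)
  moreover have "isCont H \<zeta>"
    using H by (meson UNIV_I continuous_on_eq_continuous_at holomorphic_on_imp_continuous_on open_UNIV)
  then have "(\<lambda>j. H (g ((Gi ^^ (N (k j))) s))) \<longlonglongrightarrow> H \<zeta>" using at_s by (rule isCont_tendsto_compose)
  ultimately show ?thesis by (rule LIMSEQ_unique[rotated])
qed

lemma limit_point_fixed:
  assumes pq: "p \<in> P" "q \<in> P" "p \<noteq> q" and \<tau>: "\<And>j::nat. \<tau> j > 0" "\<tau> \<longlonglongrightarrow> 0"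
    and lim: "(\<lambda>j. g (\<tau> j)) \<longlonglongrightarrow> \<zeta>"
  shows "H \<zeta> = \<zeta>"
proof -
  obtain J where J: "\<And>j. j \<ge> J \<Longrightarrow> \<tau> j < 1"
    using \<tau> unfolding lim_sequentially dist_real_def by (metis abs_of_pos diff_zero zero_less_one)
  have "\<exists>n s. Gi 1 < s \<and> s \<le> 1 \<and> \<tau> (j + J) = (Gi ^^ n) s" for j
    using fundamental_domain [of "\<tau> (j + J)" 1] \<tau>(1) J[of "j + J"] by (metis le_add2 less_imp_le)
  then obtain N \<sigma> where N: "\<And>j. Gi 1 < \<sigma> j" "\<And>j. \<sigma> j \<le> 1" "\<And>j. \<tau> (j + J) = (Gi ^^ (N j)) (\<sigma> j)" by metis
  have G1: "Gi 1 > 0" by (rule Gi_pos) simp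
  have limJ: "(\<lambda>j. \<tau> (j + J)) \<longlonglongrightarrow> 0" using \<tau>(2) by (rule LIMSEQ_ignore_initial_segment)
  \<comment> \<open>Fewer than \<open>M\<close> backward steps from above \<open>Gi 1\<close> cannot
    lead below \<open>(Gi ^^ M) (Gi 1)\<close>.\<close>
  have "filterlim N at_top sequentially"
    unfolding filterlim_at_top
  proof
    fix M
    have e: "(Gi ^^ M) (Gi 1) > 0" using Gin_pos G1 by blast
    then have "eventually (\<lambda>j. \<tau> (j + J) < (Gi ^^ M) (Gi 1)) sequentially"
      using limJ by (rule order_tendstoD(2) [rotated])
    then show "eventually (\<lambda>j. M \<le> N j) sequentially"
    proof eventually_elim
      case (elim j)
      show ?case
      proof (rule ccontr)
        assume "\<not> M \<le> N j"
        then have "(Gi ^^ M) (Gi 1) \<le> (Gi ^^ (N j)) (Gi 1)" by (intro Gin_antimono G1) simp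
        also have "\<dots> \<le> (Gi ^^ (N j)) (\<sigma> j)" using N(1)[of j] G1 by (intro Gin_mono_le) auto
        finally show False using elim N(3)[of j] by simp
      qed
    qed
  qed
  moreover have "(\<lambda>j. g ((Gi ^^ (N j)) (\<sigma> j))) \<longlonglongrightarrow> \<zeta>"
    using LIMSEQ_ignore_initial_segment [OF lim, of J] N(3) by simp
  ultimately show ?thesis
    using pullback_limit_fixed [OF pq G1, of N \<sigma> 1 \<zeta>] N(1,2) by (simp add: less_imp_le)
qed

lemma not_fixed: assumes "t > 0" shows "H (g t) \<noteq> g t"
proof
  assume "H (g t) = g t"
  then have "(H ^^ n) (g t) = g t" for n by (induction n) auto
  then have "filterlim (\<lambda>n::nat. g t) at_infinity sequentially" using esc[OF assms] by simp
  then have "\<forall>r>0. r \<le> norm (g t)" by (simp add: filterlim_at_infinity [of 0])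
  then have "norm (g t) + 1 \<le> norm (g t)" by (metis add_nonneg_pos norm_ge_zero zero_less_one)
  then show False by simp
qed

section \<open>Landing, and exclusion of infinity\<close>

lemma lands_unless_to_infinity:
  assumes pq: "p \<in> P" "q \<in> P" "p \<noteq> q" and ninf: "\<not> filterlim g at_infinity (at_right 0)"
  obtains \<zeta> where "H \<zeta> = \<zeta>" "(g \<longlongrightarrow> \<zeta>) (at_right 0)"
proof -
  have ex: "\<exists>t. 0 < t \<and> t < e \<and> Q t" if "\<not> eventually (\<lambda>t. \<not> Q t) (at_right 0)" "e > 0" for Q and e :: real
    using that unfolding eventually_at_right_field by blast
  have inv0: "(\<lambda>n. \<tau> n) \<longlonglongrightarrow> 0" if "\<And>n. 0 < \<tau> n \<and> \<tau> n < inverse (real (Suc n))" for \<tau>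
    by (rule real_tendsto_sandwich [OF _ _ tendsto_const LIMSEQ_inverse_real_of_nat])
       (use that in \<open>auto simp: less_imp_le\<close>)
  have conv: "\<exists>\<zeta> r. \<zeta> \<in> K \<and> strict_mono r \<and> (\<lambda>n. g (\<tau> (r n))) \<longlonglongrightarrow> \<zeta> \<and> H \<zeta> = \<zeta>"
    if K: "compact K" and \<tau>: "\<And>n. 0 < \<tau> n \<and> \<tau> n < inverse (real (Suc n)) \<and> g (\<tau> n) \<in> K" for K \<tau>
  proof -
    have "seq_compact K" using K by (simp add: seq_compact_eq_compact)
    then obtain \<zeta> r where \<zeta>: "\<zeta> \<in> K" "strict_mono r" "((\<lambda>n. g (\<tau> n)) \<circ> r) \<longlonglongrightarrow> \<zeta>"
      using \<tau> by (metis seq_compactE)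
    have "(\<lambda>n. \<tau> (r n)) \<longlonglongrightarrow> 0"
      using LIMSEQ_subseq_LIMSEQ [OF inv0 \<zeta>(2), of \<tau>] \<tau> by (simp add: comp_def)
    then have "H \<zeta> = \<zeta>"
      using limit_point_fixed [OF pq, of "\<lambda>n. \<tau> (r n)" \<zeta>] \<tau> \<zeta>(3) by (simp add: comp_def)
    then show ?thesis using \<zeta> by (auto simp: comp_def)
  qed
  obtain B where B: "\<not> eventually (\<lambda>t. \<not> norm (g t) < B) (at_right 0)"
    using ninf by (auto simp: filterlim_at_infinity [of 0] not_less)
  have "\<forall>n. \<exists>t. 0 < t \<and> t < inverse (real (Suc n)) \<and> norm (g t) < B"
    using ex[OF B] by simp
  then obtain \<tau> where \<tau>: "\<And>n. 0 < \<tau> n \<and> \<tau> n < inverse (real (Suc n)) \<and> norm (g (\<tau> n)) < B" by metis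
  then have "\<And>n. 0 < \<tau> n \<and> \<tau> n < inverse (real (Suc n)) \<and> g (\<tau> n) \<in> cball 0 B" by (simp add: less_imp_le)
  from conv[OF compact_cball this]
  obtain \<zeta> k where \<zeta>: "strict_mono k" "(\<lambda>n. g (\<tau> (k n))) \<longlonglongrightarrow> \<zeta>" "H \<zeta> = \<zeta>" by blast
  have \<tau>0: "(\<lambda>n. \<tau> (k n)) \<longlonglongrightarrow> 0"
    using LIMSEQ_subseq_LIMSEQ [OF inv0 \<zeta>(1), of \<tau>] \<tau> by (simp add: comp_def)
  have near: "\<exists>t. 0 < t \<and> t < d \<and> dist (g t) \<zeta> < e" if "d > 0" "e > 0" for d e
  proof -
    have "eventually (\<lambda>n. \<tau> (k n) < d) sequentially" using \<tau>0 that(1) by (rule order_tendstoD)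
    moreover have "eventually (\<lambda>n. dist (g (\<tau> (k n))) \<zeta> < e) sequentially" using \<zeta>(2) that(2) by (rule tendstoD)
    ultimately have "eventually (\<lambda>n. \<tau> (k n) < d \<and> dist (g (\<tau> (k n))) \<zeta> < e) sequentially" by (rule eventually_conj)
    then obtain n where "\<tau> (k n) < d \<and> dist (g (\<tau> (k n))) \<zeta> < e" unfolding eventually_sequentially by blast
    then show ?thesis using \<tau> by blast
  qed
  have hol: "(\<lambda>z. H z - z) holomorphic_on UNIV" by (intro holomorphic_intros H)
  obtain \<rho> where \<rho>: "\<rho> > 0" "ball \<zeta> \<rho> \<subseteq> UNIV" "\<And>z. z \<in> ball \<zeta> \<rho> - {\<zeta>} \<Longrightarrow> H z - z \<noteq> 0"
    by (rule isolated_zeros [OF hol open_UNIV connected_UNIV UNIV_I, of \<zeta> "g 1"])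
       (use \<zeta>(3) not_fixed[of 1] in auto)
  have "(g \<longlongrightarrow> \<zeta>) (at_right 0)"
  proof (rule ccontr)
    assume "\<not> (g \<longlongrightarrow> \<zeta>) (at_right 0)"
    then obtain e0 where e0: "e0 > 0" "\<not> eventually (\<lambda>t. dist (g t) \<zeta> < e0) (at_right 0)"
      unfolding tendsto_iff by blast
    define e where "e = min e0 (\<rho> / 2)"
    have e: "e > 0" "e < \<rho>" using e0 \<rho> by (auto simp: e_def)
    have far: "\<exists>t. 0 < t \<and> t < d \<and> dist (g t) \<zeta> \<ge> e" if "d > 0" for d
      using ex[of "\<lambda>t. dist (g t) \<zeta> \<ge> e0" d] e0(2) that by (fastforce simp: not_le e_def)
    \<comment> \<open>A ray that comes close to \<open>\<zeta>\<close> and leaves again at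
      arbitrarily small potentials crosses this circle each time; the crossings would accumulate at
      another fixed point near \<open>\<zeta>\<close>.\<close>
    have mid: "\<exists>t. 0 < t \<and> t < d \<and> g t \<in> sphere \<zeta> e" if d: "d > 0" for d
    proof -
      obtain t1 where t1: "0 < t1" "t1 < d" "dist (g t1) \<zeta> \<ge> e" using far[OF d] by blast
      obtain t2 where t2: "0 < t2" "t2 < d" "dist (g t2) \<zeta> < e" using near[OF d e(1)] by blast
      have c: "continuous_on {u..v} (\<lambda>t. dist (g t) \<zeta>)" if "0 < u" for u v
        by (intro continuous_intros continuous_on_subset [OF g_cont]) (use that in auto)
      have "\<exists>t. 0 < t \<and> t < d \<and> dist (g t) \<zeta> = e"
      proof (cases "t1 \<le> t2")
        case True
        then obtain x where "t1 \<le> x" "x \<le> t2" "dist (g x) \<zeta> = e"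
          using IVT2' [of "\<lambda>t. dist (g t) \<zeta>" t2 e t1] t1 t2 c[of t1 t2] by auto
        then show ?thesis using t1 t2 by (intro exI[of _ x]) simp
      next
        case False
        then obtain x where "t2 \<le> x" "x \<le> t1" "dist (g x) \<zeta> = e"
          using IVT' [of "\<lambda>t. dist (g t) \<zeta>" t2 e t1] t1 t2 c[of t2 t1] by auto
        then show ?thesis using t1 t2 by (intro exI[of _ x]) simp
      qed
      then show ?thesis by (auto simp: dist_commute)
    qed
    have "\<forall>n. \<exists>t. 0 < t \<and> t < inverse (real (Suc n)) \<and> g t \<in> sphere \<zeta> e" using mid by simp
    then obtain \<tau> where "\<And>n. 0 < \<tau> n \<and> \<tau> n < inverse (real (Suc n)) \<and> g (\<tau> n) \<in> sphere \<zeta> e" by metis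
    from conv[OF compact_sphere this]
    obtain \<xi> where "\<xi> \<in> sphere \<zeta> e" "H \<xi> = \<xi>" by blast
    then show False using \<rho>(3)[of \<xi>] e by force
  qed
  then show thesis using that \<zeta>(3) by blast
qed

text \<open>In the logarithm \<open>l\<close> of the ray, passing from \<open>t\<close> to
  \<open>Gi t\<close> is a branch of the inverse of \<open>H\<close>, and this branch contracts by
  1/2 far to the right. The backward orbit of one point therefore moves a bounded distance and
  cannot tend to infinity.\<close>

lemma not_to_infinity:
  assumes nH: "\<not> filterlim H at_infinity at_infinity"
  shows "\<not> filterlim g at_infinity (at_right 0)"
proof
  assume inf: "filterlim g at_infinity (at_right 0)"
  obtain B where B: "\<And>x. x \<in> P \<Longrightarrow> norm x \<le> B" using P(2) unfolding bounded_iff by blast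
  \<comment> \<open>Including \<open>norm (H 0)\<close> makes \<open>log_branch\<close> applicable
    with both centres equal to 0.\<close>
  define r where "r = max 1 (max B (norm (H 0)))"
  have r: "r > 0" "P \<subseteq> cball 0 r" "dist 0 (H 0) \<le> r" using B by (auto simp: r_def le_max_iff_disj)
  \<comment> \<open>To the right of \<open>M\<close> the derivative bound
    \<open>12 * pi / (Re u - ln r)\<close> is at most 1/2.\<close>
  define M where "M = ln r + 24 * pi"
  have "eventually (\<lambda>t. exp (M + 1) \<le> norm (g t)) (at_right 0)"
    using inf by (subst (asm) filterlim_at_infinity [of 0]) auto
  then obtain t1 where t1: "t1 > 0" "\<And>t. 0 < t \<Longrightarrow> t < t1 \<Longrightarrow> exp (M + 1) \<le> norm (g t)"
    unfolding eventually_at_right_field by blast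
  define t0 where "t0 = t1 / 2"
  have t0: "t0 > 0" "t0 < t1" using t1 by (auto simp: t0_def)
  have big: "exp (M + 1) \<le> norm (g t)" if "t \<in> {0<..t0}" for t using t1(2)[of t] that t0 by simp
  have gnz: "g t \<noteq> 0" if "t \<in> {0<..t0}" for t
    using big[OF that] by (metis exp_gt_zero not_le norm_zero)
  obtain l where l: "continuous_on {0<..t0} l" "\<And>t. t \<in> {0<..t0} \<Longrightarrow> g t = exp (l t)"
    by (rule continuous_logarithm_on_contractible [of "{0<..t0}" g])
       (auto intro: continuous_on_subset [OF g_cont] convex_imp_contractible simp: gnz)
  have lM: "M + 1 \<le> Re (l t)" if "t \<in> {0<..t0}" for t
    using big[OF that] l(2)[OF that] by simp
  have lr: "ln r < Re (l t)" if "t \<in> {0<..t0}" for t using lM[OF that] by (simp add: M_def) (smt (verit) pi_gt_zero)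
  have Gi_in: "Gi t \<in> {0<..t0}" if "t \<in> {0<..t0}" for t
    using Gi_pos[of t] Gi_less[of t] that by simp
  have t0_in: "t0 \<in> {0<..t0}" using t0 by simp
  have HGi: "H (g (Gi t)) = exp (l t)" if "t \<in> {0<..t0}" for t
    using Hg[OF Gi_pos] G_Gi l(2)[OF that] that by simp
  obtain \<psi> where \<psi>: "\<psi> holomorphic_on {u. ln r < Re u}" "0 + exp (\<psi> (l t0)) = g (Gi t0)"
    "\<And>u. ln r < Re u \<Longrightarrow> H (0 + exp (\<psi> u)) = 0 + exp u"
    "\<And>u. ln r < Re u \<Longrightarrow> norm (deriv \<psi> u) \<le> 12 * pi / (Re u - ln r)"
    by (rule log_branch [OF H nH lift P(1) r(2,1,3), of "l t0" "g (Gi t0)"]) (use lr t0_in HGi in auto)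
  have \<psi>c: "continuous_on {0<..t0} (\<lambda>t. \<psi> (l t))"
    by (rule continuous_on_compose2 [OF holomorphic_on_imp_continuous_on [OF \<psi>(1)] l(1)]) (use lr in auto)
  have Gic: "continuous_on {0<..t0} Gi" by (rule continuous_on_subset [OF Gi_cont]) auto
  have conn: "connected {0<..t0}" by (intro convex_connected) simp
  have e\<psi>: "exp (\<psi> (l t)) = g (Gi t)" if t: "t \<in> {0<..t0}" for t
  proof (rule lift_unique [OF H conn, where a = t0 and b = t and p = "\<lambda>t. exp (\<psi> (l t))" and q = "\<lambda>t. g (Gi t)"])
    show "continuous_on {0<..t0} (\<lambda>t. exp (\<psi> (l t)))" by (intro continuous_intros \<psi>c)
    show "continuous_on {0<..t0} (\<lambda>t. g (Gi t))"
      by (rule continuous_on_compose2 [OF g_cont Gic]) (use Gi_pos in auto)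
    show "H (exp (\<psi> (l x))) = H (g (Gi x))" if "x \<in> {0<..t0}" for x
      using \<psi>(3)[OF lr[OF that]] HGi[OF that] by simp
    show "deriv H (exp (\<psi> (l x))) \<noteq> 0" if "x \<in> {0<..t0}" for x
    proof (rule lifts_off_deriv [OF lift H P(1)])
      show "H (exp (\<psi> (l x))) \<notin> P" using \<psi>(3)[OF lr[OF that]] l(2)[OF that] g_not_P[of x] that by simp
    qed
  qed (use t t0_in \<psi>(2) in auto)
  \<comment> \<open>\<open>\<psi>\<close> follows the right branch of the inverse of
    \<open>H\<close>, but its logarithm may differ from \<open>l\<close> by a multiple of
    \<open>2 * pi * \<i>\<close>; \<open>\<kappa>\<close> is this constant.\<close>
  define \<kappa> where "\<kappa> = \<psi> (l t0) - l (Gi t0)"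
  have ek: "exp \<kappa> = 1"
    using e\<psi>[OF t0_in] l(2)[OF Gi_in[OF t0_in]] by (simp add: \<kappa>_def exp_diff)
  have \<psi>l: "\<psi> (l t) - \<kappa> = l (Gi t)" if t: "t \<in> {0<..t0}" for t
  proof (rule lift_unique [OF holomorphic_on_exp conn, where a = t0 and b = t and p = "\<lambda>t. \<psi> (l t) - \<kappa>" and q = "\<lambda>t. l (Gi t)"])
    show "continuous_on {0<..t0} (\<lambda>t. \<psi> (l t) - \<kappa>)" by (intro continuous_intros \<psi>c)
    show "continuous_on {0<..t0} (\<lambda>t. l (Gi t))"
      by (rule continuous_on_compose2 [OF l(1) Gic]) (use Gi_in in auto)
    show "exp (\<psi> (l x) - \<kappa>) = exp (l (Gi x))" if "x \<in> {0<..t0}" for x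
      using e\<psi>[OF that] l(2)[OF Gi_in[OF that]] ek by (simp add: exp_diff)
    show "\<psi> (l t0) - \<kappa> = l (Gi t0)" by (simp add: \<kappa>_def)
    show "deriv exp (\<psi> (l x) - \<kappa>) \<noteq> 0" for x by (simp add: DERIV_imp_deriv [OF DERIV_exp])
  qed (use t t0_in in auto)
  have contr: "norm (\<psi> u - \<psi> v) \<le> 1/2 * norm (u - v)" if "M < Re u" "M < Re v" for u v
  proof (rule field_differentiable_bound [of "{u. M < Re u}" \<psi> "deriv \<psi>"])
    show "convex {u. M < Re u}" by (rule convex_halfspace_Re_gt)
    fix z assume "z \<in> {u. M < Re u}"
    then have z: "24 * pi < Re z - ln r" by (simp add: M_def)
    then have zr: "ln r < Re z" by (smt (verit) pi_gt_zero)
    show "(\<psi> has_field_derivative deriv \<psi> z) (at z within {u. M < Re u})"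
      using holomorphic_derivI [OF \<psi>(1) open_halfspace_Re_gt] zr by simp
    have "12 * pi / (Re z - ln r) \<le> 1 / 2" using z zr by (simp add: field_simps)
    then show "norm (deriv \<psi> z) \<le> 1/2" using \<psi>(4)[OF zr] by linarith
  qed (use that in auto)
  define x where "x n = l ((Gi ^^ n) t0)" for n
  have in_n: "(Gi ^^ n) t0 \<in> {0<..t0}" for n using Gin_pos[OF t0(1)] Gin_antimono[OF t0(1), of 0 n] by simp
  have xS: "x (Suc n) = \<psi> (x n) - \<kappa>" for n using \<psi>l[OF in_n[of n]] by (simp add: x_def)
  define D where "D = norm (x 1 - x 0)"
  have xM: "M < Re (x n)" for n using lM[OF in_n[of n]] by (simp add: x_def)
  have step: "norm (x (Suc n) - x n) \<le> D / 2 ^ n" for n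
  proof (induction n)
    case (Suc n)
    have "x (Suc (Suc n)) - x (Suc n) = \<psi> (x (Suc n)) - \<psi> (x n)"
      unfolding xS[of "Suc n"] by (subst (2) xS[of n]) simp
    then have "norm (x (Suc (Suc n)) - x (Suc n)) \<le> 1/2 * norm (x (Suc n) - x n)"
      using contr xM by metis
    then show ?case using Suc by simp
  qed (simp add: D_def)
  \<comment> \<open>The partial sums of the geometric series with first term \<open>D\<close> and
    ratio 1/2.\<close>
  have bdd: "norm (x n - x 0) \<le> 2 * D * (1 - 1 / 2 ^ n)" for n
  proof (induction n)
    case (Suc n)
    have "norm (x (Suc n) - x 0) \<le> norm (x (Suc n) - x n) + norm (x n - x 0)"
      using norm_triangle_ineq[of "x (Suc n) - x n" "x n - x 0"] by simp
    also have "\<dots> \<le> D / 2 ^ n + 2 * D * (1 - 1 / 2 ^ n)" using step[of n] Suc by linarith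
    also have "\<dots> = 2 * D * (1 - 1 / 2 ^ Suc n)" by (simp add: field_simps)
    finally show ?case .
  qed simp
  have up: "Re (x n) \<le> Re (x 0) + 2 * D" for n
  proof -
    have "Re (x n) - Re (x 0) \<le> norm (x n - x 0)" using complex_Re_le_cmod[of "x n - x 0"] by simp
    also have "\<dots> \<le> 2 * D * 1" using bdd[of n] by (rule order_trans) (intro mult_left_mono, auto simp: D_def)
    finally show ?thesis by simp
  qed
  have "filterlim (\<lambda>n. (Gi ^^ n) t0) (at_right 0) sequentially"
    using Gin_lim[OF t0(1)] Gin_pos[OF t0(1)] by (intro tendsto_imp_filterlim_at_right) auto
  then have "filterlim (\<lambda>n. g ((Gi ^^ n) t0)) at_infinity sequentially"
    by (rule filterlim_compose [OF inf])
  then have "eventually (\<lambda>n. exp (Re (x 0) + 2 * D + 1) \<le> norm (g ((Gi ^^ n) t0))) sequentially"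
    by (subst (asm) filterlim_at_infinity [of 0]) auto
  then obtain n where "exp (Re (x 0) + 2 * D + 1) \<le> norm (g ((Gi ^^ n) t0))" unfolding eventually_sequentially by blast
  then have "Re (x 0) + 2 * D + 1 \<le> Re (x n)" using l(2)[OF in_n[of n]] by (simp add: x_def)
  then show False using up[of n] by simp
qed

lemma not_attracting:
  assumes \<zeta>: "H \<zeta> = \<zeta>" "(g \<longlongrightarrow> \<zeta>) (at_right 0)"
  shows "norm (deriv H \<zeta>) \<ge> 1"
proof (rule ccontr)
  assume "\<not> norm (deriv H \<zeta>) \<ge> 1"
  then have lt: "norm (deriv H \<zeta>) < 1" by simp
  have "(H has_field_derivative deriv H \<zeta>) (at \<zeta>)"
    using holomorphic_derivI [OF H open_UNIV] by simp
  then have "((\<lambda>z. norm ((H z - \<zeta>) / (z - \<zeta>))) \<longlongrightarrow> norm (deriv H \<zeta>)) (at \<zeta>)"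
    unfolding has_field_derivative_iff \<zeta>(1) by (rule tendsto_norm)
  then have "eventually (\<lambda>z. norm ((H z - \<zeta>) / (z - \<zeta>)) < 1) (at \<zeta>)"
    using lt by (rule order_tendstoD)
  then obtain d where d: "d > 0" "\<And>z. z \<noteq> \<zeta> \<Longrightarrow> dist z \<zeta> < d \<Longrightarrow> norm ((H z - \<zeta>) / (z - \<zeta>)) < 1"
    unfolding eventually_at by blast
  have step: "dist (H z) \<zeta> < d" if "dist z \<zeta> < d" for z
  proof (cases "z = \<zeta>")
    case False
    then have "norm (H z - \<zeta>) < norm (z - \<zeta>)" using d(2)[OF False that] by (simp add: norm_divide divide_simps)
    then show ?thesis using that by (simp add: dist_norm)
  qed (use \<zeta> d in simp)
  have "eventually (\<lambda>t. dist (g t) \<zeta> < d) (at_right 0)" using \<zeta>(2) d(1) by (rule tendstoD)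
  then obtain b where "b > 0" "\<And>t. 0 < t \<Longrightarrow> t < b \<Longrightarrow> dist (g t) \<zeta> < d"
    unfolding eventually_at_right_field by blast
  then obtain t where t: "t > 0" "dist (g t) \<zeta> < d" by (meson dense)
  have near: "dist ((H ^^ n) (g t)) \<zeta> < d" for n by (induction n) (auto simp: t step)
  have "eventually (\<lambda>n. norm \<zeta> + d \<le> norm ((H ^^ n) (g t))) sequentially"
    using esc[OF t(1)] by (subst (asm) filterlim_at_infinity [of 0]) (auto simp: d add_nonneg_pos)
  then obtain n where "norm \<zeta> + d \<le> norm ((H ^^ n) (g t))" unfolding eventually_sequentially by blast
  then show False using near[of n] norm_triangle_sub[of "(H ^^ n) (g t)" \<zeta>] by (simp add: dist_norm)
qed

end

section \<open>Indifferent landing points\<close>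

text \<open>The Fashoda theorem needs paths that join opposite sides of a box. Horizontal segments
  prolong \<open>p\<close> and vertical ones prolong \<open>q\<close> to the sides of a large box;
  the four inequalities keep these additions from creating intersections.\<close>

lemma paths_cross:
  fixes p q :: "real \<Rightarrow> complex"
  assumes p: "path p" and q: "path q"
    and left: "\<And>w. w \<in> path_image q \<Longrightarrow> Re (pathstart p) < Re w"
    and right: "\<And>w. w \<in> path_image q \<Longrightarrow> Re w < Re (pathfinish p)"
    and below: "\<And>w. w \<in> path_image p \<Longrightarrow> Im (pathstart q) < Im w"
    and above: "\<And>w. w \<in> path_image p \<Longrightarrow> Im w < Im (pathfinish q)"
  shows "path_image p \<inter> path_image q \<noteq> {}"
proof -
  have "bounded (path_image p \<union> path_image q)"
    using p q by (simp add: bounded_path_image)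
  then obtain B where B: "\<And>w. w \<in> path_image p \<union> path_image q \<Longrightarrow> norm w \<le> B"
    unfolding bounded_iff by blast
  have RI: "\<bar>Re w\<bar> \<le> B" "\<bar>Im w\<bar> \<le> B" if "w \<in> path_image p \<union> path_image q" for w
    using B[OF that] abs_Re_le_cmod[of w] abs_Im_le_cmod[of w] by linarith+
  let ?p0 = "pathstart p" and ?p1 = "pathfinish p" and ?q0 = "pathstart q" and ?q1 = "pathfinish q"
  have ends: "\<bar>Re ?p0\<bar> \<le> B" "\<bar>Im ?p0\<bar> \<le> B" "\<bar>Re ?p1\<bar> \<le> B" "\<bar>Im ?p1\<bar> \<le> B"
    "\<bar>Re ?q0\<bar> \<le> B" "\<bar>Im ?q0\<bar> \<le> B" "\<bar>Re ?q1\<bar> \<le> B" "\<bar>Im ?q1\<bar> \<le> B"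
    by (auto intro!: RI)
  define L1 where "L1 = linepath (Complex (-B) (Im ?p0)) ?p0"
  define L2 where "L2 = linepath ?p1 (Complex B (Im ?p1))"
  define V1 where "V1 = linepath (Complex (Re ?q0) (-B)) ?q0"
  define V2 where "V2 = linepath ?q1 (Complex (Re ?q1) B)"
  define P where "P = L1 +++ p +++ L2"
  define Q where "Q = V1 +++ q +++ V2"
  have PQ: "path P" "path Q" using p q by (auto simp: P_def Q_def L1_def L2_def V1_def V2_def)
  have pI: "path_image P = path_image L1 \<union> path_image p \<union> path_image L2"
    by (simp add: P_def L1_def L2_def path_image_join Un_assoc)
  have qI: "path_image Q = path_image V1 \<union> path_image q \<union> path_image V2"
    by (simp add: Q_def V1_def V2_def path_image_join Un_assoc)
  have L1: "Im w = Im ?p0" "-B \<le> Re w" "Re w \<le> Re ?p0" if "w \<in> path_image L1" for w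
    using that ends by (auto simp: L1_def closed_segment_same_Im closed_segment_eq_real_ivl abs_le_iff split: if_splits)
  have L2: "Im w = Im ?p1" "Re ?p1 \<le> Re w" "Re w \<le> B" if "w \<in> path_image L2" for w
    using that ends by (auto simp: L2_def closed_segment_same_Im closed_segment_eq_real_ivl abs_le_iff split: if_splits)
  have V1: "Re w = Re ?q0" "-B \<le> Im w" "Im w \<le> Im ?q0" if "w \<in> path_image V1" for w
    using that ends by (auto simp: V1_def closed_segment_same_Re closed_segment_eq_real_ivl abs_le_iff split: if_splits)
  have V2: "Re w = Re ?q1" "Im ?q1 \<le> Im w" "Im w \<le> B" if "w \<in> path_image V2" for w
    using that ends by (auto simp: V2_def closed_segment_same_Re closed_segment_eq_real_ivl abs_le_iff split: if_splits)
  define v where "v z = (\<chi> i::2. if i = 1 then Re z else Im z)" for z :: complex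
  have v12: "v z $ 1 = Re z" "v z $ 2 = Im z" for z by (simp_all add: v_def)
  have vinj: "z = w" if "v z = v w" for z w
    using that v12 by (metis complex_eqI)
  have vc: "continuous_on S v" for S
    unfolding v_def
  proof (intro continuous_on_vec_lambda)
    show "continuous_on S (\<lambda>x. if i = 1 then Re x else Im x)" for i :: 2
      by (cases "i = 1") (auto intro: continuous_intros)
  qed
  define a b :: "real ^ 2" where "a = (\<chi> i. -B)" and "b = (\<chi> i. B)"
  have "path_image P \<subseteq> {w. \<bar>Re w\<bar> \<le> B \<and> \<bar>Im w\<bar> \<le> B}"
  proof
    fix w assume "w \<in> path_image P"
    then consider "w \<in> path_image L1" | "w \<in> path_image p" | "w \<in> path_image L2" by (auto simp: pI)
    then show "w \<in> {w. \<bar>Re w\<bar> \<le> B \<and> \<bar>Im w\<bar> \<le> B}"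
    proof cases
      case 1 show ?thesis unfolding mem_Collect_eq using L1[OF 1] ends by (intro conjI; linarith)
    next
      case 2 show ?thesis unfolding mem_Collect_eq using RI[of w] 2 by blast
    next
      case 3 show ?thesis unfolding mem_Collect_eq using L2[OF 3] ends by (intro conjI; linarith)
    qed
  qed
  then have vP: "path_image (v \<circ> P) \<subseteq> cbox a b"
    by (auto simp: path_image_compose mem_box_cart forall_2 v12 a_def b_def abs_le_iff)
  have "path_image Q \<subseteq> {w. \<bar>Re w\<bar> \<le> B \<and> \<bar>Im w\<bar> \<le> B}"
  proof
    fix w assume "w \<in> path_image Q"
    then consider "w \<in> path_image V1" | "w \<in> path_image q" | "w \<in> path_image V2" by (auto simp: qI)
    then show "w \<in> {w. \<bar>Re w\<bar> \<le> B \<and> \<bar>Im w\<bar> \<le> B}"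
    proof cases
      case 1 show ?thesis unfolding mem_Collect_eq using V1[OF 1] ends by (intro conjI; linarith)
    next
      case 2 show ?thesis unfolding mem_Collect_eq using RI[of w] 2 by blast
    next
      case 3 show ?thesis unfolding mem_Collect_eq using V2[OF 3] ends by (intro conjI; linarith)
    qed
  qed
  then have vQ: "path_image (v \<circ> Q) \<subseteq> cbox a b"
    by (auto simp: path_image_compose mem_box_cart forall_2 v12 a_def b_def abs_le_iff)
  obtain z where "z \<in> path_image (v \<circ> P)" "z \<in> path_image (v \<circ> Q)"
  proof (rule fashoda [OF _ _ vP vQ])
    show "path (v \<circ> P)" "path (v \<circ> Q)" using PQ by (auto intro: path_continuous_image vc)
    show "pathstart (v \<circ> P) $ 1 = a $ 1" "pathfinish (v \<circ> P) $ 1 = b $ 1"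
      "pathstart (v \<circ> Q) $ 2 = a $ 2" "pathfinish (v \<circ> Q) $ 2 = b $ 2"
      by (simp_all add: pathstart_compose pathfinish_compose v12 a_def b_def P_def Q_def L1_def L2_def V1_def V2_def)
  qed
  then obtain w where w: "w \<in> path_image P" "w \<in> path_image Q"
    using vinj by (auto simp: path_image_compose)
  have q01: "?q0 \<in> path_image q" "?q1 \<in> path_image q" and p01: "?p0 \<in> path_image p" "?p1 \<in> path_image p" by auto
  have notL1: "w \<notin> path_image L1"
  proof
    assume "w \<in> path_image L1"
    from L1[OF this] w(2) V1[of w] V2[of w] left[of w] left[OF q01(1)] left[OF q01(2)] show False
      unfolding qI by auto
  qed
  have notL2: "w \<notin> path_image L2"
  proof
    assume "w \<in> path_image L2"
    from L2[OF this] w(2) V1[of w] V2[of w] right[of w] right[OF q01(1)] right[OF q01(2)] show False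
      unfolding qI by auto
  qed
  from notL1 notL2 w(1) have wp: "w \<in> path_image p" by (auto simp: pI)
  have "w \<notin> path_image V1" "w \<notin> path_image V2"
    using V1[of w] V2[of w] below[OF wp] above[OF wp] by auto
  then have "w \<in> path_image q" using w(2) by (auto simp: qI)
  then show ?thesis using wp by blast
qed

section \<open>Orbits trapped by an invariant curve in logarithmic coordinates\<close>

context ray_shift begin

text \<open>A point far to the left stays to the left of the curve \<open>l\<close>, which it cannot cross because
  \<open>Y\<close> is injective and maps \<open>l\<close> into itself; its orbit would have to leave the half-plane
  through a horizontal line blocked by \<open>l\<close>.\<close>

lemma log_trap:
  fixes Y :: "complex \<Rightarrow> complex" and l :: "real \<Rightarrow> complex"
  assumes t1: "t1 > 0" and \<alpha>: "\<alpha> > 0"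
    and Yc: "continuous_on {z. Re z < L} Y" and Yinj: "inj_on Y {z. Re z < L}"
    and Yest: "\<And>z. Re z < L \<Longrightarrow> norm (Y z - z - \<i> * of_real \<alpha>) \<le> \<alpha> / 4"
    and Yper: "\<And>z k. Y (z + of_real (2 * pi * of_int k) * \<i>) = Y z + of_real (2 * pi * of_int k) * \<i>"
    and lc: "continuous_on {0<..t1} l" and lL: "\<And>t. t \<in> {0<..t1} \<Longrightarrow> Re (l t) < L"
    and lY: "\<And>t. t \<in> {0<..t1} \<Longrightarrow> l (Gi t) = Y (l t)"
  shows "\<exists>K. \<forall>z. Re z \<le> K \<longrightarrow> (\<forall>n. Re ((Y ^^ n) z) < L)"
proof -
  have est: "Im z + 3/4 * \<alpha> \<le> Im (Y z)" "Im (Y z) \<le> Im z + 5/4 * \<alpha>" "Re (Y z) \<le> Re z + \<alpha>" if "Re z < L" for z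
  proof -
    have "\<bar>Im (Y z - z - \<i> * of_real \<alpha>)\<bar> \<le> \<alpha> / 4" "\<bar>Re (Y z - z - \<i> * of_real \<alpha>)\<bar> \<le> \<alpha> / 4"
      using Yest[OF that] abs_Im_le_cmod abs_Re_le_cmod order_trans by blast+
    then have "\<bar>Im (Y z) - Im z - \<alpha>\<bar> \<le> \<alpha> / 4" "\<bar>Re (Y z) - Re z\<bar> \<le> \<alpha> / 4" by simp_all
    then show "Im z + 3/4 * \<alpha> \<le> Im (Y z)" "Im (Y z) \<le> Im z + 5/4 * \<alpha>" "Re (Y z) \<le> Re z + \<alpha>"
      using \<alpha> by linarith+
  qed
  have Gi_in: "Gi t \<in> {0<..t1}" if "t \<in> {0<..t1}" for t
    using Gi_pos[of t] Gi_less[of t] that by simp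
  have Gin_in: "(Gi ^^ n) t \<in> {0<..t1}" if "t \<in> {0<..t1}" for t n
    by (induction n) (use that Gi_in in auto)
  have fc: "compact (l ` {Gi t1..t1})"
    by (intro compact_continuous_image continuous_on_subset [OF lc]) (use Gi_pos[OF t1] in auto)
  obtain m where m: "\<And>t. t \<in> {Gi t1..t1} \<Longrightarrow> \<bar>Im (l t)\<bar> \<le> m"
  proof -
    obtain m where "\<And>w. w \<in> l ` {Gi t1..t1} \<Longrightarrow> norm w \<le> m"
      using compact_imp_bounded [OF fc] unfolding bounded_iff by blast
    then show thesis using abs_Im_le_cmod order_trans by (intro that[of m]) blast
  qed
  have grow: "Im (l t) + real n * (3/4 * \<alpha>) \<le> Im (l ((Gi ^^ n) t))" if "t \<in> {0<..t1}" for t n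
  proof (induction n)
    case (Suc n)
    have "Im (l ((Gi ^^ n) t)) + 3/4 * \<alpha> \<le> Im (l ((Gi ^^ Suc n) t))"
      using est(1)[OF lL[OF Gin_in[OF that, of n]]] lY[OF Gin_in[OF that, of n]] by simp
    moreover have "real (Suc n) * (3/4 * \<alpha>) = real n * (3/4 * \<alpha>) + 3/4 * \<alpha>" by (simp add: algebra_simps)
    ultimately show ?case using Suc by linarith
  qed simp
  have high: "\<exists>\<tau>. 0 < \<tau> \<and> \<tau> \<le> t1 \<and> (\<forall>t. 0 < t \<and> t \<le> \<tau> \<longrightarrow> Im (l t) > C)" for C
  proof -
    obtain N :: nat where "C + m < of_nat N * (3/4 * \<alpha>)"
      using ex_less_of_nat_mult[of "3/4 * \<alpha>" "C + m"] \<alpha> by auto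
    then have N: "C + m < real N * (3/4 * \<alpha>)" by simp
    have "Im (l t) > C" if t: "0 < t" "t \<le> (Gi ^^ N) t1" for t
    proof -
      have tt: "t \<le> t1" using t Gin_antimono[OF t1, of 0 N] by simp
      obtain n s where s: "Gi t1 < s" "s \<le> t1" "t = (Gi ^^ n) s"
        by (rule fundamental_domain [OF t(1) tt])
      have "N \<le> n"
      proof (rule ccontr)
        assume "\<not> N \<le> n"
        then have "(Gi ^^ N) t1 \<le> (Gi ^^ Suc n) t1" by (intro Gin_antimono t1) simp
        also have "(Gi ^^ Suc n) t1 = (Gi ^^ n) (Gi t1)" by (simp add: funpow_swap1)
        also have "\<dots> < (Gi ^^ n) s" using s(1) Gi_pos[OF t1] by (intro Gin_mono)
        finally show False using t s by simp
      qed
      then have "real N * (3/4 * \<alpha>) \<le> real n * (3/4 * \<alpha>)" using \<alpha> by (intro mult_right_mono) auto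
      moreover have "Im (l s) + real n * (3/4 * \<alpha>) \<le> Im (l t)"
        unfolding s(3) by (rule grow) (use s Gi_pos[OF t1] in auto)
      moreover have "-m \<le> Im (l s)" using m[of s] s by auto
      ultimately show ?thesis using N by linarith
    qed
    then show ?thesis using Gin_pos[OF t1] Gin_antimono[OF t1, of 0 N]
      by (intro exI[of _ "(Gi ^^ N) t1"]) auto
  qed
  have lower: "\<exists>b. \<forall>t\<in>{\<tau>..t1}. b \<le> Re (l t)" if "\<tau> > 0" for \<tau>
  proof -
    have "compact (l ` {\<tau>..t1})"
      by (intro compact_continuous_image continuous_on_subset [OF lc]) (use that in auto)
    then have "bounded (l ` {\<tau>..t1})" by (rule compact_imp_bounded)
    then obtain b where b: "\<And>w. w \<in> l ` {\<tau>..t1} \<Longrightarrow> norm w \<le> b"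
      unfolding bounded_iff by blast
    have "-b \<le> Re (l t)" if "t \<in> {\<tau>..t1}" for t
      using b[of "l t"] that abs_Re_le_cmod[of "l t"] by (auto simp: abs_le_iff)
    then show ?thesis by blast
  qed
  \<comment> \<open>\<open>y0\<close> is above the arc of \<open>l\<close> over
    \<open>{Gi t1..t1}\<close>. A point of \<open>l\<close> at height \<open>y0\<close> or more
    hence has potential below \<open>Gi t1\<close>, so its preimage under \<open>Y\<close> on the
    curve still has potential at most \<open>t1\<close>.\<close>
  define y0 where "y0 = m + 1"
  obtain \<tau>0 where \<tau>0: "0 < \<tau>0" "\<tau>0 \<le> t1" "\<And>t. 0 < t \<Longrightarrow> t \<le> \<tau>0 \<Longrightarrow> Im (l t) > y0 + 2 * pi" using high by blast
  obtain b0 where b0: "\<And>t. t \<in> {\<tau>0..t1} \<Longrightarrow> b0 \<le> Re (l t)" using lower[OF \<tau>0(1)] by blast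
  \<comment> \<open>At the heights occurring in \<open>W\<close> the curve has potentials above
    \<open>\<tau>0\<close>, where its real part is at least \<open>b0\<close>. So \<open>W\<close>
    does not meet the curve.\<close>
  define K where "K = min b0 L - 1"
  define W where "W = {z. Re z \<le> K \<and> y0 \<le> Im z \<and> Im z \<le> y0 + 2 * pi}"
  \<comment> \<open>The induction is over all of \<open>W\<close> and not along one orbit, because
    the contradiction uses the image under \<open>Y ^^ n\<close> of a whole horizontal segment in
    \<open>W\<close>.\<close>
  have main: "z \<in> W \<Longrightarrow> Re ((Y ^^ n) z) < L" for z n
  proof (induction n arbitrary: z rule: less_induct)
    case (less n)
    have IH: "Re ((Y ^^ i) w) < L" if "i < n" "w \<in> W" for i w using less.IH that by blast
    have bds: "i \<le> n \<Longrightarrow> Im w + real i * (3/4 * \<alpha>) \<le> Im ((Y ^^ i) w) \<and> Im ((Y ^^ i) w) \<le> Im w + real i * (5/4 * \<alpha>) \<and> Re ((Y ^^ i) w) \<le> Re w + real i * \<alpha>"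
      if w: "w \<in> W" for w i
    proof (induction i)
      case (Suc i)
      have "Re ((Y ^^ i) w) < L" using IH Suc.prems w by simp
      note e = est[OF this]
      have ih: "Im w + real i * (3/4 * \<alpha>) \<le> Im ((Y ^^ i) w)" "Im ((Y ^^ i) w) \<le> Im w + real i * (5/4 * \<alpha>)"
        "Re ((Y ^^ i) w) \<le> Re w + real i * \<alpha>" using Suc by simp_all
      have "real (Suc i) * x = real i * x + x" for x by (simp add: algebra_simps)
      note * = this[of "3/4 * \<alpha>"] this[of "5/4 * \<alpha>"] this[of \<alpha>]
      show ?case unfolding funpow.simps comp_def by (intro conjI; use e ih * in linarith)
    qed simp
    have Wc: "i \<le> n \<Longrightarrow> continuous_on W (Y ^^ i)" for i
    proof (induction i)
      case (Suc i)
      have "continuous_on W (Y \<circ> (Y ^^ i))"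
        by (rule continuous_on_compose [OF _ continuous_on_subset [OF Yc]]) (use Suc IH in auto)
      then show ?case by simp
    qed (simp add: continuous_on_id)
    show ?case
    proof (rule ccontr)
      assume out: "\<not> Re ((Y ^^ n) z) < L"
      define C where "C = Im z + real n * (5/4 * \<alpha>)"
      obtain \<tau> where \<tau>: "0 < \<tau>" "\<tau> \<le> t1" "\<And>t. 0 < t \<Longrightarrow> t \<le> \<tau> \<Longrightarrow> Im (l t) > C" using high by blast
      obtain b where b: "\<And>t. t \<in> {\<tau>..t1} \<Longrightarrow> b \<le> Re (l t)" using lower[OF \<tau>(1)] by blast
      \<comment> \<open>A step moves at most \<open>\<alpha>\<close> to the right, so a point
        starting \<open>S\<close> to the left of \<open>z\<close> is still to the left of the
        relevant arc of \<open>l\<close> after \<open>n\<close> steps.\<close>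
      define S where "S = max 0 (Re z + real n * \<alpha> - b + 1)"
      have S: "S \<ge> 0" "Re z - S + real n * \<alpha> < b" by (auto simp: S_def)
      define e where "e s = z - of_real ((1 - s) * S)" for s :: real
      have eW: "e s \<in> W" "Im (e s) = Im z" if "s \<in> {0..1}" for s
      proof -
        have "(1 - s) * S \<ge> 0" using that S by simp
        then show "e s \<in> W" "Im (e s) = Im z" using less.prems by (auto simp: W_def e_def)
      qed
      define p where "p s = (Y ^^ n) (e s)" for s
      define q where "q s = l (linepath t1 \<tau> s)" for s
      have seg: "linepath t1 \<tau> s \<in> {\<tau>..t1}" if "s \<in> {0..1}" for s
      proof -
        have "linepath t1 \<tau> s \<in> closed_segment t1 \<tau>" using that by (rule linepath_in_path)
        then show ?thesis using \<tau> by (simp add: closed_segment_eq_real_ivl split: if_splits)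
      qed
      have pp: "path p"
        unfolding path_def p_def by (rule continuous_on_compose2 [OF Wc[of n]])
          (auto simp: eW e_def[abs_def] intro!: continuous_intros dest: eW(1)[unfolded e_def])
      have qq: "path q"
        unfolding path_def q_def by (rule continuous_on_compose2 [OF lc continuous_on_linepath]) (use seg \<tau> in fastforce)
      have pim: "Im z \<le> Im w" "Im w \<le> C" if "w \<in> path_image p" for w
      proof -
        obtain s where s: "s \<in> {0..1}" "w = (Y ^^ n) (e s)" using \<open>w \<in> path_image p\<close> by (auto simp: path_image_def p_def)
        have "Im (e s) + real n * (3/4 * \<alpha>) \<le> Im w" "Im w \<le> Im (e s) + real n * (5/4 * \<alpha>)"
          using bds[OF eW(1)[OF s(1)], of n] s(2) by auto
        moreover have "real n * (3/4 * \<alpha>) \<ge> 0" using \<alpha> by simp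
        ultimately show "Im z \<le> Im w" "Im w \<le> C" using eW(2)[OF s(1)] by (auto simp: C_def)
      qed
      have qim: "\<exists>t\<in>{\<tau>..t1}. w = l t" if "w \<in> path_image q" for w
        using that seg by (auto simp: path_image_def q_def)
      have ly0: "Im (l t) < y0" if "t \<in> {Gi t1..t1}" for t using m[OF that] by (simp add: y0_def abs_le_iff)
      have z0: "y0 \<le> Im z" using less.prems by (simp add: W_def)
      have "path_image p \<inter> path_image q \<noteq> {}"
      proof (rule paths_cross [OF pp qq])
        show "Re (pathstart p) < Re w" if "w \<in> path_image q" for w
        proof -
          have "Re (pathstart p) \<le> Re (e 0) + real n * \<alpha>"
            using bds[OF eW(1)[of 0], of n] by (simp add: pathstart_def p_def)
          also have "\<dots> < b" using S(2) by (simp add: e_def)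
          finally show ?thesis using qim[OF that] b by fastforce
        qed
        show "Re w < Re (pathfinish p)" if "w \<in> path_image q" for w
        proof -
          have "pathfinish p = (Y ^^ n) z" by (simp add: pathfinish_def p_def e_def)
          moreover have "Re w < L" using qim[OF that] lL \<tau> by fastforce
          ultimately show ?thesis using out by simp
        qed
        show "Im (pathstart q) < Im w" if "w \<in> path_image p" for w
          using pim(1)[OF that] z0 ly0[of t1] Gi_less[OF t1] by (simp add: pathstart_def q_def linepath_def)
        show "Im w < Im (pathfinish q)" if "w \<in> path_image p" for w
          using pim(2)[OF that] \<tau>(3)[of \<tau>] \<tau>(1) by (simp add: pathfinish_def q_def linepath_def)
      qed
      then obtain w where w: "w \<in> path_image p" "w \<in> path_image q" by blast
      obtain s where s: "s \<in> {0..1}" "w = (Y ^^ n) (e s)" using w(1) by (auto simp: path_image_def p_def)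
      define \<xi> where "\<xi> = e s"
      have \<xi>: "\<xi> \<in> W" using eW s by (simp add: \<xi>_def)
      obtain t where "t \<in> {\<tau>..t1}" "w = l t" using qim[OF w(2)] by blast
      then have t: "t \<in> {0<..t1}" "(Y ^^ n) \<xi> = l t" using s(2) \<tau>(1) by (auto simp: \<xi>_def)
      \<comment> \<open>Pulls the crossing point back along \<open>l\<close>: points of the orbit
        are above \<open>y0\<close>, so the preimage on the curve exists, and injectivity of
        \<open>Y\<close> identifies it with the previous orbit point. At time 0 this places
        \<open>\<xi>\<close> in \<open>W\<close> on the curve.\<close>
      have desc: "j \<le> n \<Longrightarrow> \<exists>t\<in>{0<..t1}. (Y ^^ (n - j)) \<xi> = l t" for j
      proof (induction j)
        case 0 then show ?case using t by auto
      next
        case (Suc j)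
        define i where "i = n - Suc j"
        have i: "n - j = Suc i" "i < n" using Suc.prems by (auto simp: i_def)
        obtain t where t: "t \<in> {0<..t1}" "Y ((Y ^^ i) \<xi>) = l t" using Suc i by auto
        have tGi: "t \<le> Gi t1"
        proof (rule ccontr)
          assume "\<not> t \<le> Gi t1"
          then have "Im (l t) < y0" using t(1) by (intro ly0) auto
          moreover have "Im \<xi> + real (Suc i) * (3/4 * \<alpha>) \<le> Im (l t)" using bds[OF \<xi>, of "Suc i"] i t(2) by simp
          moreover have "real (Suc i) * (3/4 * \<alpha>) \<ge> 0" using \<alpha> by simp
          moreover have "y0 \<le> Im \<xi>" using \<xi> by (simp add: W_def)
          ultimately show False by linarith
        qed
        have t0: "t > 0" using t(1) by simp
        have Gt: "G t \<in> {0<..t1}"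
        proof -
          have "\<not> t1 < G t" using Gi_mono[OF t1, of "G t"] Gi_G[OF t0] tGi by auto
          then show ?thesis using G_pos[OF t0] by simp
        qed
        have "Y ((Y ^^ i) \<xi>) = Y (l (G t))" using t(2) lY[OF Gt] Gi_G[OF t0] by simp
        then have "(Y ^^ i) \<xi> = l (G t)"
          using inj_onD [OF Yinj] IH[OF i(2) \<xi>] lL[OF Gt] by simp
        then show ?case using Gt by (auto simp: i_def)
      qed
      obtain t where t: "t \<in> {0<..t1}" "\<xi> = l t" using desc[of n] by auto
      have "\<not> t \<le> \<tau>0" using \<tau>0(3)[of t] t \<xi> by (auto simp: W_def)
      then have "b0 \<le> Re (l t)" using b0 t by simp
      moreover have "Re (l t) \<le> K" using \<xi> t(2) by (simp add: W_def)
      moreover have "K \<le> b0 - 1" by (simp add: K_def)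
      ultimately show False by linarith
    qed
  qed
  \<comment> \<open>\<open>W\<close> covers one vertical period; translation by multiples of
    \<open>2 * pi * \<i>\<close> extends the result to the half-plane.\<close>
  have per: "(Y ^^ n) (z + of_real (2 * pi * of_int k) * \<i>) = (Y ^^ n) z + of_real (2 * pi * of_int k) * \<i>" for n z k
    by (induction n) (simp_all only: funpow.simps comp_def id_def Yper)
  have "Re ((Y ^^ n) z) < L" if z: "Re z \<le> K" for z n
  proof -
    define k where "k = - \<lfloor>(Im z - y0) / (2 * pi)\<rfloor>"
    have k: "of_int k = - of_int \<lfloor>(Im z - y0) / (2 * pi)\<rfloor>" by (simp add: k_def)
    have "of_int \<lfloor>(Im z - y0) / (2 * pi)\<rfloor> * (2 * pi) \<le> Im z - y0"
      "Im z - y0 < (of_int \<lfloor>(Im z - y0) / (2 * pi)\<rfloor> + 1) * (2 * pi)"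
      by (intro floor_divide_lower floor_divide_upper; simp)+
    then have "z + of_real (2 * pi * of_int k) * \<i> \<in> W" using z by (auto simp: W_def k algebra_simps)
    from main[OF this, of n] show ?thesis unfolding per by simp
  qed
  then show ?thesis by blast
qed

text \<open>\<open>\<alpha>\<close> is the rotation angle selected by the logarithm \<open>l\<close>
  along the curve, so multiples of 2 pi are excluded too. Its sign fixes the direction in which the
  lifted curve climbs.\<close>

lemma no_rotation_aux:
  fixes Q :: "complex \<Rightarrow> complex" and l :: "real \<Rightarrow> complex"
  assumes \<rho>: "\<rho> > 0" and t1: "t1 > 0"
    and Q: "Q holomorphic_on ball 0 \<rho>" "Q 0 = \<i> * of_real \<alpha>" and \<alpha>: "\<alpha> > 0"
    and inj: "inj_on (\<lambda>z. z * exp (Q z)) (ball 0 \<rho>)"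
    and lc: "continuous_on {0<..t1} l"
    and lQ: "\<And>t. t \<in> {0<..t1} \<Longrightarrow> l (Gi t) = l t + Q (exp (l t))"
    and lim: "((\<lambda>t. exp (l t)) \<longlongrightarrow> 0) (at_right 0)"
  shows False
proof -
  define c where "c z = z * exp (Q z)" for z
  have "isCont Q 0" using Q(1) \<rho>
    by (metis centre_in_ball continuous_on_eq_continuous_at holomorphic_on_imp_continuous_on open_ball)
  moreover have "\<alpha> / 4 > 0" using \<alpha> by simp
  ultimately obtain \<rho>1 where \<rho>1: "\<rho>1 > 0" "\<And>x. dist x 0 < \<rho>1 \<Longrightarrow> dist (Q x) (Q 0) < \<alpha> / 4"
    unfolding continuous_at_eps_delta by blast
  define r where "r = min \<rho> \<rho>1"
  have r: "r > 0" "r \<le> \<rho>" "\<And>z. norm z < r \<Longrightarrow> norm (Q z - \<i> * of_real \<alpha>) \<le> \<alpha> / 4"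
    using \<rho> \<rho>1 Q(2) by (auto simp: r_def dist_norm less_imp_le)
  have inj_r: "inj_on c (ball 0 r)"
    unfolding c_def[abs_def] by (rule inj_on_subset [OF inj]) (use r in auto)
  have "eventually (\<lambda>t. dist (exp (l t)) 0 < r) (at_right 0)" using lim r(1) by (rule tendstoD)
  then obtain t2 where t2: "t2 > 0" "\<And>t. 0 < t \<Longrightarrow> t < t2 \<Longrightarrow> norm (exp (l t)) < r"
    unfolding eventually_at_right_field by auto
  define t3 where "t3 = min t1 (t2 / 2)"
  have t3: "t3 > 0" "t3 \<le> t1" "\<And>t. t \<in> {0<..t3} \<Longrightarrow> norm (exp (l t)) < r"
    using t1 t2 by (auto simp: t3_def)
  define L where "L = ln r"
  have expL: "norm (exp z) < r \<longleftrightarrow> Re z < L" for z :: complex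
    using r(1) by (simp add: L_def) (metis exp_less_cancel_iff exp_ln)
  \<comment> \<open>The lift of \<open>c\<close> by \<open>exp\<close>, close to the translation by
    \<open>\<i> * \<alpha>\<close> far to the left.\<close>
  define Y where "Y z = z + Q (exp z)" for z
  have expY: "exp (Y z) = c (exp z)" for z by (simp add: Y_def c_def exp_add)
  have "\<exists>K. \<forall>z. Re z \<le> K \<longrightarrow> (\<forall>n. Re ((Y ^^ n) z) < L)"
  proof (rule log_trap [OF t3(1) \<alpha>])
    have Qc: "continuous_on (ball 0 \<rho>) Q" using Q(1) by (rule holomorphic_on_imp_continuous_on)
    have "continuous_on {z. Re z < L} (\<lambda>z. Q (exp z))"
      by (rule continuous_on_compose2 [OF Qc]) (use expL r in \<open>force intro!: continuous_intros\<close>)+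
    then show "continuous_on {z. Re z < L} Y" unfolding Y_def by (intro continuous_intros)
    show "inj_on Y {z. Re z < L}"
    proof (rule inj_onI)
      fix x y assume xy: "x \<in> {z. Re z < L}" "y \<in> {z. Re z < L}" "Y x = Y y"
      have "c (exp x) = c (exp y)" using expY xy(3) by metis
      moreover have "exp x \<in> ball 0 r" "exp y \<in> ball 0 r" using xy(1,2) expL by auto
      ultimately have "exp x = exp y" using inj_r by (simp add: inj_on_eq_iff)
      then show "x = y" using xy(3) by (simp add: Y_def)
    qed
    show "norm (Y z - z - \<i> * of_real \<alpha>) \<le> \<alpha> / 4" if "Re z < L" for z
      using r(3)[of "exp z"] that expL[of z] by (simp add: Y_def)
    show "Y (z + of_real (2 * pi * of_int k) * \<i>) = Y z + of_real (2 * pi * of_int k) * \<i>" for z k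
    proof -
      have "exp (z + of_real (2 * pi * of_int k) * \<i>) = exp z"
        unfolding exp_eq by (intro exI[of _ k]) simp
      then show ?thesis by (simp add: Y_def)
    qed
    show "continuous_on {0<..t3} l" by (rule continuous_on_subset [OF lc]) (use t3 in auto)
    show "Re (l t) < L" if "t \<in> {0<..t3}" for t using t3(3)[OF that] expL by blast
    show "l (Gi t) = Y (l t)" if "t \<in> {0<..t3}" for t using lQ[of t] that t3 by (simp add: Y_def)
  qed
  then obtain K where K: "\<And>z n. Re z \<le> K \<Longrightarrow> Re ((Y ^^ n) z) < L" by blast
  define \<epsilon> where "\<epsilon> = exp K"
  have \<epsilon>: "\<epsilon> > 0" by (simp add: \<epsilon>_def)
  have c0: "c 0 = 0" by (simp add: c_def)
  have cn0: "(c ^^ n) 0 = 0" for n by (induction n) (auto simp: c0)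
  have expYn: "exp ((Y ^^ n) z) = (c ^^ n) (exp z)" for n z by (induction n) (auto simp: expY)
  have stay: "(c ^^ n) z \<in> ball 0 r" if "z \<in> ball 0 \<epsilon>" for z n
  proof (cases "z = 0")
    case False
    define w where "w = Ln z"
    have w: "z = exp w" using False by (simp add: w_def)
    then have "exp (Re w) < exp K" using that by (simp add: \<epsilon>_def)
    then have "Re w \<le> K" by simp
    then have "norm (exp ((Y ^^ n) w)) < r" using K expL by blast
    then show ?thesis by (simp add: expYn w)
  qed (simp add: cn0 r)
  have ch: "c holomorphic_on ball 0 r" unfolding c_def
    by (intro holomorphic_intros holomorphic_on_subset [OF Q(1)]) (use r in auto)
  have cnh: "(c ^^ n) holomorphic_on ball 0 \<epsilon>" for n
  proof (induction n)
    case (Suc n)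
    have "(c \<circ> (c ^^ n)) holomorphic_on ball 0 \<epsilon>"
      by (rule holomorphic_on_compose_gen [OF Suc ch]) (use stay in blast)
    then show ?case by (metis funpow.simps(2))
  qed (simp add: id_def)
  obtain h k where h: "h holomorphic_on ball 0 \<epsilon>" "strict_mono (k :: nat \<Rightarrow> nat)"
      "\<And>x. x \<in> ball 0 \<epsilon> \<Longrightarrow> (\<lambda>n. (c ^^ (k n)) x) \<longlonglongrightarrow> h x"
      "\<And>K. compact K \<Longrightarrow> K \<subseteq> ball 0 \<epsilon> \<Longrightarrow> uniform_limit K ((\<lambda>n. c ^^ n) \<circ> k) h sequentially"
  proof (rule Montel [of "ball 0 \<epsilon>" "range (\<lambda>n. c ^^ n)" "\<lambda>n. c ^^ n"])
    show "f holomorphic_on ball 0 \<epsilon>" if "f \<in> range (\<lambda>n. c ^^ n)" for f using that by (elim rangeE) (simp add: cnh)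
    show "\<exists>B. \<forall>h\<in>range (\<lambda>n. c ^^ n). \<forall>z\<in>K. norm (h z) \<le> B" if "compact K" "K \<subseteq> ball 0 \<epsilon>" for K
    proof (intro exI[of _ r] ballI)
      fix f z assume "f \<in> range (\<lambda>n. c ^^ n)" "z \<in> K"
      then obtain n where "f = c ^^ n" by (elim rangeE)
      moreover have "z \<in> ball 0 \<epsilon>" using that(2) \<open>z \<in> K\<close> by (rule subsetD)
      ultimately show "norm (f z) \<le> r" using stay[of z n] by simp
    qed
  qed auto
  have cl: "c (exp (l t)) = exp (l (Gi t))" if "t \<in> {0<..t1}" for t
    using lQ[OF that] by (simp add: c_def exp_add)
  have Gin_in: "(Gi ^^ n) t \<in> {0<..t1}" if "t \<in> {0<..t1}" for t n
    using Gin_pos[of t n] Gin_antimono[of t 0 n] that by simp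
  have cnl: "(c ^^ n) (exp (l t)) = exp (l ((Gi ^^ n) t))" if "t \<in> {0<..t1}" for t n
    by (induction n) (use cl[OF Gin_in[OF that]] in auto)
  have hl: "h (exp (l t)) = 0" if t: "t \<in> {0<..t1}" "exp (l t) \<in> ball 0 \<epsilon>" for t
  proof -
    have "filterlim (\<lambda>n. (Gi ^^ n) t) (at_right 0) sequentially"
      using Gin_lim[of t] Gin_pos[of t] t by (intro tendsto_imp_filterlim_at_right) auto
    then have "(\<lambda>n. exp (l ((Gi ^^ n) t))) \<longlonglongrightarrow> 0" by (rule filterlim_compose [OF lim])
    then have "(\<lambda>n. (c ^^ n) (exp (l t))) \<longlonglongrightarrow> 0" using cnl[OF t(1)] by simp
    then have "(\<lambda>n. (c ^^ (k n)) (exp (l t))) \<longlonglongrightarrow> 0"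
      using LIMSEQ_subseq_LIMSEQ [OF _ h(2)] by (force simp: comp_def)
    then show ?thesis using h(3)[OF t(2)] LIMSEQ_unique by blast
  qed
  \<comment> \<open>On the curve the iterates of \<open>c\<close> tend to 0, so \<open>h\<close>
    vanishes on \<open>U\<close>; as \<open>U\<close> accumulates at the interior point 0, the
    identity theorem gives \<open>h = 0\<close>.\<close>
  define U where "U = {z \<in> ball 0 \<epsilon>. \<exists>t\<in>{0<..t1}. z = exp (l t)}"
  have "0 islimpt U"
    unfolding islimpt_approachable
  proof (intro allI impI)
    fix e :: real assume "e > 0"
    then have "eventually (\<lambda>t. dist (exp (l t)) 0 < min e \<epsilon>) (at_right 0)" using lim \<epsilon> by (intro tendstoD) auto
    then obtain b where b: "b > 0" "\<And>t. 0 < t \<Longrightarrow> t < b \<Longrightarrow> dist (exp (l t)) 0 < min e \<epsilon>"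
      unfolding eventually_at_right_field by blast
    define t where "t = min t1 (b / 2)"
    have t: "t \<in> {0<..t1}" "t < b" using b t1 by (auto simp: t_def)
    then have "dist (exp (l t)) 0 < min e \<epsilon>" using b by auto
    then have "exp (l t) \<in> U" "dist (exp (l t)) 0 < e" using t by (auto simp: U_def)
    then show "\<exists>x'\<in>U. x' \<noteq> 0 \<and> dist x' 0 < e" by (intro bexI[of _ "exp (l t)"]) auto
  qed
  then have h0: "h z = 0" if "z \<in> ball 0 \<epsilon>" for z
    by (intro analytic_continuation [OF h(1) open_ball connected_ball, of U 0 z]) (use that \<epsilon> hl U_def in auto)
  define s where "s = \<epsilon> / 2"
  have s: "s > 0" "cball 0 s \<subseteq> ball (0::complex) \<epsilon>" using \<epsilon> by (auto simp: s_def)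
  have "eventually (\<lambda>n. \<forall>z\<in>cball 0 s. dist (((\<lambda>n. c ^^ n) \<circ> k) n z) (h z) < s / 2) sequentially"
    by (rule uniform_limitD [OF h(4)]) (use s in auto)
  then obtain n where n: "\<And>z. z \<in> cball 0 s \<Longrightarrow> dist (((\<lambda>n. c ^^ n) \<circ> k) n z) (h z) < s / 2"
    unfolding eventually_sequentially by blast
  define F where "F = c ^^ (k n)"
  have Fs: "norm (F z) \<le> s / 2" if "z \<in> cball 0 s" for z
    using n[OF that] h0[OF subsetD[OF s(2) that]] by (simp add: F_def less_imp_le)
  have Fh: "F holomorphic_on ball 0 \<epsilon>" by (simp add: F_def cnh)
  have "norm ((deriv ^^ 1) F 0) \<le> fact 1 * (s / 2) / s ^ 1"
  proof (rule Cauchy_inequality)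
    show "F holomorphic_on ball 0 s" by (rule holomorphic_on_subset [OF Fh]) (use s in auto)
    show "continuous_on (cball 0 s) F"
      by (rule continuous_on_subset [OF holomorphic_on_imp_continuous_on [OF Fh] s(2)])
    show "norm (F x) \<le> s / 2" if "norm (0 - x) = s" for x using Fs that by simp
  qed (rule s(1))
  then have le: "norm (deriv F 0) \<le> 1 / 2" using s(1) by simp
  have Qd: "(Q has_field_derivative deriv Q 0) (at 0)"
    using holomorphic_derivI [OF Q(1) open_ball] \<rho> by simp
  have cd: "(c has_field_derivative exp (Q 0)) (at 0)"
    unfolding c_def by (auto intro!: derivative_eq_intros Qd)
  have "((c ^^ m) has_field_derivative exp (Q 0) ^ m) (at 0)" for m
  proof (induction m)
    case (Suc m)
    have "((\<lambda>z. c ((c ^^ m) z)) has_field_derivative exp (Q 0) * exp (Q 0) ^ m) (at 0)"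
      by (rule DERIV_chain2 [OF _ Suc]) (use cd cn0 in simp)
    then show ?case by (simp add: comp_def)
  qed (simp add: id_def)
  then have "deriv F 0 = exp (Q 0) ^ k n" unfolding F_def by (rule DERIV_imp_deriv)
  then have "norm (deriv F 0) = 1" by (simp add: norm_power Q(2))
  then show False using le by simp
qed

text \<open>The quotient \<open>c z / z\<close>, completed at 0, has no zeros because
  \<open>c\<close> is injective with non-zero derivative at 0. Its logarithm can be adjusted to the
  logarithm of the curve.\<close>

lemma no_rotation:
  fixes c :: "complex \<Rightarrow> complex" and \<gamma> :: "real \<Rightarrow> complex"
  assumes \<rho>: "\<rho> > 0" and t1: "t1 > 0"
    and c: "c holomorphic_on ball 0 \<rho>" "inj_on c (ball 0 \<rho>)" "c 0 = 0" "norm (deriv c 0) = 1"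
    and \<gamma>: "continuous_on {0<..t1} \<gamma>" "\<And>t. t \<in> {0<..t1} \<Longrightarrow> \<gamma> t \<in> ball 0 \<rho> - {0}"
    and c\<gamma>: "\<And>t. t \<in> {0<..t1} \<Longrightarrow> \<gamma> (Gi t) = c (\<gamma> t)"
    and lim: "(\<gamma> \<longlongrightarrow> 0) (at_right 0)"
  shows "deriv c 0 = 1"
proof -
  define q where "q z = (if z = 0 then deriv c 0 else (c z - c 0) / (z - 0))" for z
  have qh: "q holomorphic_on ball 0 \<rho>" unfolding q_def[abs_def] by (rule pole_lemma [OF c(1)]) (use \<rho> in auto)
  have qnz: "q z \<noteq> 0" if "z \<in> ball 0 \<rho>" for z
  proof (cases "z = 0")
    case True
    then show ?thesis using c(4) by (auto simp: q_def)
  next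
    case False
    then have "c z \<noteq> c 0" using inj_onD [OF c(2), of z 0] that \<rho> by auto
    then show ?thesis using False by (simp add: q_def)
  qed
  obtain Q0 where Q0: "Q0 holomorphic_on ball 0 \<rho>" "\<And>z. z \<in> ball 0 \<rho> \<Longrightarrow> q z = exp (Q0 z)"
    by (rule contractible_imp_holomorphic_log [OF qh]) (use qnz convex_imp_contractible in auto)
  have cQ0: "c z = z * exp (Q0 z)" if "z \<in> ball 0 \<rho>" for z
    using Q0(2)[OF that] c(3) by (cases "z = 0") (auto simp: q_def field_simps)
  obtain l where l: "continuous_on {0<..t1} l" "\<And>t. t \<in> {0<..t1} \<Longrightarrow> \<gamma> t = exp (l t)"
    by (rule continuous_logarithm_on_contractible [OF \<gamma>(1)]) (use \<gamma>(2) convex_imp_contractible in auto)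
  have Gi_in: "Gi t \<in> {0<..t1}" if "t \<in> {0<..t1}" for t
    using Gi_pos[of t] Gi_less[of t] that by simp
  have in_ball: "\<gamma> t \<in> ball 0 \<rho>" if "t \<in> {0<..t1}" for t using \<gamma>(2)[OF that] by blast
  have step: "exp (l (Gi t)) = exp (l t + Q0 (\<gamma> t))" if "t \<in> {0<..t1}" for t
    using c\<gamma>[OF that] cQ0[OF in_ball[OF that]] l(2)[OF that] l(2)[OF Gi_in[OF that]] by (simp add: exp_add)
  have t1_in: "t1 \<in> {0<..t1}" using t1 by simp
  \<comment> \<open>A multiple of \<open>2 * pi * \<i>\<close> which makes the logarithm of
    \<open>c z / z\<close> equal to the actual increment of \<open>l\<close>, and not merely
    congruent to it.\<close>
  define \<kappa> where "\<kappa> = l (Gi t1) - (l t1 + Q0 (\<gamma> t1))"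
  have ek: "exp \<kappa> = 1" using step[OF t1_in] by (simp add: \<kappa>_def exp_diff)
  have lstep: "l t + Q0 (\<gamma> t) + \<kappa> = l (Gi t)" if t: "t \<in> {0<..t1}" for t
  proof (rule lift_unique [OF holomorphic_on_exp, where U = "{0<..t1}" and a = t1 and b = t
        and p = "\<lambda>t. l t + Q0 (\<gamma> t) + \<kappa>" and q = "\<lambda>t. l (Gi t)"])
    show "connected {0<..t1}" by (intro convex_connected) simp
    have "continuous_on {0<..t1} (\<lambda>t. Q0 (\<gamma> t))"
      by (rule continuous_on_compose2 [OF holomorphic_on_imp_continuous_on [OF Q0(1)] \<gamma>(1)]) (use in_ball in auto)
    then show "continuous_on {0<..t1} (\<lambda>t. l t + Q0 (\<gamma> t) + \<kappa>)" by (intro continuous_intros l)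
    show "continuous_on {0<..t1} (\<lambda>t. l (Gi t))"
      by (rule continuous_on_compose2 [OF l(1) continuous_on_subset [OF Gi_cont]]) (use Gi_in in auto)
    show "exp (l x + Q0 (\<gamma> x) + \<kappa>) = exp (l (Gi x))" if "x \<in> {0<..t1}" for x
      using step[OF that] ek by (simp add: exp_add)
    show "deriv exp (l x + Q0 (\<gamma> x) + \<kappa>) \<noteq> 0" for x by (simp add: DERIV_imp_deriv [OF DERIV_exp])
    show "l t1 + Q0 (\<gamma> t1) + \<kappa> = l (Gi t1)" by (simp add: \<kappa>_def)
  qed (use t t1_in in auto)
  define Q where "Q z = Q0 z + \<kappa>" for z
  have Qh: "Q holomorphic_on ball 0 \<rho>" unfolding Q_def by (intro holomorphic_intros Q0)
  have lQ: "l (Gi t) = l t + Q (exp (l t))" if "t \<in> {0<..t1}" for t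
    using lstep[OF that] l(2)[OF that] by (simp add: Q_def add.assoc)
  have cQ: "c z = z * exp (Q z)" if "z \<in> ball 0 \<rho>" for z
    using cQ0[OF that] ek by (simp add: Q_def exp_add)
  have injQ: "inj_on (\<lambda>z. z * exp (Q z)) (ball 0 \<rho>)"
    using c(2) inj_on_cong [of "ball 0 \<rho>" c "\<lambda>z. z * exp (Q z)", OF cQ] by simp
  have limQ: "((\<lambda>t. exp (l t)) \<longlongrightarrow> 0) (at_right 0)"
  proof (rule Lim_transform_eventually [OF lim])
    show "eventually (\<lambda>t. \<gamma> t = exp (l t)) (at_right 0)"
      unfolding eventually_at_right_field using l(2) t1 by (intro exI[of _ t1]) auto
  qed
  have dc: "deriv c 0 = exp (Q 0)" using Q0(2)[of 0] \<rho> ek by (simp add: q_def Q_def exp_add)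
  then have "Re (Q 0) = 0" using c(4) by simp
  then have Q00: "Q 0 = \<i> * of_real (Im (Q 0))" by (simp add: complex_eq_iff)
  have "\<not> Im (Q 0) > 0"
    using no_rotation_aux [OF \<rho> t1 Qh Q00 _ injQ l(1) lQ limQ] by blast
  \<comment> \<open>Complex conjugation reverses the sense of rotation and reduces this case to a
    positive angle.\<close>
  moreover have "\<not> - Im (Q 0) > 0"
  proof
    assume neg: "- Im (Q 0) > 0"
    have ballc: "cnj ` ball 0 \<rho> = ball 0 \<rho>"
    proof -
      have "z \<in> cnj ` ball 0 \<rho>" if "z \<in> ball 0 \<rho>" for z
        using that by (intro image_eqI[of z cnj "cnj z"]) auto
      then show ?thesis by auto
    qed
    show False
    proof (rule no_rotation_aux [OF \<rho> t1 _ _ neg, of "cnj \<circ> Q \<circ> cnj" "\<lambda>t. cnj (l t)"])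
      show "cnj \<circ> Q \<circ> cnj holomorphic_on ball 0 \<rho>"
        by (rule holomorphic_on_compose_cnj_cnj) (use Qh ballc in auto)
      show "(cnj \<circ> Q \<circ> cnj) 0 = \<i> * of_real (- Im (Q 0))"
        by (simp add: comp_def) (subst Q00, simp)
      show "inj_on (\<lambda>z. z * exp ((cnj \<circ> Q \<circ> cnj) z)) (ball 0 \<rho>)"
      proof (rule inj_onI)
        fix x y assume xy: "x \<in> ball 0 \<rho>" "y \<in> ball 0 \<rho>" "x * exp ((cnj \<circ> Q \<circ> cnj) x) = y * exp ((cnj \<circ> Q \<circ> cnj) y)"
        then have "cnj (x * exp ((cnj \<circ> Q \<circ> cnj) x)) = cnj (y * exp ((cnj \<circ> Q \<circ> cnj) y))" by metis
        then have "cnj x * exp (Q (cnj x)) = cnj y * exp (Q (cnj y))" by (simp add: exp_cnj)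
        then have "cnj x = cnj y" using inj_onD [OF injQ, of "cnj x" "cnj y"] xy by simp
        then show "x = y" by simp
      qed
      show "continuous_on {0<..t1} (\<lambda>t. cnj (l t))" by (intro continuous_intros l)
      show "cnj (l (Gi t)) = cnj (l t) + (cnj \<circ> Q \<circ> cnj) (exp (cnj (l t)))" if "t \<in> {0<..t1}" for t
        using lQ[OF that] by (simp add: exp_cnj)
      have "((\<lambda>t. cnj (exp (l t))) \<longlongrightarrow> cnj 0) (at_right 0)" using limQ by (intro tendsto_intros)
      then show "((\<lambda>t. exp (cnj (l t))) \<longlongrightarrow> 0) (at_right 0)" by (simp add: exp_cnj)
    qed
  qed
  ultimately have "Im (Q 0) = 0" by simp
  then have "Q 0 = 0" using Q00 by simp
  then show ?thesis using dc by simp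
qed

end

section \<open>The multiplier at the landing point\<close>

context escaping_ray begin

lemma multiplier_at_landing_point:
  assumes \<zeta>: "H \<zeta> = \<zeta>" "(g \<longlongrightarrow> \<zeta>) (at_right 0)"
  shows "norm (deriv H \<zeta>) > 1 \<or> deriv H \<zeta> = 1"
proof (rule disjCI)
  assume "deriv H \<zeta> \<noteq> 1"
  show "norm (deriv H \<zeta>) > 1"
  proof (rule ccontr)
    assume "\<not> norm (deriv H \<zeta>) > 1"
    then have n1: "norm (deriv H \<zeta>) = 1" using not_attracting [OF \<zeta>] by simp
    then have "deriv H \<zeta> \<noteq> 0" by auto
    then obtain \<delta> \<epsilon> \<xi> where L: "\<delta> > 0" "\<epsilon> > 0" "\<xi> holomorphic_on ball (H \<zeta>) \<delta>"
      "\<And>w. w \<in> ball (H \<zeta>) \<delta> \<Longrightarrow> H (\<xi> w) = w"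
      "\<And>x. dist x \<zeta> < \<epsilon> \<Longrightarrow> H x \<in> ball (H \<zeta>) \<delta> \<and> \<xi> (H x) = x"
      using local_inverse [OF H] by metis
    note L = L[unfolded \<zeta>(1)]
    have \<xi>0: "\<xi> \<zeta> = \<zeta>" using L(5)[of \<zeta>] L(2) \<zeta>(1) by simp
    define c where "c z = \<xi> (\<zeta> + z) - \<zeta>" for z
    have sh: "\<zeta> + z \<in> ball \<zeta> \<delta>" if "z \<in> ball 0 \<delta>" for z using that by (simp add: dist_norm)
    have "(\<lambda>z. \<xi> (\<zeta> + z)) holomorphic_on ball 0 \<delta>"
      by (rule holomorphic_on_compose_gen [of "\<lambda>z. \<zeta> + z" _ \<xi>, OF _ L(3), unfolded comp_def])
         (use sh in \<open>auto intro!: holomorphic_intros\<close>)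
    then have ch: "c holomorphic_on ball 0 \<delta>" unfolding c_def by (intro holomorphic_intros)
    have cinj: "inj_on c (ball 0 \<delta>)"
    proof (rule inj_onI)
      fix x y assume xy: "x \<in> ball 0 \<delta>" "y \<in> ball 0 \<delta>" "c x = c y"
      then have "H (\<xi> (\<zeta> + x)) = H (\<xi> (\<zeta> + y))" by (simp add: c_def)
      then show "x = y" using L(4)[OF sh[OF xy(1)]] L(4)[OF sh[OF xy(2)]] by simp
    qed
    have c0: "c 0 = 0" by (simp add: c_def \<xi>0)
    have dprod: "deriv H \<zeta> * deriv c 0 = 1"
    proof -
      have "(c has_field_derivative deriv c 0) (at 0)"
        using holomorphic_derivI [OF ch open_ball] L(1) by simp
      then have "((\<lambda>z. \<zeta> + c z) has_field_derivative deriv c 0) (at 0)"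
        by (auto intro!: derivative_eq_intros)
      moreover have "(H has_field_derivative deriv H \<zeta>) (at (\<zeta> + c 0))"
        using holomorphic_derivI [OF H open_UNIV] c0 by simp
      ultimately have d: "((\<lambda>z. H (\<zeta> + c z)) has_field_derivative deriv H \<zeta> * deriv c 0) (at 0)"
        by (intro DERIV_chain2)
      have "((\<lambda>z. \<zeta> + z) has_field_derivative deriv H \<zeta> * deriv c 0) (at 0)"
        by (rule has_field_derivative_transform_within_open [OF d open_ball, of 0 \<delta>])
           (use L(1) L(4)[OF sh] in \<open>auto simp: c_def\<close>)
      moreover have "((\<lambda>z. \<zeta> + z) has_field_derivative 1) (at 0)" by (auto intro!: derivative_eq_intros)
      ultimately show ?thesis by (rule DERIV_unique)
    qed
    then have "norm (deriv H \<zeta>) * norm (deriv c 0) = 1" by (metis norm_mult norm_one)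
    then have nc: "norm (deriv c 0) = 1" using n1 by simp
    have "eventually (\<lambda>t. dist (g t) \<zeta> < min \<delta> \<epsilon>) (at_right 0)" using \<zeta>(2) L(1,2) by (intro tendstoD) auto
    then obtain b where b: "b > 0" "\<And>t. 0 < t \<Longrightarrow> t < b \<Longrightarrow> dist (g t) \<zeta> < min \<delta> \<epsilon>"
      unfolding eventually_at_right_field by blast
    \<comment> \<open>\<open>\<delta>\<close> ensures that the inverse branch is defined at
      \<open>g t\<close>, and \<open>\<epsilon>\<close> that it sends \<open>g t\<close> to
      \<open>g (Gi t)\<close> and not to another preimage.\<close>
    have near: "dist (g t) \<zeta> < \<delta>" "dist (g t) \<zeta> < \<epsilon>" if "t \<in> {0<..b/2}" for t using b that by auto
    have "deriv c 0 = 1"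
    proof (rule no_rotation [OF L(1) _ ch cinj c0 nc, of "b / 2" "\<lambda>t. g t - \<zeta>"])
      show "continuous_on {0<..b/2} (\<lambda>t. g t - \<zeta>)"
        by (intro continuous_intros continuous_on_subset [OF g_cont]) auto
      show "g t - \<zeta> \<in> ball 0 \<delta> - {0}" if "t \<in> {0<..b/2}" for t
      proof -
        have "norm (g t - \<zeta>) < \<delta>" using near(1)[OF that] by (simp only: dist_norm)
        then have "g t - \<zeta> \<in> ball 0 \<delta>" by (simp only: mem_ball_0)
        then show ?thesis using not_fixed[of t] \<zeta>(1) that by auto
      qed
      show "g (Gi t) - \<zeta> = c (g t - \<zeta>)" if "t \<in> {0<..b/2}" for t
      proof -
        have "Gi t \<in> {0<..b/2}" using that Gi_pos[of t] Gi_less[of t] by simp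
        then have "\<xi> (H (g (Gi t))) = g (Gi t)" using near(2) L(5) by blast
        moreover have "H (g (Gi t)) = g t" using Hg[OF Gi_pos] G_Gi that by simp
        ultimately show ?thesis by (simp add: c_def)
      qed
      show "((\<lambda>t. g t - \<zeta>) \<longlongrightarrow> 0) (at_right 0)" using \<zeta>(2) by (simp add: LIM_zero)
    qed (use b in auto)
    then show False using dprod \<open>deriv H \<zeta> \<noteq> 1\<close> by simp
  qed
qed

theorem ray_lands:
  assumes nH: "\<not> filterlim H at_infinity at_infinity"
  obtains \<zeta> where "H \<zeta> = \<zeta>" "(g \<longlongrightarrow> \<zeta>) (at_right 0)" "norm (deriv H \<zeta>) > 1 \<or> deriv H \<zeta> = 1"
proof -
  have nc: "\<not> H constant_on UNIV"
  proof
    assume "H constant_on UNIV"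
    then have "H (g (G 1)) = H (g 1)" unfolding constant_on_def by auto
    then show False using Hg[of 1] not_fixed[of "G 1"] G_pos[of 1] by simp
  qed
  obtain p q where pq: "p \<in> P" "q \<in> P" "p \<noteq> q"
    by (rule card_ge_2_of_lifts_off [OF H nH lift P(3) nc P(1)])
  obtain \<zeta> where \<zeta>: "H \<zeta> = \<zeta>" "(g \<longlongrightarrow> \<zeta>) (at_right 0)"
    by (rule lands_unless_to_infinity [OF pq not_to_infinity [OF nH]])
  show thesis by (rule that [OF \<zeta> multiplier_at_landing_point [OF \<zeta>]])
qed

end

section \<open>Periodic rays\<close>

lemma transcendental_not_tendsto_infinity:
  assumes "transcendental_entire f"
  shows "\<not> filterlim f at_infinity at_infinity"
proof
  assume "filterlim f at_infinity at_infinity"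
  then have "((inverse \<circ> f) \<longlongrightarrow> 0) at_infinity"
    unfolding comp_def by (rule filterlim_compose [OF tendsto_inverse_0])
  then obtain a n where "\<And>z. f z = (\<Sum>i\<le>n. a i * z ^ i)"
    using pole_at_infinity assms unfolding transcendental_entire_def entire_def by metis
  then have "\<forall>z. f z = poly (\<Sum>i\<le>n. monom (a i) i) z"
    by (simp add: poly_sum poly_monom)
  then show False using assms unfolding transcendental_entire_def by blast
qed

lemma compose_not_tendsto_infinity:
  fixes K x :: "complex \<Rightarrow> complex"
  assumes K: "continuous_on UNIV K" and x: "\<not> filterlim x at_infinity at_infinity"
  shows "\<not> filterlim (\<lambda>z. K (x z)) at_infinity at_infinity"
proof
  assume lim: "filterlim (\<lambda>z. K (x z)) at_infinity at_infinity"
  obtain B where B: "\<not> eventually (\<lambda>z. B \<le> norm (x z)) at_infinity"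
    using x by (auto simp: filterlim_at_infinity [of 0])
  have "compact (K ` cball 0 B)" by (intro compact_continuous_image continuous_on_subset [OF K]) auto
  then have "bounded (K ` cball 0 B)" by (rule compact_imp_bounded)
  then obtain C where "\<forall>y\<in>K ` cball 0 B. norm y \<le> C" unfolding bounded_iff by blast
  then have C: "norm (K w) \<le> C" if "norm w \<le> B" for w using that by auto
  have "eventually (\<lambda>z. \<bar>C\<bar> + 1 \<le> norm (K (x z))) at_infinity"
    using lim by (subst (asm) filterlim_at_infinity [of 0]) auto
  then have "eventually (\<lambda>z. B \<le> norm (x z)) at_infinity"
  proof eventually_elim
    case (elim z)
    show ?case
    proof (rule ccontr)
      assume "\<not> B \<le> norm (x z)"
      then have "norm (K (x z)) \<le> C" by (intro C) simp
      with elim show False by linarith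
    qed
  qed
  then show False using B by simp
qed

lemma holomorphic_funpow:
  assumes "f holomorphic_on UNIV"
  shows "(f ^^ n) holomorphic_on UNIV"
proof (induction n)
  case (Suc n)
  have "(f \<circ> (f ^^ n)) holomorphic_on UNIV"
    using Suc assms by (rule holomorphic_on_compose_gen) auto
  then show ?case by (metis funpow.simps(2))
qed (simp add: id_def)

text \<open>The factor applied first, \<open>x\<close>, is transcendental and so does not tend to
  infinity. Whatever entire map follows is bounded on discs, so no iterate of \<open>f\<close> tends
  to infinity either.\<close>

lemma class_B_hat_props:
  assumes "f \<in> class_B_hat"
  shows "f holomorphic_on UNIV" "k \<ge> 1 \<Longrightarrow> \<not> filterlim (f ^^ k) at_infinity at_infinity"
proof -
  obtain fs where fs: "f = foldr (\<circ>) fs id" "fs \<noteq> []" "\<And>h. h \<in> set fs \<Longrightarrow> transcendental_entire h"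
    using assms unfolding class_B_hat_def by blast
  have fold: "foldr (\<circ>) gs id holomorphic_on UNIV" if "\<And>h. h \<in> set gs \<Longrightarrow> transcendental_entire h" for gs
    using that
  proof (induction gs)
    case (Cons h gs)
    have "foldr (\<circ>) gs id holomorphic_on UNIV" by (rule Cons.IH) (use Cons.prems in auto)
    moreover have "h holomorphic_on UNIV"
      using Cons.prems[of h] unfolding transcendental_entire_def entire_def by simp
    ultimately have "h \<circ> foldr (\<circ>) gs id holomorphic_on UNIV"
      by (rule holomorphic_on_compose_gen) simp
    moreover have "foldr (\<circ>) (h # gs) id = h \<circ> foldr (\<circ>) gs id" by simp
    ultimately show ?case by metis
  qed (simp add: id_def)
  show f: "f holomorphic_on UNIV" unfolding fs(1) by (rule fold) (rule fs(3))
  show "\<not> filterlim (f ^^ k) at_infinity at_infinity" if k: "k \<ge> 1"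
  proof -
    obtain ys x where yx: "fs = ys @ [x]" using fs(2) by (meson rev_exhaust)
    define X where "X = foldr (\<circ>) ys id"
    have foldx: "foldr (\<circ>) gs x = foldr (\<circ>) gs id \<circ> x" for gs :: "(complex \<Rightarrow> complex) list"
      by (induction gs) (auto simp: comp_assoc)
    have fX: "f = X \<circ> x" unfolding fs(1) yx X_def using foldx[of ys] by simp
    have Xh: "X holomorphic_on UNIV" unfolding X_def by (rule fold) (use fs(3) yx in auto)
    obtain m where m: "k = Suc m" using k by (cases k) auto
    have "(f ^^ k) = (\<lambda>z. ((f ^^ m) \<circ> X) (x z))"
      unfolding m by (subst funpow_Suc_right) (simp add: fun_eq_iff fX)
    moreover have "continuous_on UNIV ((f ^^ m) \<circ> X)"
      using holomorphic_funpow [OF f] Xh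
      by (intro continuous_on_compose holomorphic_on_imp_continuous_on) (auto intro: holomorphic_on_subset)
    moreover have "\<not> filterlim x at_infinity at_infinity"
      by (rule transcendental_not_tendsto_infinity) (use fs(3) yx in auto)
    ultimately show ?thesis using compose_not_tendsto_infinity by metis
  qed
qed

lemma postsingular_invariant:
  assumes f: "f holomorphic_on UNIV"
  shows "f ` postsingular_set f \<subseteq> postsingular_set f"
proof -
  define S where "S = (\<Union>n. (f ^^ n) ` singular_values f)"
  have "f ` closure S \<subseteq> closure (f ` S)"
    by (rule image_closure_subset [OF continuous_on_subset [OF holomorphic_on_imp_continuous_on [OF f]]])
       (auto simp: closure_subset)
  also have "f ` S \<subseteq> S"
  proof
    fix y assume "y \<in> f ` S"
    then obtain n s where "s \<in> singular_values f" "y = f ((f ^^ n) s)" unfolding S_def by blast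
    then show "y \<in> S" unfolding S_def by (intro UN_I[of "Suc n"]) auto
  qed
  then have "closure (f ` S) \<subseteq> closure S" by (rule closure_mono)
  finally show ?thesis by (simp add: postsingular_set_def S_def)
qed

lemma postsingular_lifts_off:
  assumes f: "f holomorphic_on UNIV"
  shows "lifts_off f (postsingular_set f)"
proof (rule lifts_offI [OF f])
  have "singular_values f \<subseteq> (\<Union>n. (f ^^ n) ` singular_values f)"
    by (rule subsetI, rule UN_I[of 0]) auto
  then have sub: "singular_values f \<subseteq> postsingular_set f"
    unfolding postsingular_set_def using closure_subset by (rule order_trans)
  show "asymptotic_values f \<subseteq> postsingular_set f" using sub unfolding singular_values_def by blast
  show "deriv f z \<noteq> 0" if "f z \<notin> postsingular_set f" for z
    using that sub unfolding singular_values_def critical_values_def by blast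
qed

text \<open>The model is an increasing bijection of the positive reals. The inverse is taken on
  \<open>{0<..}\<close>, as the values of \<open>F\<close> at negative arguments are
  arbitrary.\<close>

lemma ray_model_shift:
  assumes F: "ray_model F" and k: "k \<ge> 1"
  shows "ray_shift (F ^^ k) (inv_into {0<..} (F ^^ k))"
proof -
  have F0: "F 0 = 0" and Fc: "continuous_on {0..} F" and Fu: "\<not> bounded (F ` {0..})" and Fm: "strict_mono_on {0..} F"
    and Flim: "\<And>t. t > 0 \<Longrightarrow> filterlim (\<lambda>n. (F ^^ n) t) at_top sequentially" and Fn: "F ` {0..} \<subseteq> {0..}"
    using F unfolding ray_model_def by auto
  have less: "F s < F t" if "0 \<le> s" "s < t" for s t using Fm that by (auto simp: strict_mono_on_def)
  have pos: "F t > 0" if "t > 0" for t using less[of 0 t] that F0 by simp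
  have surj: "\<exists>s>0. F s = t" if t: "t > 0" for t
  proof -
    obtain u where u: "u \<ge> 0" "norm (F u) > t" using Fu unfolding bounded_iff by (force simp: not_le)
    have "F u \<ge> 0" using Fn u by auto
    then have "\<exists>s. 0 \<le> s \<and> s \<le> u \<and> F s = t"
      using u t F0 by (intro IVT' continuous_on_subset [OF Fc]) auto
    then show ?thesis using t F0 by (metis less_eq_real_def less_irrefl)
  qed
  define G where "G = F ^^ k"
  have Gpos: "(F ^^ n) t > 0" if "t > 0" for t n by (induction n) (auto simp: pos that)
  have Gless: "(F ^^ n) s < (F ^^ n) t" if "0 < s" "s < t" for s t n
    by (induction n) (auto simp: that less Gpos less_imp_le)
  have Gsurj: "\<exists>s>0. (F ^^ n) s = t" if "t > 0" for t n
    using that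
  proof (induction n arbitrary: t)
    case (Suc n)
    obtain s where s: "s > 0" "F s = t" using surj Suc.prems by blast
    then show ?case using Suc.IH[OF s(1)] by auto
  qed auto
  have inj: "inj_on G {0<..}"
    unfolding G_def by (rule inj_onI) (metis Gless greaterThan_iff less_irrefl linorder_less_linear)
  have img: "G ` {0<..} = {0<..}"
  proof
    show "{0<..} \<subseteq> G ` {0<..}"
    proof
      fix t :: real assume "t \<in> {0<..}"
      then obtain s where "s > 0" "G s = t" using Gsurj[of t k] by (auto simp: G_def)
      then show "t \<in> G ` {0<..}" by (intro image_eqI[of t G s]) auto
    qed
  qed (use Gpos in \<open>auto simp: G_def\<close>)
  define Gi where "Gi = inv_into {0<..} G"
  have Gipos: "Gi t > 0" if "t > 0" for t
    using inv_into_into[of t G "{0<..}"] img that by (simp add: Gi_def)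
  have GGi: "G (Gi t) = t" if "t > 0" for t
    unfolding Gi_def by (rule f_inv_into_f) (use img that in simp)
  have GiG: "Gi (G t) = t" if "t > 0" for t
    unfolding Gi_def by (rule inv_into_f_f [OF inj]) (use that in simp)
  have Gimono: "Gi s < Gi t" if "0 < s" "s < t" for s t
  proof (rule ccontr)
    assume "\<not> Gi s < Gi t"
    then consider "Gi t < Gi s" | "Gi t = Gi s" by linarith
    then show False
    proof cases
      case 1
      then have "G (Gi t) < G (Gi s)" unfolding G_def using Gless Gipos that by simp
      then show ?thesis using GGi that by simp
    next
      case 2
      then show ?thesis using GGi[of s] GGi[of t] that by simp
    qed
  qed
  have Giimg: "Gi ` {0<..} = {0<..}"
  proof
    show "{0<..} \<subseteq> Gi ` {0<..}"
    proof
      fix t :: real assume "t \<in> {0<..}"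
      then show "t \<in> Gi ` {0<..}" using GiG[of t] Gpos[of t k] by (intro image_eqI[of t Gi "G t"]) (auto simp: G_def)
    qed
  qed (use Gipos in auto)
  have "ray_shift G Gi"
  proof
    show "continuous_on {0<..} Gi"
      by (rule continuous_onI_mono) (use Giimg Gimono in \<open>auto simp: le_less\<close>)
    show "filterlim (\<lambda>n. (G ^^ n) t) at_top sequentially" if "t > 0" for t
    proof -
      have "filterlim (\<lambda>n. k * n) at_top sequentially"
        using k by (intro filterlim_subseq) (auto simp: strict_mono_def)
      from filterlim_compose [OF Flim [OF that] this] show ?thesis
        by (simp add: G_def funpow_mult mult.commute)
    qed
  qed (use Gpos Gipos GGi GiG Gimono in \<open>auto simp: G_def\<close>)
  then show ?thesis by (simp add: Gi_def G_def)
qed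

lemma deriv_funpow_fixpoint:
  assumes E: "E holomorphic_on UNIV" and p: "E p = (p :: complex)"
  shows "deriv (E ^^ m) p = deriv E p ^ m"
proof -
  have fix_: "(E ^^ m) p = p" for m by (induction m) (auto simp: p)
  have "((E ^^ m) has_field_derivative deriv E p ^ m) (at p)" for m
  proof (induction m)
    case (Suc m)
    have "((\<lambda>z. E ((E ^^ m) z)) has_field_derivative deriv E p * deriv E p ^ m) (at p)"
      by (rule DERIV_chain2 [OF _ Suc]) (use holomorphic_derivI [OF E open_UNIV] fix_ in simp)
    then show ?case by (simp add: comp_def)
  qed (simp add: id_def)
  then show ?thesis by (rule DERIV_imp_deriv)
qed

text \<open>The exact period \<open>q\<close> divides \<open>k\<close>, so the multiplier of
  \<open>f ^^ k\<close> is a power of that of \<open>f ^^ q\<close>. Multiplier 1 for the return map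
  of the ray thus becomes a root of unity for the cycle.\<close>

lemma repelling_or_parabolic:
  assumes f: "f holomorphic_on UNIV" and k: "k \<ge> 1" "(f ^^ k) p = p"
    and mult: "norm (deriv (f ^^ k) p) > 1 \<or> deriv (f ^^ k) p = 1"
  shows "(\<exists>q. has_period f q p) \<and> (repelling_point f p \<or> parabolic_point f p)"
proof -
  define q where "q = (LEAST q. q \<ge> 1 \<and> (f ^^ q) p = p)"
  have q: "q \<ge> 1 \<and> (f ^^ q) p = p" unfolding q_def by (rule LeastI[of _ k]) (use k in simp)
  have least: "(f ^^ j) p \<noteq> p" if "1 \<le> j" "j < q" for j
    using not_less_Least[of j "\<lambda>q. q \<ge> 1 \<and> (f ^^ q) p = p"] that unfolding q_def by blast
  have per: "has_period f q p" using q least unfolding has_period_def by blast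
  have mq: "((f ^^ q) ^^ m) p = p" for m by (induction m) (use q in auto)
  have "k mod q = 0"
  proof (rule ccontr)
    assume r: "k mod q \<noteq> 0"
    have "(f ^^ k) p = (f ^^ (k mod q + q * (k div q))) p" by simp
    also have "\<dots> = (f ^^ (k mod q)) (((f ^^ q) ^^ (k div q)) p)"
      by (simp only: funpow_add funpow_mult comp_apply mult.commute)
    finally have "(f ^^ (k mod q)) p = p" using k(2) mq by simp
    then show False using least[of "k mod q"] r q by simp
  qed
  then obtain m where m: "k = q * m" by (metis dvd_def mod_0_imp_dvd)
  have m1: "m \<ge> 1" using m k(1) by (cases m) auto
  define \<mu> where "\<mu> = deriv (f ^^ q) p"
  have "f ^^ k = (f ^^ q) ^^ m" by (simp add: m funpow_mult)
  then have dk: "deriv (f ^^ k) p = \<mu> ^ m"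
    using deriv_funpow_fixpoint [OF holomorphic_funpow [OF f, of q], of p m] q by (simp add: \<mu>_def)
  from mult show ?thesis
  proof
    assume "norm (deriv (f ^^ k) p) > 1"
    then have "norm \<mu> ^ m > 1" by (simp add: dk norm_power)
    then have "norm \<mu> > 1" by (metis norm_ge_zero not_le power_le_one)
    then show ?thesis using per unfolding repelling_point_def \<mu>_def by blast
  next
    assume "deriv (f ^^ k) p = 1"
    then have "\<mu> ^ m = 1" by (simp add: dk)
    then show ?thesis using per m1 unfolding parabolic_point_def \<mu>_def by blast
  qed
qed

theorem mainTheorem1:
  fixes f :: "complex \<Rightarrow> complex"
  assumes "f \<in> class_B_hat"
    and "bounded (postsingular_set f)"
  shows "\<forall>g :: real \<Rightarrow> complex. periodic_ray f g \<longrightarrow>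
           (\<exists>p. (g \<longlongrightarrow> p) (at_right 0) \<and>
                (\<exists>q. has_period f q p) \<and>
                (repelling_point f p \<or> parabolic_point f p))"
proof (intro allI impI)
  fix g :: "real \<Rightarrow> complex" assume "periodic_ray f g"
  then obtain k F where k: "k \<ge> 1" and F: "dynamic_ray f F g" "ray_returns f F g k"
    unfolding periodic_ray_def k_periodic_ray_def by blast
  from F(1) have ray: "ray_model F" "continuous_on {0<..} g" "\<And>t. t > 0 \<Longrightarrow> escaping f (g t)"
    by (auto elim: dynamic_ray.cases)
  have f: "f holomorphic_on UNIV" by (rule class_B_hat_props(1) [OF assms(1)])
  interpret ray_shift "F ^^ k" "inv_into {0<..} (F ^^ k)" by (rule ray_model_shift [OF ray(1) k])
  have P: "f ` postsingular_set f \<subseteq> postsingular_set f" by (rule postsingular_invariant [OF f])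
  have Pk: "(f ^^ n) ` postsingular_set f \<subseteq> postsingular_set f" for n
  proof (induction n)
    case (Suc n)
    have "(f ^^ Suc n) ` postsingular_set f = f ` ((f ^^ n) ` postsingular_set f)" by (simp add: image_comp)
    also have "\<dots> \<subseteq> postsingular_set f" using Suc P by (meson image_mono order_trans)
    finally show ?case .
  qed simp
  \<comment> \<open>The post-singular set of \<open>f\<close> itself serves for
    \<open>f ^^ k\<close>: invariance and the lifting property both pass to iterates.\<close>
  interpret escaping_ray "F ^^ k" "inv_into {0<..} (F ^^ k)" "f ^^ k" "postsingular_set f" g
  proof
    show "lifts_off (f ^^ k) (postsingular_set f)"
      by (rule lifts_off_funpow [OF postsingular_lifts_off [OF f] P])
    show "closed (postsingular_set f)" by (simp add: postsingular_set_def)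
    show "(f ^^ k) (g t) = g ((F ^^ k) t)" if "t > 0" for t
      using F(2) that unfolding ray_returns_def by blast
    show "filterlim (\<lambda>n. ((f ^^ k) ^^ n) (g t)) at_infinity sequentially" if "t > 0" for t
    proof -
      have "filterlim (\<lambda>n. k * n) at_top sequentially"
        using k by (intro filterlim_subseq) (auto simp: strict_mono_def)
      from filterlim_compose [OF ray(3) [OF that, unfolded escaping_def] this] show ?thesis
        by (simp add: funpow_mult mult.commute)
    qed
  qed (use assms(2) ray(2) Pk holomorphic_funpow [OF f] in auto)
  obtain p where p: "(f ^^ k) p = p" "(g \<longlongrightarrow> p) (at_right 0)"
    "norm (deriv (f ^^ k) p) > 1 \<or> deriv (f ^^ k) p = 1"
    by (rule ray_lands [OF class_B_hat_props(2) [OF assms(1) k]])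
  then show "\<exists>p. (g \<longlongrightarrow> p) (at_right 0) \<and> (\<exists>q. has_period f q p) \<and> (repelling_point f p \<or> parabolic_point f p)"
    using repelling_or_parabolic [OF f k p(1,3)] by blast
qed

end
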